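(* Suppose that either $d=4$ and $1\le s<2$, or $d\ge5$ and $1\le s\le\frac{d+2}3$. Then there is a constant $C$ such that, for every $V\in\ell^s(\mathbb Z^d)$ (complex-valued), $$\sup_{z\in\mathbb C\setminus\mathbb R}\left\||V|^{1/2}R_0(z)V^{1/2}\right\|_{\mathcal B(\ell^2(\mathbb Z^d))}\le C\|V\|_{\ell^s}.$$ If moreover $V\in\ell^s(\mathbb Z^d)$ is real-valued, then there exists $\gamma_0>0$ such that $H_0+\gamma V$ is unitarily equivalent to $H_0$ whenever $\gamma\in\mathbb R$ and $|\gamma|<\gamma_0$.
   Context: The discrete Laplacian $H_0$ on $\ell^2(\mathbb Z^d)$ is the Fourier multiplier (with $\widehat f(\xi)=\sum_{n}f(n)e^{-2\pi i n\cdot\xi}$ on $\mathbb T^d=(-1/2,1/2]^d$) with symbol $h_0(\xi)=4\sum_{j=1}^d\sin^2(\pi\xi_j)$, and $R_0(z)=(H_0-z)^{-1}$ for $z\in\mathbb C\setminus[0,4d]$. Functions on $\mathbb Z^d$ also denote the corresponding multiplication operators. For complex-valued $V$ on $\mathbb Z^d$, $V^{1/2}(n)=V(n)/|V(n)|^{1/2}$ if $V(n)\ne0$ and $V^{1/2}(n)=0$ if $V(n)=0$, so that $V=|V|^{1/2}V^{1/2}$. *)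

theory Defs
  imports "HOL-Analysis.Analysis"
begin

section \<open>The spaces \<open>\<ell>\<^sup>p\<close> and bounded operators on \<open>\<ell>\<^sup>2\<close>\<close>

definition lp_space :: "real \<Rightarrow> ('a \<Rightarrow> complex) set" where
  "lp_space p = {f. (\<lambda>n. norm (f n) powr p) summable_on UNIV}"

definition lp_norm :: "real \<Rightarrow> ('a \<Rightarrow> complex) \<Rightarrow> real" where
  "lp_norm p f = (\<Sum>\<^sub>\<infinity>n. norm (f n) powr p) powr (1 / p)"

definition l2_inner :: "('a \<Rightarrow> complex) \<Rightarrow> ('a \<Rightarrow> complex) \<Rightarrow> complex" where
  "l2_inner f g = (\<Sum>\<^sub>\<infinity>n. f n * cnj (g n))"

text \<open>
  Operators on \<open>\<ell>\<^sup>2\<close> are functions on all sequences, of which only the restriction to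
  \<open>lp_space 2\<close> matters.
\<close>

definition linear_op :: "(('a \<Rightarrow> complex) \<Rightarrow> 'a \<Rightarrow> complex) \<Rightarrow> bool" where
  "linear_op A \<longleftrightarrow>
     (\<forall>f\<in>lp_space 2. A f \<in> lp_space 2) \<and>
     (\<forall>f\<in>lp_space 2. \<forall>g\<in>lp_space 2. A (\<lambda>n. f n + g n) = (\<lambda>n. A f n + A g n)) \<and>
     (\<forall>c. \<forall>f\<in>lp_space 2. A (\<lambda>n. c * f n) = (\<lambda>n. c * A f n))"

definition bounded_op :: "(('a \<Rightarrow> complex) \<Rightarrow> 'a \<Rightarrow> complex) \<Rightarrow> bool" where
  "bounded_op A \<longleftrightarrow>
     linear_op A \<and> (\<exists>K. \<forall>f\<in>lp_space 2. lp_norm 2 (A f) \<le> K * lp_norm 2 f)"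

text \<open>
  The norm of \<open>\<B>(\<ell>\<^sup>2)\<close>, with value \<open>\<infinity>\<close> for anything that is not a bounded linear operator
  on \<open>\<ell>\<^sup>2\<close>. A finite bound on \<open>op_norm A\<close> thus includes the claim that \<open>A\<close> is bounded.
\<close>

definition op_norm :: "(('a \<Rightarrow> complex) \<Rightarrow> 'a \<Rightarrow> complex) \<Rightarrow> ennreal" where
  "op_norm A =
     (if bounded_op A
      then ennreal (SUP f\<in>{f \<in> lp_space 2. lp_norm 2 f \<le> 1}. lp_norm 2 (A f))
      else \<infinity>)"

definition mult_op :: "('a \<Rightarrow> complex) \<Rightarrow> ('a \<Rightarrow> complex) \<Rightarrow> 'a \<Rightarrow> complex" where
  "mult_op V f = (\<lambda>n. V n * f n)"

definition unitary_op :: "(('a \<Rightarrow> complex) \<Rightarrow> 'a \<Rightarrow> complex) \<Rightarrow> bool" where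
  "unitary_op U \<longleftrightarrow>
     linear_op U \<and> bij_betw U (lp_space 2) (lp_space 2) \<and>
     (\<forall>f\<in>lp_space 2. \<forall>g\<in>lp_space 2. l2_inner (U f) (U g) = l2_inner f g)"

text \<open>For everywhere defined operators on \<open>\<ell>\<^sup>2\<close>; the equation says \<open>A = U B U\<^sup>-\<^sup>1\<close>.\<close>

definition unitarily_equivalent ::
  "(('a \<Rightarrow> complex) \<Rightarrow> 'a \<Rightarrow> complex) \<Rightarrow> (('a \<Rightarrow> complex) \<Rightarrow> 'a \<Rightarrow> complex) \<Rightarrow> bool" where
  "unitarily_equivalent A B \<longleftrightarrow>
     (\<exists>U. unitary_op U \<and> (\<forall>f\<in>lp_space 2. A (U f) = U (B f)))"


section \<open>Fourier multipliers and the discrete Laplacian\<close>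

definition torus :: "(real ^ 'd) set" where
  "torus = {\<xi>. \<forall>j. - 1 / 2 < \<xi> $ j \<and> \<xi> $ j \<le> 1 / 2}"

definition torus_L2 :: "(real ^ 'd \<Rightarrow> complex) set" where
  "torus_L2 = {F. F \<in> borel_measurable (lebesgue_on torus) \<and>
                  integrable (lebesgue_on torus) (\<lambda>\<xi>. (norm (F \<xi>))\<^sup>2)}"

text \<open>
  \<open>fourier_transform f F\<close>: the function \<open>F\<close> represents the transform
  \<open>\<Sum>n. f(n) exp(- 2 \<pi> i n \<cdot> \<xi>)\<close> of \<open>f \<in> \<ell>\<^sup>2\<close>, where the series
  converges unconditionally in \<open>L\<^sup>2\<close> of the torus. \<open>F\<close> is determined up to null sets, which is why
  this is a relation.
\<close>

definition fourier_transform :: "(int ^ 'd \<Rightarrow> complex) \<Rightarrow> (real ^ 'd \<Rightarrow> complex) \<Rightarrow> bool" where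
  "fourier_transform f F \<longleftrightarrow> f \<in> lp_space 2 \<and> F \<in> torus_L2 \<and>
     ((\<lambda>A. LINT \<xi>|lebesgue_on torus.
          (norm (F \<xi> - (\<Sum>n\<in>A. f n * cis (- 2 * pi * (\<Sum>j\<in>UNIV. of_int (n $ j) * \<xi> $ j)))))\<^sup>2)
        \<longlongrightarrow> 0) (finite_subsets_at_top UNIV)"

definition fourier_multiplier ::
  "(real ^ 'd \<Rightarrow> complex) \<Rightarrow> (int ^ 'd \<Rightarrow> complex) \<Rightarrow> int ^ 'd \<Rightarrow> complex" where
  "fourier_multiplier m f =
     (THE g. \<exists>F. fourier_transform f F \<and> fourier_transform g (\<lambda>\<xi>. m \<xi> * F \<xi>))"

definition laplace_symbol :: "real ^ 'd \<Rightarrow> real" where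
  "laplace_symbol \<xi> = 4 * (\<Sum>j\<in>UNIV. (sin (pi * \<xi> $ j))\<^sup>2)"

definition discrete_laplacian :: "(int ^ 'd \<Rightarrow> complex) \<Rightarrow> int ^ 'd \<Rightarrow> complex" where
  "discrete_laplacian = fourier_multiplier (\<lambda>\<xi>. complex_of_real (laplace_symbol \<xi>))"

text \<open>The resolvent \<open>(H\<^sub>0 - z)\<^sup>-\<^sup>1\<close>, meaningful on \<open>\<ell>\<^sup>2\<close> for \<open>z\<close> outside \<open>[0, 4d]\<close>.\<close>

definition free_resolvent :: "complex \<Rightarrow> (int ^ 'd \<Rightarrow> complex) \<Rightarrow> int ^ 'd \<Rightarrow> complex" where
  "free_resolvent z = the_inv_into (lp_space 2) (\<lambda>u n. discrete_laplacian u n - z * u n)"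

definition abs_sqrt :: "('a \<Rightarrow> complex) \<Rightarrow> 'a \<Rightarrow> complex" where
  "abs_sqrt V n = complex_of_real (sqrt (norm (V n)))"

definition signed_sqrt :: "('a \<Rightarrow> complex) \<Rightarrow> 'a \<Rightarrow> complex" where
  "signed_sqrt V n =
     (if V n = 0 then 0 else V n / complex_of_real (sqrt (norm (V n))))"

end

theory Submission
  imports Defs "HOL-Complex_Analysis.Complex_Analysis"
begin

text \<open>
  The kernel of exp(-i t H_0) is a product of one-dimensional kernels, whose oscillatory integral
  representation gives, for exactly the exponents s in question, a bound on the integral of
  (1 + |t|)^(s - 1) times the absolute value of the kernel that is uniform in the lattice point.
  The integrals of (1 + t)^\<zeta> exp(i t z) exp(-i t H_0) over t > 0 form an analytic family; for
  Re \<zeta> = -1 their products with \<zeta> + 1 are Fourier multipliers with bounded symbols, for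
  Re \<zeta> = s - 1 they have bounded kernels. Interpolating at \<zeta> = 0 gives the resolvent bound.
  For real V and small \<gamma> the second resolvent identity carries the bound over to
  H_0 + \<gamma> V, so |V|^(1/2) is smooth in Kato's sense for both operators. The wave operators
  are constructed in discrete time, as limits of U^(-n) U_0^n for the Cayley transforms U, U_0, which
  avoids the functional calculus; smoothness makes both of them exist, and they are inverse to
  each other.
\<close>

text \<open>The obstacle is uniformity in the lattice point. A one-dimensional kernel at m has its
  turning point at t = |m| / 2, where only the decay t^(-1/3) is available. Taking the supremum over
  m before integrating would charge t^(-d/3) to every t; for fixed m the bad window has width about
  |m|^(1/3) only, and this gains 2/3 in the exponent. The window accounts for s - 1 \<le> (d - 1) /
  3; for d = 4 the bound beyond it is t^(s-2) / (t - |m| / 2), whose integral is logarithmic at s =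
  2. In the analytic family the factor \<zeta> + 1 cancels the logarithm at \<zeta> = -1,
  exp(\<zeta>^2) absorbs the polynomial growth in Im \<zeta>, and both equal 1 at \<zeta> = 0. On
  the perturbation side |V|^(1/2) stands on both sides of the resolvent, while \<gamma> and the
  phase of V form a bounded operator between the two weights. Sums over discrete time are reached
  from resolvents by a finite Fourier transform over the L-th roots of unity, with L and then the
  damping sent to their limits.\<close>

section \<open>Square-summable sequences as a complete inner product space\<close>

lemma lp_space_2_iff: "f \<in> lp_space 2 \<longleftrightarrow> (\<lambda>n. (cmod (f n))\<^sup>2) summable_on UNIV"
  by (simp add: lp_space_def)

lemma lp_space_2_add:
  assumes "f \<in> lp_space 2" "g \<in> lp_space 2"
  shows "(\<lambda>n. f n + g n) \<in> lp_space 2"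
proof -
  have s: "(\<lambda>n. 2 * (cmod (f n))\<^sup>2 + 2 * (cmod (g n))\<^sup>2) summable_on UNIV"
    using assms unfolding lp_space_2_iff by (intro summable_on_add summable_on_cmult_right)
  have b: "(cmod (f n + g n))\<^sup>2 \<le> 2 * (cmod (f n))\<^sup>2 + 2 * (cmod (g n))\<^sup>2" for n
  proof -
    have "(cmod (f n + g n))\<^sup>2 \<le> (cmod (f n) + cmod (g n))\<^sup>2"
      by (intro power_mono norm_triangle_ineq) auto
    also have "\<dots> \<le> 2 * (cmod (f n))\<^sup>2 + 2 * (cmod (g n))\<^sup>2"
      using sum_squares_bound[of "cmod (f n)" "cmod (g n)"] by (simp add: power2_sum)
    finally show ?thesis .
  qed
  show ?thesis unfolding lp_space_2_iff
    by (rule summable_on_comparison_test[OF s]) (use b in auto)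
qed

lemma lp_space_2_mult:
  assumes "f \<in> lp_space 2" "\<And>n. cmod (c n) \<le> B"
  shows "(\<lambda>n. c n * f n) \<in> lp_space 2"
proof -
  have s: "(\<lambda>n. B\<^sup>2 * (cmod (f n))\<^sup>2) summable_on UNIV"
    using assms unfolding lp_space_2_iff by (intro summable_on_cmult_right)
  have "(cmod (c n * f n))\<^sup>2 \<le> B\<^sup>2 * (cmod (f n))\<^sup>2" for n
    unfolding norm_mult power_mult_distrib by (intro mult_right_mono power_mono assms) auto
  then show ?thesis unfolding lp_space_2_iff
    by (intro summable_on_comparison_test[OF s]) auto
qed

text \<open>As a type the space becomes an instance of \<open>real_inner\<close> and
  \<open>complete_space\<close>, so that bounded linear maps, limits and the Banach fixed point
  theorem apply without carrier sets. Results return to \<open>lp_space 2\<close> through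
  \<open>coord\<close> and \<open>ell2_of\<close>.\<close>

typedef 'a ell2 = "lp_space 2 :: ('a \<Rightarrow> complex) set" morphisms coord ell2_of
proof
  show "(\<lambda>_. 0) \<in> lp_space 2" by (simp add: lp_space_2_iff)
qed

setup_lifting type_definition_ell2

lemma ell2_eqI: "(\<And>n. coord x n = coord y n) \<Longrightarrow> x = y"
  by (simp add: coord_inject[symmetric] fun_eq_iff)

lemma coord_in_lp_space [simp]: "coord x \<in> lp_space 2"
  using coord by auto

instantiation ell2 :: (type) real_vector
begin

lift_definition zero_ell2 :: "'a ell2" is "\<lambda>_. 0"
  by (simp add: lp_space_2_iff)
lift_definition plus_ell2 :: "'a ell2 \<Rightarrow> 'a ell2 \<Rightarrow> 'a ell2" is "\<lambda>f g n. f n + g n"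
  by (rule lp_space_2_add)
lift_definition uminus_ell2 :: "'a ell2 \<Rightarrow> 'a ell2" is "\<lambda>f n. - f n"
  by (simp add: lp_space_2_iff)
lift_definition minus_ell2 :: "'a ell2 \<Rightarrow> 'a ell2 \<Rightarrow> 'a ell2" is "\<lambda>f g n. f n - g n"
proof -
  fix f g :: "'a \<Rightarrow> complex"
  assume "f \<in> lp_space 2" "g \<in> lp_space 2"
  then have "(\<lambda>n. f n + - 1 * g n) \<in> lp_space 2"
    by (intro lp_space_2_add lp_space_2_mult[where B = 1]) auto
  then show "(\<lambda>n. f n - g n) \<in> lp_space 2" by simp
qed
lift_definition scaleR_ell2 :: "real \<Rightarrow> 'a ell2 \<Rightarrow> 'a ell2" is "\<lambda>r f n. of_real r * f n"
  by (rule lp_space_2_mult) auto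

lemma coord_zero [simp]: "coord 0 n = 0" by transfer simp
lemma coord_add [simp]: "coord (x + y) n = coord x n + coord y n" by transfer simp
lemma coord_diff [simp]: "coord (x - y) n = coord x n - coord y n" by transfer simp
lemma coord_uminus [simp]: "coord (- x) n = - coord x n" by transfer simp
lemma coord_scaleR [simp]: "coord (r *\<^sub>R x) n = of_real r * coord x n" by transfer simp

instance
  by standard (rule ell2_eqI, simp add: distrib_left distrib_right)+

end

lift_definition scaleC :: "complex \<Rightarrow> 'a ell2 \<Rightarrow> 'a ell2" (infixr "*\<^sub>C" 75) is "\<lambda>c f n. c * f n"
  by (rule lp_space_2_mult) auto

lemma coord_scaleC [simp]: "coord (c *\<^sub>C x) n = c * coord x n" by transfer simp
lemma coord_sum [simp]: "coord (sum f A) n = (\<Sum>i\<in>A. coord (f i) n)"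
  by (induction A rule: infinite_finite_induct) auto

lemma lp_space_2_prod_abs_summable:
  assumes "f \<in> lp_space 2" "g \<in> lp_space 2"
  shows "(\<lambda>n. cmod (f n * cnj (g n))) summable_on UNIV"
  using assms abs_summable_product[of f UNIV "\<lambda>n. cnj (g n)"]
  by (simp add: lp_space_2_iff norm_mult power2_eq_square)

lemma lp_space_2_prod_summable:
  assumes "f \<in> lp_space 2" "g \<in> lp_space 2"
  shows "(\<lambda>n. f n * cnj (g n)) summable_on UNIV"
  using lp_space_2_prod_abs_summable[OF assms] by (rule abs_summable_summable)

lemma coord_prod_Re_summable: "(\<lambda>n. Re (coord x n * cnj (coord y n))) summable_on UNIV"
  by (intro summable_on_Re lp_space_2_prod_summable) auto

lemma coord_square_summable: "(\<lambda>n. (cmod (coord x n))\<^sup>2) summable_on UNIV"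
  using coord_in_lp_space[of x] unfolding lp_space_2_iff .

lemma Re_mult_cnj: "Re (z * cnj z) = (cmod z)\<^sup>2"
  unfolding cmod_power2 by (simp add: power2_eq_square)

instantiation ell2 :: (type) real_inner
begin

text \<open>The real part of the Hermitian product, since \<open>real_inner\<close> asks for a real
  form. The imaginary part is recovered by a factor -i in the first slot, see
  \<open>l2_inner_coord\<close>.\<close>

definition inner_ell2 :: "'a ell2 \<Rightarrow> 'a ell2 \<Rightarrow> real" where
  "inner_ell2 x y = (\<Sum>\<^sub>\<infinity>n. Re (coord x n * cnj (coord y n)))"
definition norm_ell2 :: "'a ell2 \<Rightarrow> real" where "norm_ell2 x = sqrt (inner x x)"
definition dist_ell2 :: "'a ell2 \<Rightarrow> 'a ell2 \<Rightarrow> real" where "dist_ell2 x y = norm (x - y)"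
definition sgn_ell2 :: "'a ell2 \<Rightarrow> 'a ell2" where "sgn_ell2 x = x /\<^sub>R norm x"
definition uniformity_ell2 :: "('a ell2 \<times> 'a ell2) filter" where
  "uniformity_ell2 = (INF e\<in>{0<..}. principal {(x, y). dist x y < e})"
definition open_ell2 :: "'a ell2 set \<Rightarrow> bool" where
  "open_ell2 U = (\<forall>x\<in>U. \<forall>\<^sub>F (x', y) in uniformity. x' = x \<longrightarrow> y \<in> U)"

instance
proof
  fix x y z :: "'a ell2" and r :: real and U :: "'a ell2 set"
  show "dist x y = norm (x - y)" by (rule dist_ell2_def)
  show "sgn x = x /\<^sub>R norm x" by (rule sgn_ell2_def)
  show "uniformity = (INF e\<in>{0<..}. principal {(x::'a ell2, y). dist x y < e})"
    by (rule uniformity_ell2_def)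
  show "open U = (\<forall>x\<in>U. \<forall>\<^sub>F (x', y) in uniformity. x' = x \<longrightarrow> y \<in> U)" by (rule open_ell2_def)
  show "inner x y = inner y x"
    unfolding inner_ell2_def by (intro infsum_cong) (simp add: algebra_simps)
  show "inner (x + y) z = inner x z + inner y z"
    unfolding inner_ell2_def infsum_add[OF coord_prod_Re_summable coord_prod_Re_summable, symmetric]
    by (intro infsum_cong) (simp add: distrib_left distrib_right)
  show "inner (r *\<^sub>R x) y = r * inner x y"
    unfolding inner_ell2_def infsum_cmult_right[OF coord_prod_Re_summable, symmetric]
    by (intro infsum_cong) (simp add: algebra_simps)
  show ge: "0 \<le> inner x x"
    unfolding inner_ell2_def Re_mult_cnj by (intro infsum_nonneg) simp
  show "(inner x x = 0) = (x = 0)"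
  proof
    assume "inner x x = 0"
    then have "Re (coord x n * cnj (coord x n)) = 0" for n
      unfolding inner_ell2_def
      by (intro nonneg_infsum_le_0D[OF eq_refl coord_prod_Re_summable])
         (simp_all only: Re_mult_cnj zero_le_power2 UNIV_I)
    then have "coord x n = 0" for n
      unfolding Re_mult_cnj by simp
    then show "x = 0" by (intro ell2_eqI) simp
  qed (simp add: inner_ell2_def)
  show "norm x = sqrt (inner x x)" by (rule norm_ell2_def)
qed

end

lemma norm_ell2_square: "(norm x)\<^sup>2 = (\<Sum>\<^sub>\<infinity>n. (cmod (coord x n))\<^sup>2)"
proof -
  have "(norm x)\<^sup>2 = inner x x" by (simp add: power2_norm_eq_inner)
  also have "\<dots> = (\<Sum>\<^sub>\<infinity>n. (cmod (coord x n))\<^sup>2)"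
    unfolding inner_ell2_def Re_mult_cnj ..
  finally show ?thesis .
qed

lemma norm_ell2: "norm x = lp_norm 2 (coord x)"
proof -
  have "lp_norm 2 (coord x) = (norm x)\<^sup>2 powr (1 / 2)"
    unfolding lp_norm_def norm_ell2_square by simp
  also have "\<dots> = norm x" by (simp add: powr_half_sqrt)
  finally show ?thesis by simp
qed

lemma sum_coord_square_le: "finite A \<Longrightarrow> (\<Sum>n\<in>A. (cmod (coord x n))\<^sup>2) \<le> (norm x)\<^sup>2"
  unfolding norm_ell2_square by (intro finite_sum_le_infsum coord_square_summable) auto

lemma norm_coord_le: "cmod (coord x n) \<le> norm x"
  using sum_coord_square_le[of "{n}" x] by (intro power2_le_imp_le[of "cmod (coord x n)"]) auto

lemma ell2_boundI:
  assumes "\<And>A. finite A \<Longrightarrow> (\<Sum>n\<in>A. (cmod (f n))\<^sup>2) \<le> B\<^sup>2"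
  shows "f \<in> lp_space 2" and "B \<ge> 0 \<Longrightarrow> norm (ell2_of f) \<le> B"
proof -
  show f: "f \<in> lp_space 2" unfolding lp_space_2_iff
    by (intro nonneg_bdd_above_summable_on) (auto intro!: bdd_aboveI[of _ "B\<^sup>2"] assms)
  assume "B \<ge> 0"
  have "(norm (ell2_of f))\<^sup>2 \<le> B\<^sup>2"
    unfolding norm_ell2_square using f
    by (intro infsum_le_finite_sums) (auto simp: ell2_of_inverse lp_space_2_iff assms)
  then show "norm (ell2_of f) \<le> B" using \<open>B \<ge> 0\<close> by (rule power2_le_imp_le)
qed

instance ell2 :: (type) complete_space
proof
  fix X :: "nat \<Rightarrow> 'a ell2"
  assume C: "Cauchy X"
  have "Cauchy (\<lambda>i. coord (X i) n)" for n
  proof (rule metric_CauchyI)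
    fix e :: real assume "0 < e"
    then obtain M where M: "\<And>i j. i \<ge> M \<Longrightarrow> j \<ge> M \<Longrightarrow> dist (X i) (X j) < e"
      using metric_CauchyD[OF C] by metis
    have "dist (coord (X i) n) (coord (X j) n) \<le> dist (X i) (X j)" for i j
      using norm_coord_le[of "X i - X j" n] by (simp add: dist_norm)
    then show "\<exists>M. \<forall>m\<ge>M. \<forall>k\<ge>M. dist (coord (X m) n) (coord (X k) n) < e"
      using M by (meson le_less_trans)
  qed
  then have "\<exists>l. (\<lambda>i. coord (X i) n) \<longlonglongrightarrow> l" for n
    using Cauchy_convergent convergent_def by blast
  then obtain f where f: "\<And>n. (\<lambda>i. coord (X i) n) \<longlonglongrightarrow> f n" by metis
  \<comment> \<open>On a finite set the limit in j may be taken termwise. The bound does not depend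
    on the set, so \<open>ell2_boundI\<close> turns it into membership and a norm bound.\<close>
  have key: "(\<Sum>n\<in>A. (cmod (coord (X i) n - f n))\<^sup>2) \<le> e\<^sup>2"
    if "finite A" "\<And>j. j \<ge> i \<Longrightarrow> dist (X i) (X j) < e" for A i e
  proof (rule LIMSEQ_le_const2)
    show "(\<lambda>j. \<Sum>n\<in>A. (cmod (coord (X i) n - coord (X j) n))\<^sup>2)
            \<longlonglongrightarrow> (\<Sum>n\<in>A. (cmod (coord (X i) n - f n))\<^sup>2)"
      by (intro tendsto_intros f)
    have "(\<Sum>n\<in>A. (cmod (coord (X i) n - coord (X j) n))\<^sup>2) \<le> e\<^sup>2" if "j \<ge> i" for j
    proof -
      have "(\<Sum>n\<in>A. (cmod (coord (X i) n - coord (X j) n))\<^sup>2) \<le> (norm (X i - X j))\<^sup>2"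
        using sum_coord_square_le[OF \<open>finite A\<close>, of "X i - X j"] by simp
      also have "\<dots> \<le> e\<^sup>2"
        using \<open>\<And>j. j \<ge> i \<Longrightarrow> dist (X i) (X j) < e\<close>[OF that] by (intro power_mono) (auto simp: dist_norm)
      finally show ?thesis .
    qed
    then show "\<exists>N. \<forall>j\<ge>N. (\<Sum>n\<in>A. (cmod (coord (X i) n - coord (X j) n))\<^sup>2) \<le> e\<^sup>2" by auto
  qed
  have ex: "\<exists>M. \<forall>i\<ge>M. \<forall>j\<ge>i. dist (X i) (X j) < e" if "e > 0" for e
    using metric_CauchyD[OF C that] by (meson order_trans)
  obtain M where M: "\<And>i j. i \<ge> M \<Longrightarrow> j \<ge> i \<Longrightarrow> dist (X i) (X j) < 1" using ex[of 1] by auto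
  have "(\<lambda>n. coord (X M) n - f n) \<in> lp_space 2"
    using key[of _ M 1] M by (intro ell2_boundI(1)[of _ 1]) auto
  then have "(\<lambda>n. coord (X M) n + (- 1) * (coord (X M) n - f n)) \<in> lp_space 2"
    by (intro lp_space_2_add lp_space_2_mult[where B = 1]) auto
  then have fl: "f \<in> lp_space 2" by simp
  have "X \<longlonglongrightarrow> ell2_of f"
  proof (rule metric_LIMSEQ_I)
    fix r :: real assume "0 < r"
    then obtain M where M: "\<And>i j. i \<ge> M \<Longrightarrow> j \<ge> i \<Longrightarrow> dist (X i) (X j) < r / 2"
      using ex[of "r / 2"] by auto
    have "dist (X i) (ell2_of f) < r" if "i \<ge> M" for i
    proof -
      have "X i - ell2_of f = ell2_of (\<lambda>n. coord (X i) n - f n)"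
        using fl by (simp add: minus_ell2_def ell2_of_inverse)
      moreover have "norm (ell2_of (\<lambda>n. coord (X i) n - f n)) \<le> r / 2"
        using key[of _ i "r / 2"] M that \<open>0 < r\<close> by (intro ell2_boundI(2)) auto
      ultimately show ?thesis using \<open>0 < r\<close> by (simp add: dist_norm)
    qed
    then show "\<exists>M. \<forall>i\<ge>M. dist (X i) (ell2_of f) < r" by blast
  qed
  then show "convergent X" by (auto simp: convergent_def)
qed

section \<open>Complex scalars and bounded complex-linear operators\<close>

lemma scaleC_scaleC [simp]: "a *\<^sub>C b *\<^sub>C x = (a * b) *\<^sub>C x"
  by (rule ell2_eqI) simp
lemma scaleC_one [simp]: "1 *\<^sub>C x = x" by (rule ell2_eqI) simp
lemma scaleC_zero [simp]: "0 *\<^sub>C x = 0" "a *\<^sub>C 0 = 0" by (rule ell2_eqI; simp)+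
lemma scaleC_add_right: "a *\<^sub>C (x + y) = a *\<^sub>C x + a *\<^sub>C y" by (rule ell2_eqI) (simp add: algebra_simps)
lemma scaleC_diff_right: "a *\<^sub>C (x - y) = a *\<^sub>C x - a *\<^sub>C y" by (rule ell2_eqI) (simp add: algebra_simps)
lemma scaleC_diff_left: "(a - b) *\<^sub>C x = a *\<^sub>C x - b *\<^sub>C x" by (rule ell2_eqI) (simp add: algebra_simps)
lemma scaleC_minus [simp]: "(- a) *\<^sub>C x = - (a *\<^sub>C x)" "a *\<^sub>C (- x) = - (a *\<^sub>C x)" by (rule ell2_eqI; simp)+
lemma scaleC_sum_right: "a *\<^sub>C (\<Sum>i\<in>I. f i) = (\<Sum>i\<in>I. a *\<^sub>C f i)" by (rule ell2_eqI) (simp add: sum_distrib_left)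
lemma scaleC_sum_left: "(\<Sum>i\<in>I. c i) *\<^sub>C x = (\<Sum>i\<in>I. c i *\<^sub>C x)" by (rule ell2_eqI) (simp add: sum_distrib_right)
lemma scaleR_scaleC: "r *\<^sub>R x = complex_of_real r *\<^sub>C x" by (rule ell2_eqI) simp

lemma inner_scaleC_left: "inner (c *\<^sub>C x) y = inner x (cnj c *\<^sub>C y)"
  unfolding inner_ell2_def by (intro infsum_cong) (simp add: algebra_simps)

lemma norm_scaleC [simp]: "norm (c *\<^sub>C x) = cmod c * norm x"
proof -
  have "(norm (c *\<^sub>C x))\<^sup>2 = inner x ((cnj c * c) *\<^sub>C x)"
    by (simp add: power2_norm_eq_inner inner_scaleC_left)
  also have "cnj c * c = complex_of_real ((cmod c)\<^sup>2)"
    using complex_norm_square[of c] by (simp add: mult.commute)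
  also have "inner x (complex_of_real ((cmod c)\<^sup>2) *\<^sub>C x) = (cmod c * norm x)\<^sup>2"
    by (simp only: scaleR_scaleC[symmetric] inner_scaleR_right power2_norm_eq_inner[symmetric] power_mult_distrib)
  finally show ?thesis by (simp add: power2_eq_iff_nonneg)
qed

text \<open>\<open>bounded_linear\<close> is linearity over the reals; commutation with
  \<open>scaleC\<close> adds the complex structure.\<close>

definition clin :: "('a ell2 \<Rightarrow> 'b ell2) \<Rightarrow> bool" where
  "clin T \<longleftrightarrow> bounded_linear T \<and> (\<forall>c x. T (c *\<^sub>C x) = c *\<^sub>C T x)"

lemma clinI:
  assumes "\<And>x y. T (x + y) = T x + T y" "\<And>c x. T (c *\<^sub>C x) = c *\<^sub>C T x" "\<And>x. norm (T x) \<le> K * norm x"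
  shows "clin T"
  unfolding clin_def using assms
  by (auto intro!: bounded_linear_intro[where K = K] simp: scaleR_scaleC mult.commute)

lemma clin_scaleC: "clin T \<Longrightarrow> T (c *\<^sub>C x) = c *\<^sub>C T x" by (simp add: clin_def)
lemma clin_add: "clin T \<Longrightarrow> T (x + y) = T x + T y" by (simp add: clin_def linear_simps)
lemma clin_diff: "clin T \<Longrightarrow> T (x - y) = T x - T y" by (simp add: clin_def linear_simps)
lemma clin_0: "clin T \<Longrightarrow> T 0 = 0" by (simp add: clin_def linear_simps)
lemma clin_uminus: "clin T \<Longrightarrow> T (- x) = - T x" by (simp add: clin_def linear_simps)
lemma clin_sum: "clin T \<Longrightarrow> T (\<Sum>i\<in>I. f i) = (\<Sum>i\<in>I. T (f i))"
  by (induction I rule: infinite_finite_induct) (auto simp: clin_add clin_0)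
lemma clin_bounded: "clin T \<Longrightarrow> \<exists>K>0. \<forall>x. norm (T x) \<le> K * norm x"
  using bounded_linear.pos_bounded[of T] by (auto simp: clin_def mult.commute)
lemma clin_tendsto: "clin T \<Longrightarrow> (f \<longlongrightarrow> l) F \<Longrightarrow> ((\<lambda>i. T (f i)) \<longlongrightarrow> T l) F"
  by (simp add: clin_def bounded_linear.tendsto)
lemma clin_compose: "clin S \<Longrightarrow> clin T \<Longrightarrow> clin (\<lambda>x. S (T x))"
  by (simp add: clin_def bounded_linear_compose)
lemma clin_id: "clin (\<lambda>x. x)" by (simp add: clin_def)
lemma clin_scaleC_op: "clin (\<lambda>x. c *\<^sub>C x)"
  by (rule clinI[where K = "cmod c"]) (auto simp: scaleC_add_right mult.commute)
lemma clin_add_op: "clin S \<Longrightarrow> clin T \<Longrightarrow> clin (\<lambda>x. S x + T x)"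
  by (simp add: clin_def bounded_linear_add scaleC_add_right)
lemma clin_diff_op: "clin S \<Longrightarrow> clin T \<Longrightarrow> clin (\<lambda>x. S x - T x)"
  by (simp add: clin_def bounded_linear_sub scaleC_diff_right)
lemma clin_sum_op: "(\<And>i. i \<in> I \<Longrightarrow> clin (T i)) \<Longrightarrow> clin (\<lambda>x. \<Sum>i\<in>I. T i x)"
  by (simp add: clin_def bounded_linear_sum scaleC_sum_right)

definition symop :: "('a ell2 \<Rightarrow> 'a ell2) \<Rightarrow> bool" where
  "symop T \<longleftrightarrow> clin T \<and> (\<forall>x y. inner (T x) y = inner x (T y))"

definition mulop :: "('a \<Rightarrow> complex) \<Rightarrow> 'a ell2 \<Rightarrow> 'a ell2" where
  "mulop c x = ell2_of (\<lambda>n. c n * coord x n)"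

context
  fixes c :: "'a \<Rightarrow> complex" and B :: real
  assumes c: "\<And>n. cmod (c n) \<le> B"
begin

lemma coord_mulop: "coord (mulop c x) n = c n * coord x n"
  unfolding mulop_def by (simp add: ell2_of_inverse lp_space_2_mult[OF _ c])

lemma norm_mulop_le: "norm (mulop c x) \<le> B * norm x"
proof -
  have B: "0 \<le> B" using c[of undefined] norm_ge_zero order_trans by blast
  show ?thesis unfolding mulop_def
  proof (rule ell2_boundI(2))
    fix A :: "'a set" assume A: "finite A"
    have "(\<Sum>n\<in>A. (cmod (c n * coord x n))\<^sup>2) \<le> (\<Sum>n\<in>A. B\<^sup>2 * (cmod (coord x n))\<^sup>2)"
      unfolding norm_mult power_mult_distrib by (intro sum_mono mult_right_mono power_mono c) auto
    also have "\<dots> \<le> (B * norm x)\<^sup>2"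
      using sum_coord_square_le[OF A, of x] B
      by (auto simp: sum_distrib_left[symmetric] power_mult_distrib intro!: mult_left_mono)
    finally show "(\<Sum>n\<in>A. (cmod (c n * coord x n))\<^sup>2) \<le> (B * norm x)\<^sup>2" .
  qed (use B in auto)
qed

lemma clin_mulop: "clin (mulop c)"
  by (rule clinI[where K = B]) (auto intro!: ell2_eqI norm_mulop_le simp: coord_mulop algebra_simps)

lemma symop_mulop: "(\<And>n. c n \<in> \<real>) \<Longrightarrow> symop (mulop c)"
  unfolding symop_def inner_ell2_def
  by (auto intro!: infsum_cong clin_mulop simp: coord_mulop algebra_simps complex_is_Real_iff)

end

definition shiftop :: "'a::ab_group_add \<Rightarrow> 'a ell2 \<Rightarrow> 'a ell2" where
  "shiftop e x = ell2_of (\<lambda>n. coord x (n + e))"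

lemma sum_shift_le: "finite A \<Longrightarrow> (\<Sum>n\<in>A. (cmod (coord x (n + e)))\<^sup>2) \<le> (norm x)\<^sup>2"
  for e :: "'a::ab_group_add"
  using sum_coord_square_le[of "(\<lambda>n. n + e) ` A" x] by (simp add: sum.reindex)

lemma coord_shiftop [simp]: "coord (shiftop e x) n = coord x (n + e)"
  unfolding shiftop_def
  by (subst ell2_of_inverse) (auto intro!: ell2_boundI(1)[where B = "norm x"] sum_shift_le)

lemma norm_shiftop_le: "norm (shiftop e x) \<le> norm x"
  unfolding shiftop_def by (intro ell2_boundI(2) sum_shift_le) auto

lemma clin_shiftop: "clin (shiftop e)"
  by (rule clinI[where K = 1]) (auto intro!: ell2_eqI simp: norm_shiftop_le)

lemma inner_shiftop: "inner (shiftop e x) y = inner x (shiftop (- e) y)"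
proof -
  have "(\<Sum>\<^sub>\<infinity>n. Re (coord x (n + e) * cnj (coord y n)))
      = (\<Sum>\<^sub>\<infinity>n. Re (coord x n * cnj (coord y (n - e))))"
    by (rule infsum_reindex_bij_witness[of _ "\<lambda>n. n - e" "\<lambda>n. n + e"]) auto
  then show ?thesis by (simp add: inner_ell2_def)
qed

definition truncate :: "'a set \<Rightarrow> 'a ell2 \<Rightarrow> 'a ell2" where
  "truncate A = mulop (\<lambda>n. if n \<in> A then 1 else 0)"

lemma coord_truncate [simp]: "coord (truncate A x) n = (if n \<in> A then coord x n else 0)"
  unfolding truncate_def by (subst coord_mulop[where B = 1]) auto

lemma tendsto_truncate: "((\<lambda>A. truncate A x) \<longlongrightarrow> x) (finite_subsets_at_top UNIV)"
proof -
  let ?F = "finite_subsets_at_top (UNIV :: 'a set)"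
  have "((\<lambda>A. \<Sum>n\<in>A. (cmod (coord x n))\<^sup>2) \<longlongrightarrow> (norm x)\<^sup>2) ?F"
    unfolding norm_ell2_square using infsum_tendsto[OF coord_square_summable] by auto
  then have lim: "((\<lambda>A. (norm x)\<^sup>2 - (\<Sum>n\<in>A. (cmod (coord x n))\<^sup>2)) \<longlongrightarrow> 0) ?F"
    using tendsto_diff[OF tendsto_const[of "(norm x)\<^sup>2"]] by fastforce
  have eq: "\<forall>\<^sub>F A in ?F. (norm x)\<^sup>2 - (\<Sum>n\<in>A. (cmod (coord x n))\<^sup>2) = (norm (x - truncate A x))\<^sup>2"
    unfolding eventually_finite_subsets_at_top
  proof (intro exI[of _ "{}"] conjI allI impI)
    fix A :: "'a set" assume "finite A \<and> {} \<subseteq> A \<and> A \<subseteq> UNIV"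
    then have A: "finite A" by simp
    have 1: "(norm (truncate A x))\<^sup>2 = (\<Sum>n\<in>A. (cmod (coord x n))\<^sup>2)"
      unfolding norm_ell2_square
      by (subst infsum_cong_neutral[where T = A and g = "\<lambda>n. (cmod (coord x n))\<^sup>2"]) (use A in auto)
    have "inner x (truncate A x) = inner (truncate A x) (truncate A x)"
      unfolding inner_ell2_def by (intro infsum_cong) auto
    then have "(norm (x - truncate A x))\<^sup>2 = (norm x)\<^sup>2 - (norm (truncate A x))\<^sup>2"
      by (simp add: power2_norm_eq_inner inner_diff_left inner_diff_right inner_commute)
    then show "(norm x)\<^sup>2 - (\<Sum>n\<in>A. (cmod (coord x n))\<^sup>2) = (norm (x - truncate A x))\<^sup>2"
      using 1 by simp
  qed auto
  have "((\<lambda>A. (norm (x - truncate A x))\<^sup>2) \<longlongrightarrow> 0) ?F"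
    using Lim_transform_eventually[OF lim eq] .
  then have "((\<lambda>A. sqrt ((norm (x - truncate A x))\<^sup>2)) \<longlongrightarrow> sqrt 0) ?F"
    by (intro tendsto_real_sqrt)
  then have "((\<lambda>A. x - truncate A x) \<longlongrightarrow> 0) ?F"
    by (simp add: tendsto_norm_zero_iff)
  from tendsto_diff[OF tendsto_const[of x] this] show ?thesis by simp
qed

text \<open>With y = T x and A exhausting the index set, the form tends to the squared norm of T x.
  Operator bounds thus reduce to bilinear forms over finite sets, the only ones the interpolation
  argument treats.\<close>

lemma clin_norm_le_of_truncate:
  assumes T: "clin T" and K: "K \<ge> 0"
    and b: "\<And>A x y. finite A \<Longrightarrow> inner (T (truncate A x)) (truncate A y) \<le> K * norm x * norm y"
  shows "norm (T x) \<le> K * norm x"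
proof -
  let ?F = "finite_subsets_at_top (UNIV :: 'a set)"
  have "((\<lambda>A. inner (T (truncate A x)) (truncate A (T x))) \<longlongrightarrow> inner (T x) (T x)) ?F"
    by (intro tendsto_inner clin_tendsto[OF T] tendsto_truncate)
  moreover have "\<forall>\<^sub>F A in ?F. inner (T (truncate A x)) (truncate A (T x)) \<le> K * norm x * norm (T x)"
    using b by (intro eventually_finite_subsets_at_top_weakI) auto
  ultimately have "inner (T x) (T x) \<le> K * norm x * norm (T x)"
    by (intro tendsto_upperbound) auto
  then have "norm (T x) * norm (T x) \<le> K * norm x * norm (T x)"
    by (simp add: power2_norm_eq_inner[symmetric] power2_eq_square)
  then show ?thesis using K by (cases "norm (T x) = 0") auto
qed

section \<open>Smooth perturbations\<close>

lemma inner_scaleC_self: "inner x (w *\<^sub>C x) = Re w * (norm x)\<^sup>2"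
proof -
  have "inner x (w *\<^sub>C x) = (\<Sum>\<^sub>\<infinity>n. Re w * (cmod (coord x n))\<^sup>2)"
    unfolding inner_ell2_def cmod_power2
    by (intro infsum_cong) (simp add: power2_eq_square algebra_simps)
  then show ?thesis
    by (simp add: norm_ell2_square infsum_cmult_right coord_square_summable)
qed

text \<open>Lax-Milgram by Banach's fixed point theorem: N x = y says that x is a fixed point of x
  \<mapsto> x - \<rho> (N x - y), which is a contraction for a suitable \<rho>.\<close>

lemma coercive_bij:
  assumes N: "clin N" and c: "c > 0" "\<And>x. c * (norm x)\<^sup>2 \<le> inner (N x) x"
  shows "\<exists>!x. N x = y"
proof -
  obtain K0 where K0: "K0 > 0" "\<And>x. norm (N x) \<le> K0 * norm x" using clin_bounded[OF N] by auto
  \<comment> \<open>Enlarging the constant to at least c ensures c^2 / K^2 \<le> 1, so that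
    \<open>q\<close> squares back to 1 - c^2 / K^2.\<close>
  define K where "K = max K0 c"
  have K: "K > 0" "c \<le> K" "norm (N x) \<le> K * norm x" for x
    using K0(1) order_trans[OF K0(2)[of x], of "K * norm x"] by (auto simp: K_def mult_right_mono)
  \<comment> \<open>The minimiser of 1 - 2 c \<rho> + K^2 \<rho>^2, which bounds the square of the
    contraction factor; the minimum is 1 - c^2 / K^2.\<close>
  define \<rho> where "\<rho> = c / K\<^sup>2"
  define q where "q = sqrt (1 - c\<^sup>2 / K\<^sup>2)"
  have cK: "0 < c\<^sup>2 / K\<^sup>2" "c\<^sup>2 / K\<^sup>2 \<le> 1" using K c by (auto simp: power_mono)
  have q: "0 \<le> q" "q < 1" "q\<^sup>2 = 1 - c\<^sup>2 / K\<^sup>2"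
    using cK unfolding q_def by (auto simp del: power_divide)
  have contr: "norm (x - \<rho> *\<^sub>R N x) \<le> q * norm x" for x
  proof (rule power2_le_imp_le)
    have "(norm (x - \<rho> *\<^sub>R N x))\<^sup>2 = (norm x)\<^sup>2 - 2 * \<rho> * inner (N x) x + \<rho>\<^sup>2 * (norm (N x))\<^sup>2"
      unfolding power2_norm_eq_inner
      by (simp add: inner_diff_left inner_diff_right inner_commute power2_eq_square algebra_simps)
    also have "\<dots> \<le> (norm x)\<^sup>2 - 2 * \<rho> * (c * (norm x)\<^sup>2) + \<rho>\<^sup>2 * (K * norm x)\<^sup>2"
      using c(2)[of x] K c by (intro add_mono diff_mono mult_left_mono power_mono) (auto simp: \<rho>_def)
    also have "\<dots> = (q * norm x)\<^sup>2"
      unfolding power_mult_distrib q(3) \<rho>_def using K(1) by (simp add: field_simps power2_eq_square)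
    finally show "(norm (x - \<rho> *\<^sub>R N x))\<^sup>2 \<le> (q * norm x)\<^sup>2" .
  qed (use q in auto)
  have "\<exists>!x. x - \<rho> *\<^sub>R (N x - y) = x"
  proof (rule banach_fix_type[OF q(1,2)], intro allI)
    fix x x'
    have e: "(x - \<rho> *\<^sub>R (N x - y)) - (x' - \<rho> *\<^sub>R (N x' - y)) = (x - x') - \<rho> *\<^sub>R N (x - x')"
      by (simp add: clin_diff[OF N] algebra_simps)
    show "dist (x - \<rho> *\<^sub>R (N x - y)) (x' - \<rho> *\<^sub>R (N x' - y)) \<le> q * dist x x'"
      unfolding dist_norm e by (rule contr)
  qed
  moreover have "x - \<rho> *\<^sub>R (N x - y) = x \<longleftrightarrow> N x = y" for x
    using K c by (auto simp: \<rho>_def)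
  ultimately show ?thesis by simp
qed

section \<open>Resolvents of bounded self-adjoint operators\<close>

definition resolvent :: "('a ell2 \<Rightarrow> 'a ell2) \<Rightarrow> complex \<Rightarrow> 'a ell2 \<Rightarrow> 'a ell2" where
  "resolvent H z y = (THE x. H x - z *\<^sub>C x = y)"

locale selfadjoint =
  fixes H :: "'a ell2 \<Rightarrow> 'a ell2"
  assumes symop: "symop H"
begin

lemma clin_H: "clin H" using symop by (simp add: symop_def)
lemma inner_H: "inner (H x) y = inner x (H y)" using symop by (simp add: symop_def)

text \<open>By symmetry H x is orthogonal to i x, so only z contributes. The factor i Im z instead
  of i makes the result nonnegative in both half planes; this is the coercivity behind
  \<open>resolvent_ex1\<close> and the norm bound.\<close>

lemma inner_shifted:
  "inner ((\<i> * of_real (Im z)) *\<^sub>C (H x - z *\<^sub>C x)) x = (Im z)\<^sup>2 * (norm x)\<^sup>2"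
proof -
  have "inner (H x) (\<i> *\<^sub>C x) = inner x (\<i> *\<^sub>C H x)"
    by (simp add: inner_H clin_scaleC[OF clin_H])
  also have "\<dots> = - inner (H x) (\<i> *\<^sub>C x)"
    using inner_scaleC_left[of "- \<i>" x "H x"] by (simp add: inner_commute)
  finally have 0: "inner (H x) (\<i> *\<^sub>C x) = 0" by simp
  have 1: "inner (H x) ((- \<i> * of_real (Im z)) *\<^sub>C x) = 0"
  proof -
    have "(- \<i> * of_real (Im z)) *\<^sub>C x = (- Im z) *\<^sub>R (\<i> *\<^sub>C x)"
      by (simp add: scaleR_scaleC mult.commute)
    then show ?thesis using 0 by simp
  qed
  have 2: "inner (z *\<^sub>C x) ((- \<i> * of_real (Im z)) *\<^sub>C x) = - (Im z)\<^sup>2 * (norm x)\<^sup>2"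
    unfolding inner_scaleC_left scaleC_scaleC inner_scaleC_self by (simp add: power2_eq_square)
  show ?thesis
    unfolding inner_scaleC_left using 1 2 by (simp add: inner_diff_left)
qed

context
  fixes z :: complex
  assumes z: "Im z \<noteq> 0"
begin

lemma resolvent_ex1: "\<exists>!x. H x - z *\<^sub>C x = y"
proof -
  let ?c = "\<i> * of_real (Im z)"
  have "\<exists>!x. ?c *\<^sub>C (H x - z *\<^sub>C x) = ?c *\<^sub>C y"
    using z by (intro coercive_bij[where c = "(Im z)\<^sup>2"] clin_compose[OF clin_scaleC_op]
        clin_diff_op clin_H clin_scaleC_op) (auto simp only: inner_shifted, auto)
  moreover have "?c *\<^sub>C a = ?c *\<^sub>C b \<longleftrightarrow> a = b" for a b :: "'a ell2"
    using z by (metis (no_types, lifting) complex_i_not_zero field_class.field_inverse mult_eq_0_iff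
        of_real_eq_0_iff scaleC_one scaleC_scaleC)
  ultimately show ?thesis by simp
qed

lemma resolvent_eq: "H (resolvent H z y) - z *\<^sub>C resolvent H z y = y"
  unfolding resolvent_def by (rule theI'[OF resolvent_ex1])

lemma resolvent_unique: "H x - z *\<^sub>C x = y \<Longrightarrow> resolvent H z y = x"
  unfolding resolvent_def by (rule the1_equality[OF resolvent_ex1])

lemma H_resolvent: "H (resolvent H z y) = y + z *\<^sub>C resolvent H z y"
  using resolvent_eq by (metis diff_eq_eq)

lemma norm_resolvent_le: "norm (resolvent H z y) \<le> norm y / \<bar>Im z\<bar>"
proof -
  let ?x = "resolvent H z y"
  have "(Im z)\<^sup>2 * (norm ?x)\<^sup>2 \<le> norm ((\<i> * of_real (Im z)) *\<^sub>C (H ?x - z *\<^sub>C ?x)) * norm ?x"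
    unfolding inner_shifted[symmetric] by (rule norm_cauchy_schwarz)
  also have "\<dots> = \<bar>Im z\<bar> * norm y * norm ?x" by (simp add: resolvent_eq norm_mult)
  finally have "(\<bar>Im z\<bar> * norm ?x) * (\<bar>Im z\<bar> * norm ?x) \<le> norm y * (\<bar>Im z\<bar> * norm ?x)"
    by (simp add: power2_eq_square algebra_simps)
  then have "\<bar>Im z\<bar> * norm ?x \<le> norm y"
    by (cases "norm ?x = 0") (use z in auto)
  then show ?thesis using z by (simp add: field_simps)
qed

lemma clin_resolvent: "clin (resolvent H z)"
proof (rule clinI[where K = "1 / \<bar>Im z\<bar>"])
  show "resolvent H z (x + y) = resolvent H z x + resolvent H z y" for x y
    by (rule resolvent_unique) (simp add: clin_add[OF clin_H] H_resolvent scaleC_add_right)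
  show "resolvent H z (c *\<^sub>C x) = c *\<^sub>C resolvent H z x" for c x
    by (rule resolvent_unique) (simp add: clin_scaleC[OF clin_H] H_resolvent scaleC_add_right mult.commute)
qed (use norm_resolvent_le in simp)

end

lemma inner_resolvent:
  assumes z: "Im z \<noteq> 0"
  shows "inner (resolvent H z x) y = inner x (resolvent H (cnj z) y)"
proof -
  let ?u = "resolvent H z x" and ?v = "resolvent H (cnj z) y"
  have z': "Im (cnj z) \<noteq> 0" using z by simp
  have "inner ?u y = inner ?u (H ?v - cnj z *\<^sub>C ?v)" by (simp only: resolvent_eq[OF z'])
  also have "\<dots> = inner (H ?u - z *\<^sub>C ?u) ?v"
    by (simp add: inner_diff_left inner_diff_right inner_H inner_scaleC_left)
  also have "\<dots> = inner x ?v" by (simp only: resolvent_eq[OF z])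
  finally show ?thesis .
qed

lemma resolvent_identity:
  assumes z: "Im z \<noteq> 0" and w: "Im w \<noteq> 0"
  shows "resolvent H z x - resolvent H w x = (z - w) *\<^sub>C resolvent H z (resolvent H w x)"
proof -
  have "resolvent H z ((z - w) *\<^sub>C resolvent H w x) = resolvent H z x - resolvent H w x"
    by (rule resolvent_unique[OF z])
       (simp add: clin_diff[OF clin_H] H_resolvent z w scaleC_diff_right scaleC_diff_left)
  then show ?thesis by (simp add: clin_scaleC[OF clin_resolvent[OF z]])
qed

lemma resolvent_commute:
  assumes z: "Im z \<noteq> 0" and w: "Im w \<noteq> 0"
  shows "resolvent H z (resolvent H w x) = resolvent H w (resolvent H z x)"
proof (rule resolvent_unique[OF z])
  have "H (resolvent H w (resolvent H z x)) - z *\<^sub>C resolvent H w (resolvent H z x)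
      = resolvent H z x + (w - z) *\<^sub>C resolvent H w (resolvent H z x)"
    by (simp add: H_resolvent w scaleC_diff_left)
  also have "\<dots> = resolvent H w x"
    using resolvent_identity[OF w z, of x] by (metis add.commute diff_add_cancel)
  finally show "H (resolvent H w (resolvent H z x)) - z *\<^sub>C resolvent H w (resolvent H z x) = resolvent H w x" .
qed

section \<open>The Cayley transform\<close>

text \<open>The unitary (H - i)(H + i)^(-1), written with the resolvent at -i. Its powers play the
  role of the evolution at integer times.\<close>

definition cayley :: "'a ell2 \<Rightarrow> 'a ell2" where
  "cayley x = x - (2 * \<i>) *\<^sub>C resolvent H (- \<i>) x"
definition cayley_inv :: "'a ell2 \<Rightarrow> 'a ell2" where
  "cayley_inv x = x + (2 * \<i>) *\<^sub>C resolvent H \<i> x"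

lemma clin_cayley: "clin cayley"
  unfolding cayley_def by (intro clin_diff_op clin_id clin_compose[OF clin_scaleC_op] clin_resolvent) simp
lemma clin_cayley_inv: "clin cayley_inv"
  unfolding cayley_inv_def by (intro clin_add_op clin_id clin_compose[OF clin_scaleC_op] clin_resolvent) simp

lemma cayley_cayley_inv: "cayley (cayley_inv x) = x"
proof -
  have i: "resolvent H \<i> x - resolvent H (- \<i>) x = (2 * \<i>) *\<^sub>C resolvent H (-\<i>) (resolvent H \<i> x)"
    using resolvent_identity[of \<i> "- \<i>" x] resolvent_commute[of \<i> "- \<i>" x] by simp
  have "cayley (cayley_inv x) = x + (2 * \<i>) *\<^sub>C (resolvent H \<i> x - resolvent H (- \<i>) x)
     - (2 * \<i> * (2 * \<i>)) *\<^sub>C resolvent H (-\<i>) (resolvent H \<i> x)"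
    unfolding cayley_def cayley_inv_def
    by (simp add: clin_add clin_scaleC clin_resolvent scaleC_add_right scaleC_diff_right del: mult_minus_right)
  then show ?thesis unfolding i by simp
qed

lemma cayley_inv_cayley: "cayley_inv (cayley x) = x"
proof -
  have i: "resolvent H \<i> x - resolvent H (- \<i>) x = (2 * \<i>) *\<^sub>C resolvent H \<i> (resolvent H (- \<i>) x)"
    using resolvent_identity[of \<i> "- \<i>" x] by simp
  have "cayley_inv (cayley x) = x + (2 * \<i>) *\<^sub>C (resolvent H \<i> x - resolvent H (- \<i>) x)
     - (2 * \<i> * (2 * \<i>)) *\<^sub>C resolvent H \<i> (resolvent H (-\<i>) x)"
    unfolding cayley_def cayley_inv_def
    by (simp add: clin_diff clin_scaleC clin_resolvent scaleC_add_right scaleC_diff_right del: mult_minus_right)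
  then show ?thesis unfolding i by simp
qed

lemma inner_cayley: "inner (cayley x) y = inner x (cayley_inv y)"
  unfolding cayley_def cayley_inv_def
  by (simp add: inner_diff_left inner_add_right inner_scaleC_left inner_resolvent clin_scaleC clin_resolvent)

lemma norm_cayley [simp]: "norm (cayley x) = norm x"
  by (simp add: norm_eq_sqrt_inner inner_cayley cayley_inv_cayley)
lemma norm_cayley_inv [simp]: "norm (cayley_inv x) = norm x"
  using norm_cayley[of "cayley_inv x"] by (simp add: cayley_cayley_inv)

lemma clin_cayley_pow: "clin (cayley ^^ n)"
proof (induction n)
  case (Suc n)
  show ?case using clin_compose[OF clin_cayley Suc] by (simp add: comp_def)
qed (simp add: clin_id id_def)
lemma clin_cayley_inv_pow: "clin (cayley_inv ^^ n)"
proof (induction n)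
  case (Suc n)
  show ?case using clin_compose[OF clin_cayley_inv Suc] by (simp add: comp_def)
qed (simp add: clin_id id_def)
lemma norm_cayley_pow [simp]: "norm ((cayley ^^ n) x) = norm x"
  by (induction n) auto
lemma norm_cayley_inv_pow [simp]: "norm ((cayley_inv ^^ n) x) = norm x"
  by (induction n) auto
lemma inner_cayley_pow: "inner ((cayley ^^ n) x) y = inner x ((cayley_inv ^^ n) y)"
  by (induction n arbitrary: y) (auto simp: inner_cayley funpow_swap1[of cayley_inv])
lemma cayley_pow_inv: "(cayley ^^ n) ((cayley_inv ^^ n) x) = x"
  by (induction n arbitrary: x) (auto simp: funpow_swap1[of cayley_inv] cayley_cayley_inv)
lemma cayley_inv_pow: "(cayley_inv ^^ n) ((cayley ^^ n) x) = x"
  by (induction n arbitrary: x) (auto simp: cayley_inv_cayley funpow_swap1[of cayley_inv])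

text \<open>(H - i)^(-1) cancels the numerator of (H - i)(H + i)^(-1). This absorbs the surplus
  Cayley transform in one step of the wave sequence, see \<open>inner_wave_step\<close>.\<close>

lemma resolvent_cayley: "resolvent H \<i> (cayley x) = resolvent H (- \<i>) x"
proof -
  have "(2 * \<i>) *\<^sub>C resolvent H \<i> (resolvent H (- \<i>) x) = resolvent H \<i> x - resolvent H (- \<i>) x"
    using resolvent_identity[of \<i> "- \<i>" x] by simp
  then show ?thesis by (simp add: cayley_def clin_diff clin_scaleC clin_resolvent)
qed

end

section \<open>Kato smoothness in discrete time\<close>

lemma cis_root_sum:
  assumes "l < L" "m < L"
  shows "(\<Sum>j<L. cis (2 * pi * real j * real l / real L) * cnj (cis (2 * pi * real j * real m / real L)))
     = (if l = m then of_nat L else 0)"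
proof (cases "l = m")
  case True
  then show ?thesis by (simp add: cis_cnj cis_mult)
next
  case False
  define w where "w = cis (2 * pi * (real l - real m) / real L)"
  have "w \<noteq> 1"
  proof
    assume "w = 1"
    then have "cos (2 * pi * (real l - real m) / real L) = 1" by (simp add: w_def complex_eq_iff)
    then obtain n :: int where "2 * pi * (real l - real m) / real L = of_int n * 2 * pi"
      by (auto simp: cos_one_2pi_int)
    then have "2 * pi * ((real l - real m) / real L) = 2 * pi * of_int n" by simp
    then have "(real l - real m) / real L = of_int n" by (simp only: mult_cancel_left) simp
    then have "real l - real m = of_int n * real L" using assms by (simp add: divide_eq_eq split: if_splits)
    then have "of_int (int l - int m) = (of_int (n * int L) :: real)" by simp
    then have e: "int l - int m = n * int L" using of_int_eq_iff by blast
    have "\<bar>int l - int m\<bar> < int L" using assms by linarith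
    then have "\<bar>n\<bar> * int L < 1 * int L" unfolding e by (simp add: abs_mult)
    then have "\<bar>n\<bar> < 1" using assms by (subst (asm) mult_less_cancel_right_pos) auto
    then show False using e False by simp
  qed
  have pow: "w ^ j = cis (real j * (2 * pi * (real l - real m) / real L))" for j
    unfolding w_def Complex.DeMoivre by (simp add: mult.assoc)
  have "w ^ L = cis (2 * pi * (real l - real m))" unfolding pow using assms by simp
  also have "\<dots> = 1" by (rule cis_multiple_2pi) auto
  finally have "w ^ L = 1" .
  then have "(\<Sum>j<L. w ^ j) = 0" using \<open>w \<noteq> 1\<close> by (simp add: geometric_sum)
  moreover have "cis (2 * pi * real j * real l / real L) * cnj (cis (2 * pi * real j * real m / real L)) = w ^ j" for j
    unfolding pow cis_cnj cis_mult by (rule arg_cong[where f = cis]) (simp add: algebra_simps diff_divide_distrib)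
  ultimately show ?thesis using False by simp
qed

text \<open>Orthogonality is kept as a hypothesis on \<open>e\<close> because the identity is
  applied both to the matrix of roots of unity and to its conjugate.\<close>

lemma discrete_parseval:
  fixes e :: "nat \<Rightarrow> nat \<Rightarrow> complex" and f :: "nat \<Rightarrow> 'a ell2"
  assumes orth: "\<And>l m. l < L \<Longrightarrow> m < L \<Longrightarrow> (\<Sum>j<L. e j l * cnj (e j m)) = (if l = m then of_nat L else 0)"
  shows "(\<Sum>j<L. (norm (\<Sum>l<L. e j l *\<^sub>C f l))\<^sup>2) = real L * (\<Sum>l<L. (norm (f l))\<^sup>2)"
proof -
  have "(\<Sum>j<L. (norm (\<Sum>l<L. e j l *\<^sub>C f l))\<^sup>2)
      = (\<Sum>j<L. \<Sum>m<L. \<Sum>l<L. inner ((e j l * cnj (e j m)) *\<^sub>C f l) (f m))"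
    unfolding power2_norm_eq_inner inner_sum_left inner_sum_right
    by (intro sum.cong refl) (simp add: inner_scaleC_left mult.commute)
  also have "\<dots> = (\<Sum>m<L. \<Sum>j<L. \<Sum>l<L. inner ((e j l * cnj (e j m)) *\<^sub>C f l) (f m))"
    by (rule sum.swap)
  also have "\<dots> = (\<Sum>m<L. \<Sum>l<L. \<Sum>j<L. inner ((e j l * cnj (e j m)) *\<^sub>C f l) (f m))"
    by (intro sum.cong refl sum.swap)
  also have "\<dots> = (\<Sum>m<L. \<Sum>l<L. inner ((\<Sum>j<L. e j l * cnj (e j m)) *\<^sub>C f l) (f m))"
    by (simp add: scaleC_sum_left inner_sum_left)
  also have "\<dots> = (\<Sum>m<L. \<Sum>l<L. if l = m then real L * (norm (f m))\<^sup>2 else 0)"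
  proof (intro sum.cong refl)
    fix l m assume "l \<in> {..<L}" "m \<in> {..<L}"
    then show "inner ((\<Sum>j<L. e j l * cnj (e j m)) *\<^sub>C f l) (f m) = (if l = m then real L * (norm (f m))\<^sup>2 else 0)"
      using scaleR_scaleC[of "real L" "f m", symmetric] by (simp add: orth power2_norm_eq_inner)
  qed
  also have "\<dots> = real L * (\<Sum>l<L. (norm (f l))\<^sup>2)"
    by (simp add: sum.delta sum_distrib_left)
  finally show ?thesis .
qed

text \<open>The uniform bound on A (H - z)^(-1) A is the resolvent form of Kato smoothness. What it
  is used for is \<open>smoothness\<close>: square summability of A (H + i)^(-1) along the orbits of
  the Cayley transform.\<close>

locale smooth = selfadjoint +
  fixes A :: "'a ell2 \<Rightarrow> 'a ell2" and K :: real
  assumes symA: "symop A" and K: "K \<ge> 0"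
    and bound: "\<And>z x. Im z \<noteq> 0 \<Longrightarrow> norm (A (resolvent H z (A x))) \<le> K * norm x"
begin

lemma clin_A: "clin A" using symA by (simp add: symop_def)
lemma inner_A: "inner (A x) y = inner x (A y)" using symA by (simp add: symop_def)

text \<open>Since the resolvents at z and \<open>cnj z\<close> differ by 2 i Im z times their
  product, the squared norm of R(z) A x is a matrix element of A (R(z) - R(cnj z)) A divided by 2 i
  Im z. The hypothesis bounds each of the two terms by K.\<close>

lemma Im_times_resolvent_A:
  assumes z: "Im z \<noteq> 0"
  shows "\<bar>Im z\<bar> * (norm (resolvent H z (A x)))\<^sup>2 \<le> K * (norm x)\<^sup>2"
proof -
  have z': "Im (cnj z) \<noteq> 0" using z by simp
  let ?u = "resolvent H z (A x) - resolvent H (cnj z) (A x)"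
  have d: "?u = (z - cnj z) *\<^sub>C resolvent H (cnj z) (resolvent H z (A x))"
    using resolvent_identity[OF z z', of "A x"] resolvent_commute[OF z z'] by simp
  have "(norm (resolvent H z (A x)))\<^sup>2 = inner (A x) (resolvent H (cnj z) (resolvent H z (A x)))"
    by (simp add: power2_norm_eq_inner inner_resolvent[OF z])
  also have "\<dots> = inner (A x) ((1 / (z - cnj z)) *\<^sub>C ?u)"
    unfolding d using z by (simp add: complex_diff_cnj)
  also have "\<dots> = inner x ((1 / (z - cnj z)) *\<^sub>C (A (resolvent H z (A x)) - A (resolvent H (cnj z) (A x))))"
    by (simp add: inner_A clin_scaleC[OF clin_A] clin_diff[OF clin_A])
  also have "\<dots> \<le> norm x * (cmod (1 / (z - cnj z)) * norm (A (resolvent H z (A x)) - A (resolvent H (cnj z) (A x))))"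
    using norm_cauchy_schwarz[of x] norm_scaleC by metis
  also have "\<dots> \<le> norm x * (1 / (2 * \<bar>Im z\<bar>) * (K * norm x + K * norm x))"
    by (intro mult_left_mono mult_mono order_trans[OF norm_triangle_ineq4] add_mono bound z z')
       (auto simp: complex_diff_cnj norm_divide norm_mult)
  also have "\<dots> = K * (norm x)\<^sup>2 / \<bar>Im z\<bar>" by (simp add: power2_eq_square)
  finally show ?thesis using z by (simp add: field_simps)
qed

text \<open>\<open>Y\<close> is (1 - b U^(-1))^(-1) R(i) A with U the Cayley transform. The Moebius
  map b \<mapsto> i (1 + b) / (1 - b) takes the disc to the upper half plane, and the resolvent at
  the image point, divided by 1 - b and applied to A x, is this vector.\<close>

lemma disc_resolvent:
  assumes b: "cmod b < 1"
  obtains Y where "\<And>x. Y x - b *\<^sub>C cayley_inv (Y x) = resolvent H \<i> (A x)"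
    "\<And>x. (1 - (cmod b)\<^sup>2) * (norm (Y x))\<^sup>2 \<le> K * (norm x)\<^sup>2"
proof
  have b1: "1 - b \<noteq> 0" using b by auto
  define \<zeta> where "\<zeta> = \<i> * (1 + b) / (1 - b)"
  \<comment> \<open>The numerator is the weight in the claim; the denominator cancels against the
    factor 1 / (1 - b) in \<open>Y\<close>, squared.\<close>
  have Im: "Im \<zeta> = (1 - (cmod b)\<^sup>2) / (cmod (1 - b))\<^sup>2"
    unfolding \<zeta>_def cmod_power2 by (simp add: Im_divide power2_eq_square algebra_simps)
  have pos: "1 - (cmod b)\<^sup>2 > 0" using b by (simp add: abs_square_less_1)
  then have z: "Im \<zeta> \<noteq> 0" "Im \<zeta> > 0" using b1 by (auto simp: Im)
  define Y where "Y x = (1 / (1 - b)) *\<^sub>C resolvent H \<zeta> (A x)" for x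
  have d: "\<zeta> - \<i> = 2 * \<i> * b / (1 - b)" using b1 by (simp add: \<zeta>_def field_simps)
  show "Y x - b *\<^sub>C cayley_inv (Y x) = resolvent H \<i> (A x)" for x
  proof -
    have "resolvent H \<zeta> (A x) - resolvent H \<i> (A x) = (2 * \<i> * b / (1 - b)) *\<^sub>C resolvent H \<i> (resolvent H \<zeta> (A x))"
      using resolvent_identity[of \<zeta> \<i> "A x"] resolvent_commute[of \<zeta> \<i> "A x"] z by (simp add: d)
    then have e: "resolvent H \<i> (A x) = resolvent H \<zeta> (A x) - (2 * \<i> * b / (1 - b)) *\<^sub>C resolvent H \<i> (resolvent H \<zeta> (A x))"
      by (simp add: algebra_simps)
    have "Y x - b *\<^sub>C cayley_inv (Y x) = (1 - b) *\<^sub>C Y x - (2 * \<i> * b) *\<^sub>C resolvent H \<i> (Y x)"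
      by (simp add: cayley_inv_def scaleC_add_right scaleC_diff_left mult.commute mult.left_commute)
    also have "\<dots> = resolvent H \<i> (A x)"
      unfolding e using b1 by (simp add: Y_def clin_scaleC[OF clin_resolvent])
    finally show ?thesis .
  qed
  show "(1 - (cmod b)\<^sup>2) * (norm (Y x))\<^sup>2 \<le> K * (norm x)\<^sup>2" for x
  proof -
    have "(1 - (cmod b)\<^sup>2) * (norm (Y x))\<^sup>2 = Im \<zeta> * (norm (resolvent H \<zeta> (A x)))\<^sup>2"
      by (simp add: Y_def norm_divide power_divide Im)
    also have "\<dots> \<le> K * (norm x)\<^sup>2" using Im_times_resolvent_A[of \<zeta> x] z by simp
    finally show ?thesis .
  qed
qed

text \<open>A Fourier transform of length L in the time index turns the periodic recursion y l - r
  U^(-1) y (l + 1) = h l into L equations that \<open>disc_resolvent\<close> solves at points of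
  modulus r. Parseval then bounds the sum of the squared norms of y, but with the diverging factor 1
  / (1 - r^2). The vanishing data at N, ..., L - 1 pay for it: there y decays geometrically
  backwards from y L = y 0, and the squared norms sum to r^2 (1 - r^(2 (L - N))) / (1 - r^2) times
  that of y 0.\<close>

lemma damped_bound:
  fixes g :: "nat \<Rightarrow> 'a ell2"
  assumes r: "0 < r" "r < 1" and g0: "\<And>n. n \<ge> N \<Longrightarrow> g n = 0" and NL: "N < L"
  shows "r\<^sup>2 * (1 - r ^ (2 * (L - N))) * (norm (\<Sum>n<N. r ^ n *\<^sub>R (cayley_inv ^^ n) (resolvent H \<i> (A (g n)))))\<^sup>2
     \<le> (1 + r ^ L)\<^sup>2 * (K * (\<Sum>n<N. (norm (g n))\<^sup>2))"
proof -
  define E where "E j l = cis (2 * pi * real j * real l / real L)" for j l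
  have orth: "(\<Sum>j<L. E j l * cnj (E j m)) = (if l = m then of_nat L else 0)" if "l < L" "m < L" for l m
    unfolding E_def by (rule cis_root_sum[OF that])
  have sym: "E j l = E l j" for j l by (simp add: E_def mult.commute mult.left_commute mult.assoc)
  have orth': "(\<Sum>l<L. cnj (E j l) * cnj (cnj (E m l))) = (if j = m then of_nat L else 0)" if "j < L" "m < L" for j m
  proof -
    have "cnj (E j l) * cnj (cnj (E m l)) = E l m * cnj (E l j)" for l
      using sym[of j l] sym[of m l] by (simp only: complex_cnj_cnj mult.commute)
    then show ?thesis using orth[OF that(2,1)] by simp
  qed
  have L: "real L > 0" "of_nat L \<noteq> (0::complex)" using NL by auto
  define h where "h n = resolvent H \<i> (A (g n))" for n
  define gh where "gh j = (\<Sum>m<L. E j m *\<^sub>C g m)" for j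
  \<comment> \<open>A shift of the time index multiplies mode j by \<open>cnj (E j 1)\<close>; the
    damping r moves this point from the circle into the disc.\<close>
  define b where "b j = of_real r * cnj (E j 1)" for j
  have nb: "cmod (b j) = r" for j using r by (simp add: b_def E_def norm_mult)
  have "\<exists>Y. \<forall>j. Y j - b j *\<^sub>C cayley_inv (Y j) = resolvent H \<i> (A (gh j)) \<and>
     (1 - r\<^sup>2) * (norm (Y j))\<^sup>2 \<le> K * (norm (gh j))\<^sup>2"
  proof (rule choice, rule allI)
    fix j
    obtain Y where "\<And>x. Y x - b j *\<^sub>C cayley_inv (Y x) = resolvent H \<i> (A x)"
      "\<And>x. (1 - (cmod (b j))\<^sup>2) * (norm (Y x))\<^sup>2 \<le> K * (norm x)\<^sup>2"
      using disc_resolvent[of "b j"] nb r by metis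
    then show "\<exists>y. y - b j *\<^sub>C cayley_inv y = resolvent H \<i> (A (gh j)) \<and>
      (1 - r\<^sup>2) * (norm y)\<^sup>2 \<le> K * (norm (gh j))\<^sup>2" by (auto simp: nb)
  qed
  then obtain Y where Y: "\<And>j. Y j - b j *\<^sub>C cayley_inv (Y j) = resolvent H \<i> (A (gh j))"
    "\<And>j. (1 - r\<^sup>2) * (norm (Y j))\<^sup>2 \<le> K * (norm (gh j))\<^sup>2" by blast
  define y where "y l = (\<Sum>j<L. cnj (E j l) *\<^sub>C ((1 / of_nat L) *\<^sub>C Y j))" for l
  have rec: "y l - r *\<^sub>R cayley_inv (y (Suc l)) = h l" if "l < L" for l
  proof -
    have EE: "cnj (E j (Suc l)) = cnj (E j l) * cnj (E j 1)" for j
      unfolding E_def cis_cnj cis_mult by (rule arg_cong[where f = cis]) (simp add: field_simps add_divide_distrib)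
    have "r *\<^sub>R cayley_inv (y (Suc l)) = (\<Sum>j<L. (cnj (E j l) * (1 / of_nat L)) *\<^sub>C (b j *\<^sub>C cayley_inv (Y j)))"
      unfolding y_def EE by (simp add: clin_sum[OF clin_cayley_inv] clin_scaleC[OF clin_cayley_inv]
          scaleR_scaleC scaleC_sum_right b_def mult.commute mult.left_commute)
    then have "y l - r *\<^sub>R cayley_inv (y (Suc l)) = (\<Sum>j<L. (cnj (E j l) * (1 / of_nat L)) *\<^sub>C (Y j - b j *\<^sub>C cayley_inv (Y j)))"
      unfolding y_def by (simp add: sum_subtractf scaleC_diff_right)
    also have "\<dots> = (\<Sum>j<L. (cnj (E j l) * (1 / of_nat L)) *\<^sub>C (\<Sum>m<L. E j m *\<^sub>C h m))"
      unfolding Y gh_def h_def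
      by (simp add: clin_sum[OF clin_A] clin_scaleC[OF clin_A] clin_sum[OF clin_resolvent] clin_scaleC[OF clin_resolvent])
    also have "\<dots> = (\<Sum>m<L. ((1 / of_nat L) * (\<Sum>j<L. E j m * cnj (E j l))) *\<^sub>C h m)"
      unfolding scaleC_sum_right sum_distrib_left scaleC_sum_left
      by (subst sum.swap) (simp add: mult.commute mult.left_commute)
    also have "\<dots> = (\<Sum>m<L. if m = l then h m else 0)"
      using that L by (intro sum.cong refl) (auto simp: orth)
    finally show ?thesis using that by simp
  qed
  have yL: "y L = y 0" by (simp add: y_def E_def)
  have h0: "h n = 0" if "n \<ge> N" for n
    unfolding h_def by (simp add: g0 that clin_0[OF clin_A] clin_0[OF clin_resolvent])
  \<comment> \<open>For k = L periodicity closes the recursion, so the sum to be bounded is y 0 -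
    r^L U^(-L) y 0; this produces the factor 1 + r^L.\<close>
  have unroll: "y 0 = (\<Sum>n<k. r ^ n *\<^sub>R (cayley_inv ^^ n) (h n)) + r ^ k *\<^sub>R (cayley_inv ^^ k) (y k)" if "k \<le> L" for k
    using that
  proof (induction k)
    case (Suc k)
    have "y k = h k + r *\<^sub>R cayley_inv (y (Suc k))" using rec[of k] Suc.prems by (simp add: algebra_simps)
    then have "(cayley_inv ^^ k) (y k) = (cayley_inv ^^ k) (h k) + r *\<^sub>R (cayley_inv ^^ Suc k) (y (Suc k))"
      by (simp add: clin_add[OF clin_cayley_inv_pow] scaleR_scaleC clin_scaleC[OF clin_cayley_inv_pow]
           clin_scaleC[OF clin_cayley_inv] funpow_swap1)
    then show ?case using Suc by (simp add: scaleR_add_right mult.commute)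
  qed simp
  define v where "v = (\<Sum>n<N. r ^ n *\<^sub>R (cayley_inv ^^ n) (h n))"
  have "(\<Sum>n<L. r ^ n *\<^sub>R (cayley_inv ^^ n) (h n)) = v"
    unfolding v_def using NL h0 by (intro sum.mono_neutral_right) (auto simp: clin_0[OF clin_cayley_inv_pow])
  then have "v = y 0 - r ^ L *\<^sub>R (cayley_inv ^^ L) (y 0)"
    using unroll[of L] yL by (simp add: algebra_simps)
  then have "norm v \<le> norm (y 0) + r ^ L * norm (y 0)"
    using norm_triangle_ineq4[of "y 0" "r ^ L *\<^sub>R (cayley_inv ^^ L) (y 0)"] r by simp
  then have v: "(norm v)\<^sup>2 \<le> (1 + r ^ L)\<^sup>2 * (norm (y 0))\<^sup>2"
    unfolding power_mult_distrib[symmetric] by (intro power_mono) (auto simp: algebra_simps)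
  \<comment> \<open>From N on the recursion has no source term, and U is isometric, so each step
    back costs exactly a factor r.\<close>
  have rewind: "norm (y (L - p)) = r ^ p * norm (y 0)" if "p \<le> L - N" for p
    using that
  proof (induction p)
    case (Suc p)
    have "y (L - Suc p) = r *\<^sub>R cayley_inv (y (Suc (L - Suc p)))"
      using rec[of "L - Suc p"] h0[of "L - Suc p"] Suc.prems NL by simp
    moreover have "Suc (L - Suc p) = L - p" using Suc.prems NL by linarith
    ultimately show ?case using Suc r by simp
  qed (simp add: yL)
  have "(\<Sum>p\<in>{1..L - N}. (r ^ p * norm (y 0))\<^sup>2) = (\<Sum>p\<in>{1..L - N}. (norm (y (L - p)))\<^sup>2)"
    by (intro sum.cong refl) (simp add: rewind)
  also have "\<dots> = (\<Sum>l\<in>(\<lambda>p. L - p) ` {1..L - N}. (norm (y l))\<^sup>2)"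
    by (subst sum.reindex) (auto simp: inj_on_def)
  also have "\<dots> \<le> (\<Sum>l<L. (norm (y l))\<^sup>2)" using NL by (intro sum_mono2) auto
  also have "\<dots> = real L * (\<Sum>j<L. (norm ((1 / of_nat L :: complex) *\<^sub>C Y j))\<^sup>2)"
    unfolding y_def by (rule discrete_parseval[where e = "\<lambda>l j. cnj (E j l)"]) (rule orth')
  also have "\<dots> = (\<Sum>j<L. (norm (Y j))\<^sup>2) / real L"
    using L by (simp add: norm_divide power_divide sum_divide_distrib[symmetric] power2_eq_square)
  finally have "(1 - r\<^sup>2) * (\<Sum>p\<in>{1..L - N}. (r ^ p * norm (y 0))\<^sup>2) \<le> (1 - r\<^sup>2) * ((\<Sum>j<L. (norm (Y j))\<^sup>2) / real L)"
    using r by (intro mult_left_mono) (auto simp: abs_square_le_1)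
  also have "\<dots> = (\<Sum>j<L. (1 - r\<^sup>2) * (norm (Y j))\<^sup>2) / real L" by (simp add: sum_distrib_left)
  also have "\<dots> \<le> (\<Sum>j<L. K * (norm (gh j))\<^sup>2) / real L"
    by (intro divide_right_mono sum_mono Y) auto
  also have "\<dots> = K * (\<Sum>l<L. (norm (g l))\<^sup>2)"
    unfolding gh_def sum_distrib_left[symmetric] using discrete_parseval[where e = E and f = g, OF orth] L by simp
  also have "(\<Sum>l<L. (norm (g l))\<^sup>2) = (\<Sum>l<N. (norm (g l))\<^sup>2)"
    using NL by (intro sum.mono_neutral_right) (auto simp: g0)
  also have "(1 - r\<^sup>2) * (\<Sum>p\<in>{1..L - N}. (r ^ p * norm (y 0))\<^sup>2) = r\<^sup>2 * (1 - r ^ (2 * (L - N))) * (norm (y 0))\<^sup>2"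
  proof -
    have "(1 - r\<^sup>2) * (\<Sum>p\<in>{1..M}. (r ^ p * norm (y 0))\<^sup>2) = r\<^sup>2 * (1 - r ^ (2 * M)) * (norm (y 0))\<^sup>2" for M
    proof (induction M)
      case (Suc M)
      have "(1 - r\<^sup>2) * (\<Sum>p\<in>{1..Suc M}. (r ^ p * norm (y 0))\<^sup>2)
          = (1 - r\<^sup>2) * (\<Sum>p\<in>{1..M}. (r ^ p * norm (y 0))\<^sup>2) + (1 - r\<^sup>2) * (r ^ Suc M * norm (y 0))\<^sup>2"
        by (simp add: distrib_left)
      also have "\<dots> = r\<^sup>2 * (1 - (r ^ M)\<^sup>2) * (norm (y 0))\<^sup>2 + (1 - r\<^sup>2) * (r * r ^ M * norm (y 0))\<^sup>2"
        by (simp only: Suc power_even_eq power_Suc)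
      also have "\<dots> = r\<^sup>2 * (1 - (r * r ^ M)\<^sup>2) * (norm (y 0))\<^sup>2"
        by (simp add: algebra_simps power2_eq_square)
      finally show ?case by (simp only: power_even_eq power_Suc)
    qed simp
    then show ?thesis .
  qed
  finally have y0: "r\<^sup>2 * (1 - r ^ (2 * (L - N))) * (norm (y 0))\<^sup>2 \<le> K * (\<Sum>l<N. (norm (g l))\<^sup>2)" .
  have "r ^ (2 * (L - N)) \<le> 1" using r by (intro power_le_one) auto
  then have "r\<^sup>2 * (1 - r ^ (2 * (L - N))) * (norm v)\<^sup>2 \<le> r\<^sup>2 * (1 - r ^ (2 * (L - N))) * ((1 + r ^ L)\<^sup>2 * (norm (y 0))\<^sup>2)"
    by (intro mult_left_mono v) auto
  also have "\<dots> \<le> (1 + r ^ L)\<^sup>2 * (K * (\<Sum>l<N. (norm (g l))\<^sup>2))"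
    using mult_left_mono[OF y0, of "(1 + r ^ L)\<^sup>2"] by (simp add: algebra_simps)
  finally show ?thesis unfolding v_def h_def .
qed

text \<open>In \<open>damped_bound\<close> first L tends to infinity for fixed r < 1, which removes
  both powers growing with L; then r tends to 1 in a finite sum.\<close>

lemma dual_smoothness:
  fixes g :: "nat \<Rightarrow> 'a ell2"
  shows "(norm (\<Sum>n<N. (cayley_inv ^^ n) (resolvent H \<i> (A (g n)))))\<^sup>2 \<le> K * (\<Sum>n<N. (norm (g n))\<^sup>2)"
proof -
  define g' where "g' n = (if n < N then g n else 0)" for n
  define h where "h n = (cayley_inv ^^ n) (resolvent H \<i> (A (g n)))" for n
  define G where "G = K * (\<Sum>n<N. (norm (g n))\<^sup>2)"
  have step: "r\<^sup>2 * (norm (\<Sum>n<N. r ^ n *\<^sub>R h n))\<^sup>2 \<le> G" if r: "0 < r" "r < 1" for r :: real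
  proof (rule LIMSEQ_le)
    let ?a = "\<lambda>M::nat. r\<^sup>2 * (1 - (r\<^sup>2) ^ Suc M) * (norm (\<Sum>n<N. r ^ n *\<^sub>R h n))\<^sup>2"
    let ?b = "\<lambda>M::nat. (1 + r ^ N * r ^ Suc M)\<^sup>2 * G"
    have lim: "(\<lambda>M. (r\<^sup>2) ^ Suc M) \<longlonglongrightarrow> 0" "(\<lambda>M. r ^ Suc M) \<longlonglongrightarrow> 0"
      using r by (auto intro!: LIMSEQ_Suc LIMSEQ_realpow_zero simp: abs_square_less_1)
    have "?a \<longlonglongrightarrow> r\<^sup>2 * (1 - 0) * (norm (\<Sum>n<N. r ^ n *\<^sub>R h n))\<^sup>2" "?b \<longlonglongrightarrow> (1 + r ^ N * 0)\<^sup>2 * G"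
      by (intro tendsto_mult tendsto_diff tendsto_power tendsto_add tendsto_const lim)+
    then show "?a \<longlonglongrightarrow> r\<^sup>2 * (norm (\<Sum>n<N. r ^ n *\<^sub>R h n))\<^sup>2" "?b \<longlonglongrightarrow> G" by simp_all
    have e: "(\<Sum>n<N. r ^ n *\<^sub>R (cayley_inv ^^ n) (resolvent H \<i> (A (g' n)))) = (\<Sum>n<N. r ^ n *\<^sub>R h n)"
      "K * (\<Sum>n<N. (norm (g' n))\<^sup>2) = G"
      unfolding G_def by (auto simp: g'_def h_def intro!: sum.cong)
    have e': "r ^ (2 * (N + Suc M - N)) = (r\<^sup>2) ^ Suc M" "r ^ (N + Suc M) = r ^ N * r ^ Suc M" for M
      by (simp_all only: add_diff_cancel_left' power_mult power_add)
    have "?a M \<le> ?b M" for M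
      by (rule damped_bound[OF r, of N g' "N + Suc M", unfolded e e']) (auto simp: g'_def)
    then show "\<exists>M0. \<forall>M\<ge>M0. ?a M \<le> ?b M" by blast
  qed
  have "1\<^sup>2 * (norm (\<Sum>n<N. 1 ^ n *\<^sub>R h n))\<^sup>2 \<le> G"
  proof (rule tendsto_upperbound)
    show "((\<lambda>r. r\<^sup>2 * (norm (\<Sum>n<N. r ^ n *\<^sub>R h n))\<^sup>2) \<longlongrightarrow> 1\<^sup>2 * (norm (\<Sum>n<N. 1 ^ n *\<^sub>R h n))\<^sup>2) (at_left (1::real))"
      by (intro tendsto_intros)
    show "\<forall>\<^sub>F r in at_left (1::real). r\<^sup>2 * (norm (\<Sum>n<N. r ^ n *\<^sub>R h n))\<^sup>2 \<le> G"
      using eventually_at_left_real[of 0 "1::real"] by (auto elim!: eventually_mono intro: step)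
  qed simp
  then show ?thesis by (simp add: h_def G_def)
qed

text \<open>Duality: with g n chosen as the very vectors to be summed, their squared norms add up to
  S = (x, w) for the vector w of \<open>dual_smoothness\<close>. Hence S^2 \<le> K S times the
  squared norm of x, and one S cancels.\<close>

lemma smoothness: "(\<Sum>n<N. (norm (A (resolvent H (- \<i>) ((cayley ^^ n) x))))\<^sup>2) \<le> K * (norm x)\<^sup>2"
proof -
  define g where "g n = A (resolvent H (- \<i>) ((cayley ^^ n) x))" for n
  define S where "S = (\<Sum>n<N. (norm (g n))\<^sup>2)"
  define w where "w = (\<Sum>n<N. (cayley_inv ^^ n) (resolvent H \<i> (A (g n))))"
  have S0: "S \<ge> 0" by (auto simp: S_def intro: sum_nonneg)
  have "S = (\<Sum>n<N. inner x ((cayley_inv ^^ n) (resolvent H \<i> (A (g n)))))"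
    unfolding S_def power2_norm_eq_inner
    by (intro sum.cong refl) (subst g_def, simp add: inner_A inner_resolvent inner_cayley_pow)
  also have "\<dots> \<le> norm x * norm w"
    unfolding w_def inner_sum_right[symmetric] by (rule norm_cauchy_schwarz)
  finally have "S\<^sup>2 \<le> (norm x * norm w)\<^sup>2" using S0 by (intro power_mono)
  also have "\<dots> \<le> (norm x)\<^sup>2 * (K * S)"
    unfolding power_mult_distrib w_def S_def by (intro mult_left_mono dual_smoothness) auto
  finally have "S * S \<le> (K * (norm x)\<^sup>2) * S" by (simp add: power2_eq_square algebra_simps)
  then show ?thesis using S0 K unfolding S_def[symmetric] g_def[symmetric]
    by (cases "S = 0") auto
qed

end

section \<open>Wave operators as limits in discrete time\<close>

lemma sum_mult_le_sqrt:
  fixes a b :: "nat \<Rightarrow> real"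
  shows "(\<Sum>k\<in>I. a k * b k) \<le> sqrt (\<Sum>k\<in>I. (a k)\<^sup>2) * sqrt (\<Sum>k\<in>I. (b k)\<^sup>2)"
  using L2_set_mult_ineq[of "\<lambda>k. \<bar>a k\<bar>" "\<lambda>k. \<bar>b k\<bar>" I] 
  by (intro order_trans[OF sum_mono[of I "\<lambda>k. a k * b k" "\<lambda>k. \<bar>\<bar>a k\<bar>\<bar> * \<bar>\<bar>b k\<bar>\<bar>"]])
     (auto simp: L2_set_def abs_mult[symmetric])

text \<open>Both operators are smooth with the same A and K, and their difference factors through A
  on either side. Replacing S by its negative exchanges the two operators, so one construction
  serves both directions.\<close>

locale wave_pair = P: smooth H1 A K + Q: smooth H2 A K
  for H1 H2 A :: "'a ell2 \<Rightarrow> 'a ell2" and K :: real +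
  fixes S :: "'a ell2 \<Rightarrow> 'a ell2" and s :: real
  assumes S: "\<And>x. norm (S x) \<le> s * norm x"
    and diff: "\<And>x. H1 x = H2 x + A (S (A x))"
begin

definition wave_seq :: "'a ell2 \<Rightarrow> nat \<Rightarrow> 'a ell2" where
  "wave_seq x n = (P.cayley_inv ^^ n) ((Q.cayley ^^ n) x)"
definition wave :: "'a ell2 \<Rightarrow> 'a ell2" where "wave x = lim (wave_seq x)"

lemma resolvent_diff:
  "resolvent H2 (- \<i>) x - resolvent H1 (- \<i>) x = resolvent H1 (- \<i>) (A (S (A (resolvent H2 (- \<i>) x))))"
proof -
  have i: "Im (- \<i>) \<noteq> 0" by simp
  let ?u = "resolvent H2 (- \<i>) x" and ?v = "resolvent H1 (- \<i>) x"
  have "H1 (?u - ?v) = x + (- \<i>) *\<^sub>C ?u + A (S (A ?u)) - (x + (- \<i>) *\<^sub>C ?v)"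
    by (simp only: clin_diff[OF P.clin_H] P.H_resolvent[OF i] diff[of ?u] Q.H_resolvent[OF i])
  then show ?thesis
    by (intro P.resolvent_unique[OF i, symmetric]) (simp add: scaleC_diff_right)
qed

text \<open>One step is U1^(-(k+1)) (U2 - U1) U2^k, and U2 - U1 is -2 i R1(-i) A S A R2(-i). Moving
  the left factors to y leaves A R1(i) U1^(k+1) y, which by \<open>resolvent_cayley\<close> is A
  R1(-i) U1^k y: both sides are the quantities that \<open>smoothness\<close> sums.\<close>

lemma inner_wave_step:
  "inner (wave_seq x (Suc k) - wave_seq x k) y \<le>
     2 * s * (norm (A (resolvent H2 (- \<i>) ((Q.cayley ^^ k) x))) * norm (A (resolvent H1 (- \<i>) ((P.cayley ^^ k) y))))"
proof -
  let ?u = "(Q.cayley ^^ k) x" and ?v = "(P.cayley ^^ Suc k) y"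
  have "wave_seq x k = (P.cayley_inv ^^ Suc k) (P.cayley ?u)"
    by (simp add: wave_seq_def funpow_swap1 P.cayley_inv_cayley)
  moreover have "wave_seq x (Suc k) = (P.cayley_inv ^^ Suc k) (Q.cayley ?u)"
    by (simp add: wave_seq_def)
  ultimately have "wave_seq x (Suc k) - wave_seq x k = (P.cayley_inv ^^ Suc k) (Q.cayley ?u - P.cayley ?u)"
    by (simp only: clin_diff[OF P.clin_cayley_inv_pow])
  also have "Q.cayley ?u - P.cayley ?u = (- 2 * \<i>) *\<^sub>C (resolvent H2 (- \<i>) ?u - resolvent H1 (- \<i>) ?u)"
    by (simp add: Q.cayley_def P.cayley_def scaleC_diff_right)
  finally have "inner (wave_seq x (Suc k) - wave_seq x k) y
      = inner (- (2 * \<i>) *\<^sub>C (resolvent H1 (- \<i>) (A (S (A (resolvent H2 (- \<i>) ?u)))))) ?v"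
    by (simp only: resolvent_diff inner_commute[of _ y] P.inner_cayley_pow[symmetric]) (simp add: inner_commute)
  also have "\<dots> = inner ((- (2 * \<i>)) *\<^sub>C S (A (resolvent H2 (- \<i>) ?u))) (A (resolvent H1 \<i> ?v))"
    by (simp add: inner_scaleC_left P.inner_resolvent clin_scaleC[OF P.clin_resolvent] clin_scaleC[OF P.clin_A] P.inner_A
        clin_uminus[OF P.clin_resolvent] clin_uminus[OF P.clin_A])
  also have "resolvent H1 \<i> ?v = resolvent H1 (- \<i>) ((P.cayley ^^ k) y)"
    by (simp add: P.resolvent_cayley)
  also have "inner ((- (2 * \<i>)) *\<^sub>C S (A (resolvent H2 (- \<i>) ?u))) (A (resolvent H1 (- \<i>) ((P.cayley ^^ k) y)))
     \<le> norm ((- (2 * \<i>)) *\<^sub>C S (A (resolvent H2 (- \<i>) ?u))) * norm (A (resolvent H1 (- \<i>) ((P.cayley ^^ k) y)))"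
    by (rule norm_cauchy_schwarz)
  also have "\<dots> \<le> (2 * (s * norm (A (resolvent H2 (- \<i>) ?u)))) * norm (A (resolvent H1 (- \<i>) ((P.cayley ^^ k) y)))"
    using S by (intro mult_right_mono) (auto simp: norm_mult)
  finally show ?thesis by (simp add: algebra_simps)
qed

lemma s_nonneg_or: "s \<ge> 0 \<or> (\<forall>x::'a ell2. x = 0)"
proof (rule disjCI)
  assume "\<not> (\<forall>x::'a ell2. x = 0)"
  then obtain x :: "'a ell2" where "x \<noteq> 0" by auto
  then show "s \<ge> 0" using S[of x] norm_ge_zero[of "S x"]
    by (metis mult_neg_pos not_le order_trans zero_less_norm_iff)
qed

text \<open>Telescope and pair with y, the difference itself. By Cauchy-Schwarz in k and smoothness
  of H1 the factors in y sum to at most sqrt K times the norm of y, which cancels; what remains is a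
  piece of a convergent series depending on x alone.\<close>

lemma wave_seq_diff:
  assumes "m \<le> n" "s \<ge> 0"
  shows "norm (wave_seq x n - wave_seq x m) \<le>
     2 * s * sqrt K * sqrt (\<Sum>k\<in>{m..<n}. (norm (A (resolvent H2 (- \<i>) ((Q.cayley ^^ k) x))))\<^sup>2)"
proof -
  define a where "a k = norm (A (resolvent H2 (- \<i>) ((Q.cayley ^^ k) x)))" for k
  define y where "y = wave_seq x n - wave_seq x m"
  define b where "b k = norm (A (resolvent H1 (- \<i>) ((P.cayley ^^ k) y)))" for k
  have "(norm y)\<^sup>2 = inner (\<Sum>k\<in>{m..<n}. wave_seq x (Suc k) - wave_seq x k) y"
    unfolding power2_norm_eq_inner using assms by (simp add: sum_Suc_diff' y_def)
  also have "\<dots> \<le> (\<Sum>k\<in>{m..<n}. 2 * s * (a k * b k))"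
    unfolding inner_sum_left a_def b_def by (intro sum_mono inner_wave_step)
  also have "\<dots> \<le> 2 * s * (sqrt (\<Sum>k\<in>{m..<n}. (a k)\<^sup>2) * sqrt (\<Sum>k\<in>{m..<n}. (b k)\<^sup>2))"
    unfolding sum_distrib_left[symmetric] using assms by (intro mult_left_mono sum_mult_le_sqrt) auto
  also have "\<dots> \<le> 2 * s * (sqrt (\<Sum>k\<in>{m..<n}. (a k)\<^sup>2) * (sqrt K * norm y))"
  proof -
    have "(\<Sum>k\<in>{m..<n}. (b k)\<^sup>2) \<le> (\<Sum>k<n. (b k)\<^sup>2)" by (intro sum_mono2) auto
    also have "\<dots> \<le> K * (norm y)\<^sup>2" unfolding b_def by (rule P.smoothness)
    finally have "sqrt (\<Sum>k\<in>{m..<n}. (b k)\<^sup>2) \<le> sqrt K * norm y"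
      using real_sqrt_le_mono by (fastforce simp: real_sqrt_mult)
    then show ?thesis using assms by (intro mult_left_mono) (auto intro!: sum_nonneg)
  qed
  finally have "norm y * norm y \<le> (2 * s * sqrt K * sqrt (\<Sum>k\<in>{m..<n}. (a k)\<^sup>2)) * norm y"
    by (simp add: power2_eq_square algebra_simps)
  then have "norm y \<le> 2 * s * sqrt K * sqrt (\<Sum>k\<in>{m..<n}. (a k)\<^sup>2)"
    using assms P.K by (cases "norm y = 0") (auto intro!: mult_nonneg_nonneg sum_nonneg)
  then show ?thesis by (simp add: y_def a_def)
qed

lemma wave_seq_tendsto: "wave_seq x \<longlonglongrightarrow> wave x"
proof (cases "s \<ge> 0")
  case True
  define a where "a k = (norm (A (resolvent H2 (- \<i>) ((Q.cayley ^^ k) x))))\<^sup>2" for k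
  define C where "C = 2 * s * sqrt K"
  have C: "C \<ge> 0" using True P.K by (simp add: C_def)
  have "summable a"
    by (rule summableI_nonneg_bounded[where x = "K * (norm x)\<^sup>2"]) (auto simp: a_def Q.smoothness)
  then have "Cauchy (\<lambda>n. \<Sum>k<n. a k)" by (simp add: summable_iff_convergent convergent_Cauchy)
  have "Cauchy (wave_seq x)"
  proof (rule CauchyI')
    fix e :: real assume e: "e > 0"
    \<comment> \<open>Makes C sqrt d smaller than e; the 1 in the denominator covers C = 0.\<close>
    define d where "d = (e / (C + 1))\<^sup>2"
    have "d > 0" using e C by (simp add: d_def)
    then obtain M where M: "\<And>m n. m \<ge> M \<Longrightarrow> n \<ge> M \<Longrightarrow> norm ((\<Sum>k<m. a k) - (\<Sum>k<n. a k)) < d"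
      using CauchyD[OF \<open>Cauchy (\<lambda>n. \<Sum>k<n. a k)\<close>] by metis
    have "dist (wave_seq x m) (wave_seq x n) < e" if "m \<ge> M" "n > m" for m n
    proof -
      have "(\<Sum>k\<in>{m..<n}. a k) = (\<Sum>k<n. a k) - (\<Sum>k<m. a k)"
        using that by (simp add: sum_diff_nat_ivl[of 0 m n a, symmetric] lessThan_atLeast0)
      then have "(\<Sum>k\<in>{m..<n}. a k) \<le> d" using M[of n m] that by (simp add: abs_less_iff)
      then have "sqrt (\<Sum>k\<in>{m..<n}. a k) \<le> sqrt d" by simp
      also have "sqrt d = e / (C + 1)" using e C by (simp add: d_def)
      finally have "C * sqrt (\<Sum>k\<in>{m..<n}. a k) \<le> C * (e / (C + 1))" using C by (rule mult_left_mono)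
      also have "\<dots> < e" using e C by (simp add: field_simps)
      finally show ?thesis
        using wave_seq_diff[of m n x] that True by (simp add: dist_norm norm_minus_commute a_def C_def)
    qed
    then show "\<exists>M. \<forall>m\<ge>M. \<forall>n>m. dist (wave_seq x m) (wave_seq x n) < e" by blast
  qed
  then show ?thesis unfolding wave_def by (simp add: Cauchy_convergent_iff convergent_LIMSEQ_iff)
next
  case False
  then have 0: "y = z" for y z :: "'a ell2" using s_nonneg_or by metis
  have "wave_seq x = (\<lambda>_. wave x)" using 0 by auto
  then show ?thesis by simp
qed

lemma norm_wave [simp]: "norm (wave x) = norm x"
proof -
  have "(\<lambda>n. norm (wave_seq x n)) \<longlonglongrightarrow> norm (wave x)"
    by (intro tendsto_norm wave_seq_tendsto)
  then show ?thesis by (simp add: wave_seq_def LIMSEQ_const_iff)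
qed

lemma clin_wave: "clin wave"
proof (rule clinI[where K = 1])
  have s: "wave_seq (x + y) n = wave_seq x n + wave_seq y n" "wave_seq (c *\<^sub>C x) n = c *\<^sub>C wave_seq x n" for x y c n
    by (simp_all add: wave_seq_def clin_add[OF Q.clin_cayley_pow] clin_add[OF P.clin_cayley_inv_pow]
        clin_scaleC[OF Q.clin_cayley_pow] clin_scaleC[OF P.clin_cayley_inv_pow])
  show "wave (x + y) = wave x + wave y" for x y
    using tendsto_add[OF wave_seq_tendsto[of x] wave_seq_tendsto[of y]]
    by (intro LIMSEQ_unique[OF wave_seq_tendsto]) (simp only: s(1)[symmetric])
  show "wave (c *\<^sub>C x) = c *\<^sub>C wave x" for c x
    using clin_tendsto[OF clin_scaleC_op wave_seq_tendsto[of x], of c]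
    by (intro LIMSEQ_unique[OF wave_seq_tendsto]) (simp only: s(2)[symmetric])
qed simp

text \<open>A Cayley transform of H1 applied to the approximant n + 1 gives the approximant n at U2
  x; the limit does not see the shift of n.\<close>

lemma cayley_wave: "P.cayley (wave x) = wave (Q.cayley x)"
proof (rule LIMSEQ_unique)
  show "(\<lambda>n. P.cayley (wave_seq x (Suc n))) \<longlonglongrightarrow> P.cayley (wave x)"
    by (intro clin_tendsto[OF P.clin_cayley] LIMSEQ_Suc wave_seq_tendsto)
  have "P.cayley (wave_seq x (Suc n)) = wave_seq (Q.cayley x) n" for n
    by (simp add: wave_seq_def P.cayley_cayley_inv funpow_swap1[of Q.cayley])
  then show "(\<lambda>n. P.cayley (wave_seq x (Suc n))) \<longlonglongrightarrow> wave (Q.cayley x)"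
    using wave_seq_tendsto[of "Q.cayley x"] by simp
qed

text \<open>Intertwining the Cayley transforms means intertwining the resolvents at -i. Evaluated at
  (H2 + i) x this passes to the operators.\<close>

lemma H_wave: "H1 (wave x) = wave (H2 x)"
proof -
  have i: "Im (- \<i>) \<noteq> 0" by simp
  let ?u = "H2 x + \<i> *\<^sub>C x"
  have x: "resolvent H2 (- \<i>) ?u = x" by (rule Q.resolvent_unique[OF i]) simp
  have "(2 * \<i>) *\<^sub>C resolvent H1 (- \<i>) (wave ?u) = (2 * \<i>) *\<^sub>C wave (resolvent H2 (- \<i>) ?u)"
    using cayley_wave[of ?u] unfolding P.cayley_def Q.cayley_def
    by (simp add: clin_diff[OF clin_wave] clin_scaleC[OF clin_wave])
  then have "(1 / (2 * \<i>)) *\<^sub>C (2 * \<i>) *\<^sub>C resolvent H1 (- \<i>) (wave ?u) = (1 / (2 * \<i>)) *\<^sub>C (2 * \<i>) *\<^sub>C wave x"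
    by (simp only: x)
  then have "resolvent H1 (- \<i>) (wave ?u) = wave x" by simp
  then have "H1 (wave x) = wave ?u - \<i> *\<^sub>C wave x"
    using P.H_resolvent[OF i, of "wave ?u"] by simp
  then show ?thesis by (simp add: clin_add[OF clin_wave] clin_scaleC[OF clin_wave])
qed

end

text \<open>The n-th approximants in opposite directions are exact inverses and isometries. So the
  forward approximant at \<open>B.wave x\<close> misses x by exactly the distance of
  \<open>B.wave_seq x n\<close> from its limit. Existence of both limits thus yields
  surjectivity.\<close>

lemma wave_inverse:
  assumes 1: "wave_pair H1 H2 A K S s" and 2: "wave_pair H2 H1 A K S' s'"
  shows "wave_pair.wave H1 H2 (wave_pair.wave H2 H1 x) = x"
proof -
  interpret F: wave_pair H1 H2 A K S s by fact
  interpret B: wave_pair H2 H1 A K S' s' by fact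
  have "(\<lambda>n. norm (F.wave_seq (B.wave x) n - x)) \<longlonglongrightarrow> 0"
  proof -
    have "norm (F.wave_seq (B.wave x) n - x) = norm (B.wave x - B.wave_seq x n)" for n
    proof -
      have x: "x = F.wave_seq (B.wave_seq x n) n"
        by (simp add: F.wave_seq_def B.wave_seq_def F.Q.cayley_pow_inv F.P.cayley_inv_pow)
      have "F.wave_seq (B.wave x) n - F.wave_seq (B.wave_seq x n) n = F.wave_seq (B.wave x - B.wave_seq x n) n"
        by (simp add: F.wave_seq_def clin_diff[OF F.Q.clin_cayley_pow] clin_diff[OF F.P.clin_cayley_inv_pow])
      then show ?thesis using x by (simp add: F.wave_seq_def)
    qed
    moreover have "(\<lambda>n. norm (B.wave x - B.wave_seq x n)) \<longlonglongrightarrow> norm (B.wave x - B.wave x)"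
      by (intro tendsto_intros B.wave_seq_tendsto)
    ultimately show ?thesis by simp
  qed
  then have "F.wave_seq (B.wave x) \<longlonglongrightarrow> x" by (simp add: tendsto_norm_zero_iff LIM_zero_iff)
  with F.wave_seq_tendsto show ?thesis using LIMSEQ_unique by blast
qed

text \<open>The condition s K \<le> 1/2 closes the second resolvent identity into the bound 2 K for
  the perturbed operator. The unperturbed one obeys 2 K as well, so that both fit into
  \<open>wave_pair\<close>, in either order.\<close>

theorem smooth_perturbation:
  assumes H0: "symop H0" and A: "symop A" and S: "symop S"
    and bound: "\<And>z x. Im z \<noteq> 0 \<Longrightarrow> norm (A (resolvent H0 z (A x))) \<le> K * norm x"
    and s: "\<And>x. norm (S x) \<le> s * norm x" and K: "0 \<le> K" and s0: "0 \<le> s" "s * K \<le> 1 / 2"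
  shows "\<exists>W. clin W \<and> bij W \<and> (\<forall>x. norm (W x) = norm x) \<and> (\<forall>x. H0 (W x) + A (S (A (W x))) = W (H0 x))"
proof -
  define H where "H x = H0 x + A (S (A x))" for x
  have cl: "clin H0" "clin A" "clin S" using H0 A S by (auto simp: symop_def)
  have symH: "symop H"
    unfolding symop_def H_def
    using H0 A S clin_add_op[OF cl(1) clin_compose[OF cl(2) clin_compose[OF cl(3) cl(2)]]]
    by (simp add: inner_add_left inner_add_right symop_def)
  interpret P0: selfadjoint H0 by standard fact
  interpret P: selfadjoint H by standard fact
  have b: "norm (A (resolvent H z (A x))) \<le> 2 * K * norm x" if z: "Im z \<noteq> 0" for z x
  proof -
    let ?R = "resolvent H z (A x)"
    \<comment> \<open>The second resolvent identity. After applying A, the unknown A R A appears on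
      both sides and its coefficient on the right is at most 1/2.\<close>
    have "resolvent H0 z (A x - A (S (A ?R))) = ?R"
      by (rule P0.resolvent_unique[OF z]) (use P.H_resolvent[OF z, of "A x"] in \<open>simp add: H_def algebra_simps\<close>)
    then have "A ?R = A (resolvent H0 z (A x)) - A (resolvent H0 z (A (S (A ?R))))"
      by (metis clin_diff[OF cl(2)] clin_diff[OF P0.clin_resolvent[OF z]])
    then have "norm (A ?R) \<le> norm (A (resolvent H0 z (A x))) + norm (A (resolvent H0 z (A (S (A ?R)))))"
      by (metis norm_triangle_ineq4)
    also have "\<dots> \<le> K * norm x + K * norm (S (A ?R))"
      by (intro add_mono bound z)
    also have "\<dots> \<le> K * norm x + K * (s * norm (A ?R))"
      by (intro add_left_mono mult_left_mono s K)
    also have "\<dots> \<le> K * norm x + 1 / 2 * norm (A ?R)"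
      using mult_right_mono[OF s0(2), of "norm (A ?R)"] by (simp add: algebra_simps)
    finally show ?thesis by simp
  qed
  have b0: "norm (A (resolvent H0 z (A x))) \<le> 2 * K * norm x" if z: "Im z \<noteq> 0" for z x
    using bound[OF z, of x] mult_nonneg_nonneg[OF K norm_ge_zero[of x]] by linarith
  have w1: "wave_pair H H0 A (2 * K) S s"
    by unfold_locales (simp_all add: H0 A symH K b b0 s H_def)
  have w2: "wave_pair H0 H A (2 * K) (\<lambda>x. - S x) s"
    by unfold_locales (simp_all add: H0 A symH K b b0 s H_def clin_uminus[OF cl(2)])
  interpret W: wave_pair H H0 A "2 * K" S s by (rule w1)
  have "bij W.wave"
    by (rule o_bij[where g = "wave_pair.wave H0 H"]) (auto simp: wave_inverse[OF w1 w2] wave_inverse[OF w2 w1])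
  then show ?thesis
    using W.clin_wave by (intro exI[of _ W.wave]) (simp add: H_def[symmetric] W.H_wave)
qed

section \<open>Oscillatory integrals\<close>

lemma has_vector_derivative_cis:
  assumes "(f has_real_derivative d) (at x)"
  shows "((\<lambda>x. cis (f x)) has_vector_derivative (\<i> * of_real d * cis (f x))) (at x)"
proof -
  have 1: "((\<lambda>x. complex_of_real (f x)) has_vector_derivative of_real d) (at x)"
    using assms by (intro has_vector_derivative_of_real) (simp add: has_real_derivative_iff_has_vector_derivative)
  have 2: "((\<lambda>z. exp (\<i> * z)) has_field_derivative (exp (\<i> * complex_of_real (f x)) * \<i>)) (at (complex_of_real (f x)))"
    by (auto intro!: derivative_eq_intros)
  show ?thesis
    using field_vector_diff_chain_at[OF 1 2] by (simp add: o_def cis_conv_exp mult_ac)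
qed

lemma integral_flip:
  fixes f :: "real \<Rightarrow> complex"
  assumes "f integrable_on {a..b}"
  shows "integral {c - b..c - a} (\<lambda>x. f (c - x)) = integral {a..b} f"
proof (rule integral_unique)
  have "((\<lambda>x. f (- x)) has_integral integral {a..b} f) (cbox (- b) (- a))"
    using assms by (simp add: integrable_integral)
  from has_integral_affinity'[OF this, of 1 "- c"]
  show "((\<lambda>x. f (c - x)) has_integral integral {a..b} f) {c - b..c - a}" by (simp add: add.commute)
qed

context
  fixes \<phi> \<phi>' \<phi>'' :: "real \<Rightarrow> real" and a b :: real
  assumes ab: "a \<le> b"
    and d1: "\<And>x. (\<phi> has_real_derivative \<phi>' x) (at x)"
    and d2: "\<And>x. (\<phi>' has_real_derivative \<phi>'' x) (at x)"
    and c2: "continuous_on UNIV \<phi>''"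
    and neg: "\<And>x. x \<in> {a..b} \<Longrightarrow> \<phi>'' x \<le> 0"
begin

lemma phase_integrable: "(\<lambda>x. cis (\<phi> x)) integrable_on {s..t}"
proof (rule integrable_continuous_real)
  have "continuous_on {s..t} \<phi>"
    using d1 by (meson DERIV_isCont continuous_at_imp_continuous_on)
  then show "continuous_on {s..t} (\<lambda>x. cis (\<phi> x))" by (intro continuous_intros)
qed

lemma phase_deriv_antimono: "a \<le> x \<Longrightarrow> x \<le> y \<Longrightarrow> y \<le> b \<Longrightarrow> \<phi>' y \<le> \<phi>' x"
  by (rule DERIV_nonpos_imp_nonincreasing[of x y \<phi>']) (auto intro!: exI[of _ "\<phi>'' _"] d2 neg)

text \<open>The first-derivative test: integrate by parts against \<open>1 / \<phi>'\<close>, which is monotone.\<close>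
lemma van_der_Corput_first:
  assumes \<mu>: "\<mu> > 0" and st: "a \<le> s" "s \<le> t" "t \<le> b"
    and big: "(\<forall>x\<in>{s..t}. \<phi>' x \<ge> \<mu>) \<or> (\<forall>x\<in>{s..t}. \<phi>' x \<le> - \<mu>)"
  shows "cmod (integral {s..t} (\<lambda>x. cis (\<phi> x))) \<le> 4 / \<mu>"
proof -
  have nz: "\<phi>' x \<noteq> 0" and inv: "\<bar>1 / \<phi>' x\<bar> \<le> 1 / \<mu>" if "x \<in> {s..t}" for x
  proof -
    have *: "\<mu> \<le> \<bar>\<phi>' x\<bar>" using big that by fastforce
    then show "\<phi>' x \<noteq> 0" using \<mu> by auto
    show "\<bar>1 / \<phi>' x\<bar> \<le> 1 / \<mu>" using * \<mu> by (simp add: abs_divide frac_le)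
  qed
  define G where "G x = cis (\<phi> x) * (- \<i> * of_real (1 / \<phi>' x))" for x
  define h where "h x = cis (\<phi> x) * (- \<i> * of_real (- \<phi>'' x / (\<phi>' x)\<^sup>2))" for x
  define q where "q x = - \<phi>'' x / (\<phi>' x)\<^sup>2" for x
  have dinv: "((\<lambda>x. 1 / \<phi>' x) has_real_derivative q x) (at x)" if "x \<in> {s..t}" for x
    unfolding q_def using DERIV_inverse'[OF d2 nz[OF that]]
    by (simp add: inverse_eq_divide power2_eq_square)
  have dG: "(G has_vector_derivative (h x + cis (\<phi> x))) (at x)" if "x \<in> {s..t}" for x
  proof -
    have "((\<lambda>x. - \<i> * complex_of_real (1 / \<phi>' x)) has_vector_derivative (- \<i> * of_real (q x))) (at x)"
      using dinv[OF that] by (intro has_vector_derivative_mult_right has_vector_derivative_of_real)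
         (simp add: has_real_derivative_iff_has_vector_derivative)
    from has_vector_derivative_mult[OF has_vector_derivative_cis[OF d1] this]
    show ?thesis unfolding G_def h_def using nz[OF that]
      by (simp add: q_def algebra_simps)
  qed
  have iG: "((\<lambda>x. h x + cis (\<phi> x)) has_integral (G t - G s)) {s..t}"
    by (rule fundamental_theorem_of_calculus[OF st(2), of G "\<lambda>x. h x + cis (\<phi> x)"])
       (rule has_vector_derivative_at_within[OF dG])
  have iq: "(q has_integral (1 / \<phi>' t - 1 / \<phi>' s)) {s..t}"
    using fundamental_theorem_of_calculus[OF st(2), of "\<lambda>x. 1 / \<phi>' x" q] dinv
    by (auto simp: has_real_derivative_iff_has_vector_derivative has_vector_derivative_at_within)
  have ih: "h integrable_on {s..t}"
    using integrable_diff[OF has_integral_integrable[OF iG] phase_integrable] by simp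
  have "G t - G s = integral {s..t} h + integral {s..t} (\<lambda>x. cis (\<phi> x))"
    using iG integral_add[OF ih phase_integrable] by (metis integral_unique)
  then have e: "integral {s..t} (\<lambda>x. cis (\<phi> x)) = G t - G s - integral {s..t} h" by simp
  have "cmod (h x) \<le> q x" if "x \<in> {s..t}" for x
    using neg[of x] that st by (simp add: h_def q_def norm_mult norm_divide norm_power)
  then have "cmod (integral {s..t} h) \<le> integral {s..t} q"
    using ih iq by (intro Henstock_Kurzweil_Integration.integral_norm_bound_integral) auto
  also have "\<dots> = 1 / \<phi>' t - 1 / \<phi>' s" using iq by (rule integral_unique)
  also have "\<dots> \<le> 1 / \<mu> + 1 / \<mu>"
    using abs_le_D2[OF inv[of s]] abs_le_D1[OF inv[of t]] st by simp
  finally have 1: "cmod (integral {s..t} h) \<le> 1 / \<mu> + 1 / \<mu>" .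
  have 2: "cmod (G x) \<le> 1 / \<mu>" if "x \<in> {s..t}" for x
    using inv[OF that] by (simp add: G_def norm_mult norm_divide abs_divide)
  have "cmod (G t - G s - integral {s..t} h) \<le> cmod (G t) + cmod (G s) + cmod (integral {s..t} h)"
    using norm_triangle_ineq4[of "G t - G s" "integral {s..t} h"] norm_triangle_ineq4[of "G t" "G s"] by linarith
  then show ?thesis unfolding e using 1 2[of s] 2[of t] st by simp
qed

text \<open>\<phi>' decreases, so it is at least \<mu> on an initial piece, at most -\<mu> on a
  final piece, and smaller than \<mu> in modulus between. The first-derivative test gives 4 / \<mu>
  on each outer piece; in the middle the integrand has modulus one and the length is at most
  \<delta>.\<close>

lemma van_der_Corput_sublevel:
  assumes \<mu>: "\<mu> > 0" and \<delta>: "\<delta> \<ge> 0"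
    and sub: "\<And>x y. x \<in> {a..b} \<Longrightarrow> y \<in> {a..b} \<Longrightarrow> x \<le> y \<Longrightarrow> \<bar>\<phi>' x\<bar> \<le> \<mu> \<Longrightarrow> \<bar>\<phi>' y\<bar> \<le> \<mu> \<Longrightarrow> y - x \<le> \<delta>"
  shows "cmod (integral {a..b} (\<lambda>x. cis (\<phi> x))) \<le> \<delta> + 8 / \<mu>"
proof -
  let ?f = "\<lambda>x. cis (\<phi> x)"
  have cont: "continuous_on S \<phi>'" for S
    using d2 by (meson DERIV_isCont continuous_at_imp_continuous_on)
  have "\<exists>c. a \<le> c \<and> c \<le> b \<and> (c = a \<or> \<phi>' c \<ge> \<mu>) \<and> (\<forall>x. c < x \<and> x \<le> b \<longrightarrow> \<phi>' x < \<mu>)"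
  proof (cases "{x \<in> {a..b}. \<mu> \<le> \<phi>' x} = {}")
    case True
    then show ?thesis using ab by (intro exI[of _ a]) force
  next
    case False
    have "compact ({a..b} \<inter> \<phi>' -` {\<mu>..})"
      by (intro compact_Int_closed closed_vimage compact_Icc) (auto intro: cont)
    moreover have "{a..b} \<inter> \<phi>' -` {\<mu>..} \<noteq> {}" using False by auto
    ultimately obtain c where "c \<in> {a..b} \<inter> \<phi>' -` {\<mu>..}" "\<And>x. x \<in> {a..b} \<inter> \<phi>' -` {\<mu>..} \<Longrightarrow> x \<le> c"
      using compact_attains_sup by metis
    note c = this
    have "\<phi>' x < \<mu>" if "c < x" "x \<le> b" for x
    proof (rule ccontr)
      assume "\<not> \<phi>' x < \<mu>"
      then show False using c(1) c(2)[of x] that by auto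
    qed
    then show ?thesis using c(1) by (intro exI[of _ c]) auto
  qed
  then obtain c where c: "a \<le> c" "c \<le> b" "c = a \<or> \<phi>' c \<ge> \<mu>" "\<And>x. c < x \<Longrightarrow> x \<le> b \<Longrightarrow> \<phi>' x < \<mu>" by blast
  have "\<exists>e. c \<le> e \<and> e \<le> b \<and> (e = b \<or> \<phi>' e \<le> - \<mu>) \<and> (\<forall>x. c \<le> x \<and> x < e \<longrightarrow> \<phi>' x > - \<mu>)"
  proof (cases "{x \<in> {c..b}. \<phi>' x \<le> - \<mu>} = {}")
    case True
    then have "- \<mu> < \<phi>' x" if "x \<in> {c..b}" for x using that not_le by blast
    then show ?thesis using c by (intro exI[of _ b]) auto
  next
    case False
    have "compact ({c..b} \<inter> \<phi>' -` {..- \<mu>})"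
      by (intro compact_Int_closed closed_vimage compact_Icc) (auto intro: cont)
    moreover have "{c..b} \<inter> \<phi>' -` {..- \<mu>} \<noteq> {}" using False by auto
    ultimately obtain e where "e \<in> {c..b} \<inter> \<phi>' -` {..- \<mu>}" "\<And>x. x \<in> {c..b} \<inter> \<phi>' -` {..- \<mu>} \<Longrightarrow> e \<le> x"
      using compact_attains_inf by metis
    note e = this
    have "- \<mu> < \<phi>' x" if "c \<le> x" "x < e" for x
    proof (rule ccontr)
      assume "\<not> - \<mu> < \<phi>' x"
      then show False using e(1) e(2)[of x] that by auto
    qed
    then show ?thesis using e(1) by (intro exI[of _ e]) auto
  qed
  then obtain e where e: "c \<le> e" "e \<le> b" "e = b \<or> \<phi>' e \<le> - \<mu>" "\<And>x. c \<le> x \<Longrightarrow> x < e \<Longrightarrow> \<phi>' x > - \<mu>" by blast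
  have 1: "cmod (integral {a..c} ?f) \<le> 4 / \<mu>"
  proof (cases "c = a")
    case False
    then have "\<forall>x\<in>{a..c}. \<phi>' x \<ge> \<mu>" using c phase_deriv_antimono[of _ c] by fastforce
    then show ?thesis using c \<mu> by (intro van_der_Corput_first) auto
  qed (use \<mu> in simp)
  have 2: "cmod (integral {e..b} ?f) \<le> 4 / \<mu>"
  proof (cases "e = b")
    case False
    then have "\<forall>x\<in>{e..b}. \<phi>' x \<le> - \<mu>" using c e phase_deriv_antimono[of e] by fastforce
    then show ?thesis using c e \<mu> by (intro van_der_Corput_first) auto
  qed (use \<mu> in simp)
  have ce: "e - c \<le> \<delta>"
  proof (rule ccontr)
    assume "\<not> e - c \<le> \<delta>"
    \<comment> \<open>Strict bounds on \<phi>' hold only inside the middle piece. Moving both ends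
      inwards by \<eta> reaches points where \<open>sub\<close> applies and still leaves a gap of
      \<delta> + 2 \<eta>.\<close>
    define \<eta> where "\<eta> = (e - c - \<delta>) / 4"
    have \<eta>: "\<eta> > 0" "e - c = \<delta> + 4 * \<eta>" using \<open>\<not> e - c \<le> \<delta>\<close> by (auto simp: \<eta>_def field_simps)
    have "\<bar>\<phi>' (c + \<eta>)\<bar> \<le> \<mu>" "\<bar>\<phi>' (e - \<eta>)\<bar> \<le> \<mu>"
      using c(4)[of "c + \<eta>"] c(4)[of "e - \<eta>"] e(4)[of "c + \<eta>"] e(4)[of "e - \<eta>"] e(2) \<eta> \<delta> by auto
    then have "(e - \<eta>) - (c + \<eta>) \<le> \<delta>"
      using c e \<eta> \<delta> by (intro sub) auto
    then show False using \<eta> by simp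
  qed
  have 3: "cmod (integral {c..e} ?f) \<le> 1 * (e - c)"
  proof (rule integral_bound)
    have "continuous_on {c..e} \<phi>" using d1 by (meson DERIV_isCont continuous_at_imp_continuous_on)
    then show "continuous_on {c..e} ?f" by (intro continuous_intros)
  qed (use e in auto)
  have "integral {a..b} ?f = integral {a..c} ?f + (integral {c..e} ?f + integral {e..b} ?f)"
    using Henstock_Kurzweil_Integration.integral_combine[OF c(1,2) phase_integrable]
      Henstock_Kurzweil_Integration.integral_combine[OF e(1,2) phase_integrable] by simp
  also have "cmod \<dots> \<le> cmod (integral {a..c} ?f) + (cmod (integral {c..e} ?f) + cmod (integral {e..b} ?f))"
    by (rule norm_triangle_le[OF add_left_mono[OF norm_triangle_ineq]])
  also have "\<dots> \<le> 4 / \<mu> + (\<delta> + 4 / \<mu>)" using 1 2 3 ce by (intro add_mono) auto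
  finally show ?thesis by simp
qed

end

section \<open>The phase of the one-dimensional propagator\<close>

text \<open>For r = 2 t this is 2 pi m x - 4 t sin^2(pi x) up to the constant 2 t, see
  \<open>norm_kernel1\<close>. Stationary points solve m = r sin(2 pi x) and degenerate when |m| =
  r.\<close>

definition phase :: "real \<Rightarrow> int \<Rightarrow> real \<Rightarrow> real" where
  "phase r m x = r * cos (2 * pi * x) + 2 * pi * m * x"

lemma phase_deriv:
  "(phase r m has_real_derivative 2 * pi * (m - r * sin (2 * pi * x))) (at x)"
  "((\<lambda>x. 2 * pi * (m - r * sin (2 * pi * x))) has_real_derivative - (4 * pi\<^sup>2 * r * cos (2 * pi * x))) (at x)"
  unfolding phase_def by (auto intro!: derivative_eq_intros simp: algebra_simps power2_eq_square)

lemma phase_integrable_on: "(\<lambda>x. cis (phase r m x)) integrable_on {a..b}"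
  unfolding phase_def by (intro integrable_continuous_real continuous_intros)

lemma quarter_bounds:
  assumes "- 1 / 4 \<le> x" "x \<le> 1 / 4"
  shows "- pi / 2 \<le> 2 * pi * x" "2 * pi * x \<le> pi / 2"
  using mult_left_mono[OF assms(1), of "2 * pi"] mult_left_mono[OF assms(2), of "2 * pi"] by auto

lemma sin_ge_third: "0 \<le> h \<Longrightarrow> h \<le> pi / 2 \<Longrightarrow> h / 3 \<le> sin h"
proof -
  assume h: "0 \<le> h" "h \<le> pi / 2"
  have small: "x / 3 \<le> sin x" if "0 \<le> x" "x \<le> pi / 3" for x
  proof -
    have "\<exists>d. ((\<lambda>x. sin x - x / 3) has_real_derivative d) (at y) \<and> 0 \<le> d" if y: "0 \<le> y" "y \<le> x" for y
    proof -
      have "cos (pi / 3) \<le> cos y" using y \<open>x \<le> pi / 3\<close> by (intro cos_monotone_0_pi_le) auto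
      then show ?thesis
        by (intro exI[of _ "cos y - 1 / 3"]) (auto intro!: derivative_eq_intros simp: cos_60)
    qed
    from DERIV_nonneg_imp_nondecreasing[OF that(1), of "\<lambda>x. sin x - x / 3", OF this]
    show ?thesis by simp
  qed
  show ?thesis
  proof (cases "h \<le> pi / 3")
    case False
    have "1.5 \<le> sqrt 3" by (rule real_le_rsqrt) (simp add: power2_eq_square)
    then have "h / 3 \<le> sin (pi / 3)" using h pi_less_4 unfolding sin_60 by simp
    also have "\<dots> \<le> sin h" using h False by (intro sin_monotone_2pi_le) auto
    finally show ?thesis .
  qed (use small h in auto)
qed

text \<open>At worst, near the ends of the interval, the sine is quadratically flat. With h half the
  distance, sin v - sin u = 2 sin h cos((u + v) / 2), the cosine is at least sin h, and sin h \<ge>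
  h / 3; this gives 18.\<close>

lemma sin_diff_lower:
  fixes u v :: real
  assumes "- pi / 2 \<le> u" "u \<le> v" "v \<le> pi / 2"
  shows "(v - u)\<^sup>2 \<le> 18 * (sin v - sin u)"
proof -
  define h where "h = (v - u) / 2"
  have h: "0 \<le> h" "h \<le> pi / 2" using assms by (auto simp: h_def field_simps)
  have c: "cos ((v + u) / 2) \<ge> sin h"
  proof -
    have "\<bar>(v + u) / 2\<bar> \<le> pi / 2 - h" using assms by (auto simp: h_def abs_le_iff field_simps)
    then have "cos (pi / 2 - h) \<le> cos \<bar>(v + u) / 2\<bar>"
      using h by (intro cos_monotone_0_pi_le) auto
    then show ?thesis unfolding cos_abs_real by (simp add: cos_diff)
  qed
  have s: "sin h \<ge> h / 3" using h by (rule sin_ge_third)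
  have e: "sin v - sin u = 2 * (sin h * cos ((v + u) / 2))" unfolding sin_diff_sin h_def by simp
  have "2 * (h / 3 * (h / 3)) \<le> 2 * (sin h * cos ((v + u) / 2))"
    using c s h sin_ge_zero[of h] by (intro mult_left_mono mult_mono) auto
  then show ?thesis unfolding e[symmetric] by (simp add: h_def power2_eq_square)
qed

text \<open>Near v the sine has slope cos v. In the product formula the cosine of the midpoint is at
  least cos v / 2, because cos v \<le> cos u + cos v, and the sine of the half distance is at least
  a third of its argument.\<close>

lemma sin_diff_abs:
  fixes u v :: real
  assumes u: "- pi / 2 \<le> u" "u \<le> pi / 2" and v: "- pi / 2 \<le> v" "v \<le> pi / 2"
  shows "\<bar>u - v\<bar> * cos v \<le> 6 * \<bar>sin u - sin v\<bar>"
proof -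
  define h where "h = (u - v) / 2"
  have h: "\<bar>h\<bar> \<le> pi / 2" using assms by (auto simp: h_def abs_le_iff field_simps)
  have s: "\<bar>h\<bar> / 3 \<le> \<bar>sin h\<bar>"
    using sin_ge_third[of "\<bar>h\<bar>"] h by (cases "h \<ge> 0") auto
  have pos: "0 \<le> cos ((u + v) / 2)" "0 \<le> cos u" "0 \<le> cos v"
    using assms by (auto intro!: cos_ge_zero simp: field_simps)
  have "cos v \<le> cos u + cos v" using pos by simp
  also have "\<dots> = 2 * cos ((u + v) / 2) * cos ((u - v) / 2)" by (rule cos_plus_cos)
  also have "\<dots> \<le> 2 * cos ((u + v) / 2) * 1" using pos by (intro mult_left_mono) auto
  finally have c: "cos v \<le> 2 * cos ((u + v) / 2)" by simp
  have "(\<bar>h\<bar> / 3) * (cos v / 2) \<le> \<bar>sin h\<bar> * cos ((u + v) / 2)"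
    using s c pos by (intro mult_mono) auto
  moreover have "\<bar>sin u - sin v\<bar> = 2 * (\<bar>sin h\<bar> * cos ((u + v) / 2))"
    unfolding sin_diff_sin h_def using pos by (simp add: abs_mult)
  ultimately show ?thesis by (simp add: h_def)
qed

context
  fixes r a b :: real and m :: int
  assumes r: "r > 0" and ab: "- 1 / 4 \<le> a" "a \<le> b" "b \<le> 1 / 4"
begin

lemma phase_second_deriv_nonpos: "x \<in> {a..b} \<Longrightarrow> - (4 * pi\<^sup>2 * r * cos (2 * pi * x)) \<le> 0"
  using quarter_bounds[of x] ab r by (auto intro!: mult_nonneg_nonneg cos_ge_zero)

text \<open>This covers every m, also a degenerate stationary point: by
  \<open>sin_diff_lower\<close> the set where the derivative is at most \<mu> has length at most
  sqrt(\<mu> / r), and \<mu> = r^(1/3) equates this with 1 / \<mu>.\<close>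

lemma phase_bound_cbrt: "cmod (integral {a..b} (\<lambda>x. cis (phase r m x))) \<le> 9 * r powr (- 1 / 3)"
proof -
  define \<mu> where "\<mu> = r powr (1 / 3)"
  define \<delta> where "\<delta> = r powr (- 1 / 3)"
  have \<mu>: "\<mu> > 0" "\<delta> \<ge> 0" "1 / \<mu> = \<delta>" using r by (auto simp: \<mu>_def \<delta>_def powr_minus_divide)
  have \<mu>r: "\<mu> / r = \<delta>\<^sup>2"
    using r powr_add[of r "- 1 / 3" "- 1 / 3"] powr_diff[of r "1 / 3" 1] by (simp add: \<mu>_def \<delta>_def power2_eq_square)
  have "cmod (integral {a..b} (\<lambda>x. cis (phase r m x))) \<le> \<delta> + 8 / \<mu>"
  proof (rule van_der_Corput_sublevel[OF ab(2) phase_deriv _ phase_second_deriv_nonpos \<mu>(1,2)])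
    fix x y assume x: "x \<in> {a..b}" and y: "y \<in> {a..b}" and xy: "x \<le> y"
      and bx: "\<bar>2 * pi * (m - r * sin (2 * pi * x))\<bar> \<le> \<mu>" and by': "\<bar>2 * pi * (m - r * sin (2 * pi * y))\<bar> \<le> \<mu>"
    have "(2 * pi * y - 2 * pi * x)\<^sup>2 \<le> 18 * (sin (2 * pi * y) - sin (2 * pi * x))"
      using quarter_bounds[of x] quarter_bounds[of y] x y xy ab by (intro sin_diff_lower) auto
    then have "r * (4 * pi\<^sup>2 * (y - x)\<^sup>2) \<le> r * (18 * (sin (2 * pi * y) - sin (2 * pi * x)))"
      using r by (intro mult_left_mono) (auto simp: power2_eq_square algebra_simps)
    also have "pi * \<dots> = 9 * (2 * pi * (m - r * sin (2 * pi * x)) - 2 * pi * (m - r * sin (2 * pi * y)))"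
      by (simp add: algebra_simps)
    also have "\<dots> \<le> 9 * (\<mu> + \<mu>)"
      by (intro mult_left_mono order_trans[OF abs_ge_self order_trans[OF abs_triangle_ineq4 add_mono[OF bx by']]]) simp
    finally have "pi * (r * (4 * pi\<^sup>2 * (y - x)\<^sup>2)) \<le> 18 * \<mu>" by simp
    moreover have "18 * (r * (y - x)\<^sup>2) \<le> (pi * (4 * pi\<^sup>2)) * (r * (y - x)\<^sup>2)"
    proof (rule mult_right_mono)
      have "2 * (4 * 2\<^sup>2) \<le> pi * (4 * pi\<^sup>2)" using pi_ge_two by (intro mult_mono power_mono) auto
      then show "18 \<le> pi * (4 * pi\<^sup>2)" by simp
    qed (use r in auto)
    ultimately have "r * (y - x)\<^sup>2 \<le> \<mu>" by (simp add: algebra_simps)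
    then have "(y - x)\<^sup>2 \<le> \<delta>\<^sup>2" unfolding \<mu>r[symmetric] using r by (simp add: field_simps)
    then show "y - x \<le> \<delta>" using \<mu>(2) by (rule power2_le_imp_le)
  qed (intro continuous_intros)
  then show ?thesis using \<mu>(3) unfolding \<delta>_def by simp
qed

text \<open>For m < r the stationary point \<open>t0\<close> is nondegenerate, with r cos t0 = q =
  sqrt(r^2 - m^2). By \<open>sin_diff_abs\<close> the set of small derivative has length at most
  \<mu> / q, which balances 1 / \<mu> for \<mu> = sqrt q.\<close>

lemma phase_bound_above:
  assumes m: "m \<ge> 0" "m < r"
  shows "cmod (integral {a..b} (\<lambda>x. cis (phase r m x))) \<le> 9 * (r\<^sup>2 - (real_of_int m)\<^sup>2) powr (- 1 / 4)"
proof -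
  define q where "q = sqrt (r\<^sup>2 - (real_of_int m)\<^sup>2)"
  have mr: "(real_of_int m)\<^sup>2 < r\<^sup>2" using m by (intro power_strict_mono) auto
  then have q: "q > 0" by (simp add: q_def)
  define \<mu> where "\<mu> = sqrt q"
  have \<mu>: "\<mu> > 0" "\<mu> / q \<ge> 0" using q by (auto simp: \<mu>_def)
  have \<mu>q: "\<mu> / q = 1 / \<mu>" using q by (simp add: \<mu>_def field_simps)
  have \<mu>p: "1 / \<mu> = (r\<^sup>2 - (real_of_int m)\<^sup>2) powr (- 1 / 4)"
    using mr by (simp add: \<mu>_def q_def powr_half_sqrt[symmetric] powr_powr powr_minus_divide)
  define t0 where "t0 = arcsin (m / r)"
  have mr1: "- 1 \<le> m / r" "m / r \<le> 1" using m r by (auto simp: field_simps)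
  have t0: "- pi / 2 \<le> t0" "t0 \<le> pi / 2" "sin t0 = m / r"
    using arcsin_bounded[OF mr1] mr1 by (auto simp: t0_def)
  have ct0: "cos t0 = q / r"
  proof -
    have "cos t0 = sqrt (1 - (m / r)\<^sup>2)" using mr1 by (simp add: t0_def cos_arcsin)
    also have "1 - (m / r)\<^sup>2 = (r\<^sup>2 - (real_of_int m)\<^sup>2) / r\<^sup>2" using r by (simp add: field_simps)
    also have "sqrt \<dots> = q / r" using r by (simp add: real_sqrt_divide q_def)
    finally show ?thesis .
  qed
  have "cmod (integral {a..b} (\<lambda>x. cis (phase r m x))) \<le> \<mu> / q + 8 / \<mu>"
  proof (rule van_der_Corput_sublevel[OF ab(2) phase_deriv _ phase_second_deriv_nonpos \<mu>])
    have close: "pi * q * \<bar>2 * pi * x - t0\<bar> \<le> 3 * \<mu>"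
      if x: "x \<in> {a..b}" and bx: "\<bar>2 * pi * (m - r * sin (2 * pi * x))\<bar> \<le> \<mu>" for x
    proof -
      have "\<bar>2 * pi * x - t0\<bar> * cos t0 \<le> 6 * \<bar>sin (2 * pi * x) - sin t0\<bar>"
        using quarter_bounds[of x] x ab t0 by (intro sin_diff_abs) auto
      then have "(pi * r) * (\<bar>2 * pi * x - t0\<bar> * cos t0) \<le> (pi * r) * (6 * \<bar>sin (2 * pi * x) - sin t0\<bar>)"
        using r by (intro mult_left_mono) auto
      also have "\<dots> = 3 * \<bar>(2 * pi * r) * (sin (2 * pi * x) - m / r)\<bar>"
        using r unfolding abs_mult t0(3) by simp
      also have "(2 * pi * r) * (sin (2 * pi * x) - m / r) = - (2 * pi * (m - r * sin (2 * pi * x)))"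
        using r by (simp add: field_simps)
      also have "3 * \<bar>- (2 * pi * (m - r * sin (2 * pi * x)))\<bar> \<le> 3 * \<mu>" using bx by simp
      finally show ?thesis unfolding ct0 using r by (simp add: mult_ac)
    qed
    fix x y assume x: "x \<in> {a..b}" and y: "y \<in> {a..b}" and xy: "x \<le> y"
      and bx: "\<bar>2 * pi * (m - r * sin (2 * pi * x))\<bar> \<le> \<mu>" and by': "\<bar>2 * pi * (m - r * sin (2 * pi * y))\<bar> \<le> \<mu>"
    have "pi * q * (2 * pi * y - 2 * pi * x) \<le> pi * q * (\<bar>2 * pi * x - t0\<bar> + \<bar>2 * pi * y - t0\<bar>)"
      using q by (intro mult_left_mono) auto
    also have "\<dots> \<le> 3 * \<mu> + 3 * \<mu>"
      unfolding distrib_left using close[OF x bx] close[OF y by'] by (rule add_mono)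
    finally have "pi\<^sup>2 * (q * (y - x)) \<le> 3 * \<mu>" by (simp add: algebra_simps power2_eq_square)
    moreover have "3 * (q * (y - x)) \<le> pi\<^sup>2 * (q * (y - x))"
    proof (rule mult_right_mono)
      have "2\<^sup>2 \<le> pi\<^sup>2" using pi_ge_two by (intro power_mono) auto
      then show "3 \<le> pi\<^sup>2" by simp
    qed (use q xy in auto)
    ultimately have "q * (y - x) \<le> \<mu>" by simp
    then show "y - x \<le> \<mu> / q" using q by (simp add: field_simps)
  qed (intro continuous_intros)
  then show ?thesis using \<mu>q \<mu>p by simp
qed

lemma phase_bound_below:
  assumes m: "r < m"
  shows "cmod (integral {a..b} (\<lambda>x. cis (phase r m x))) \<le> 4 / (m - r)"
proof -
  have "m - r \<le> 2 * pi * (m - r * sin (2 * pi * x))" for x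
  proof -
    have "1 * (m - r) \<le> (2 * pi) * (m - r * sin (2 * pi * x))"
      using m r pi_ge_two mult_left_mono[OF sin_le_one, of r "2 * pi * x"] by (intro mult_mono) auto
    then show ?thesis by simp
  qed
  then have big: "(\<forall>x\<in>{a..b}. m - r \<le> 2 * pi * (m - r * sin (2 * pi * x))) \<or>
      (\<forall>x\<in>{a..b}. 2 * pi * (m - r * sin (2 * pi * x)) \<le> - (m - r))" by blast
  have cont: "continuous_on UNIV (\<lambda>x. - (4 * pi\<^sup>2 * r * cos (2 * pi * x)))" by (intro continuous_intros)
  show ?thesis
    by (rule van_der_Corput_first[OF ab(2) phase_deriv cont phase_second_deriv_nonpos _ order_refl ab(2) order_refl big])
       (use m in auto)
qed

end

text \<open>The bounds above need a concave phase, that is |x| \<le> 1/4. The reflections x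
  \<mapsto> 1/2 - x and x \<mapsto> -1/2 - x carry the outer quarters into that interval; they flip
  the sign of the cosine, which conjugates the integrand up to a unimodular constant.\<close>

lemma phase_full_bound:
  assumes B: "\<And>a b. - 1 / 4 \<le> a \<Longrightarrow> a \<le> b \<Longrightarrow> b \<le> 1 / 4 \<Longrightarrow> cmod (integral {a..b} (\<lambda>x. cis (phase r m x))) \<le> B"
  shows "cmod (integral {- 1 / 2..1 / 2} (\<lambda>x. cis (phase r m x))) \<le> 3 * B"
proof -
  let ?f = "\<lambda>x. cis (phase r m x)"
  have refl: "?f (c - x) = cis (2 * pi * m * c) * cnj (?f x)" if "cos (2 * pi * (c - x)) = - cos (2 * pi * x)" for c x
    unfolding cis_cnj cis_mult using that by (simp add: phase_def algebra_simps)
  have cnj: "integral S (\<lambda>x. cnj (?f x)) = cnj (integral S ?f)" for S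
    by (rule integral_cnj[symmetric])
  have 1: "cmod (integral {1 / 4..1 / 2} ?f) \<le> B"
  proof -
    have "integral {1 / 4..1 / 2} ?f = integral {1 / 2 - 1 / 2..1 / 2 - 1 / 4} (\<lambda>x. ?f (1 / 2 - x))"
      by (rule integral_flip[symmetric, OF phase_integrable_on])
    also have "\<dots> = cis (2 * pi * m * (1 / 2)) * cnj (integral {0..1 / 4} ?f)"
      unfolding cnj[symmetric] by (subst refl) (auto simp: right_diff_distrib cos_diff)
    finally show ?thesis using B[of 0 "1 / 4"] by (simp add: norm_mult)
  qed
  have 2: "cmod (integral {- 1 / 2..- 1 / 4} ?f) \<le> B"
  proof -
    have "integral {- 1 / 2..- 1 / 4} ?f = integral {- 1 / 2 - (- 1 / 4)..- 1 / 2 - (- 1 / 2)} (\<lambda>x. ?f (- 1 / 2 - x))"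
      by (rule integral_flip[symmetric, OF phase_integrable_on])
    also have "\<dots> = cis (2 * pi * m * (- 1 / 2)) * cnj (integral {- 1 / 4..0} ?f)"
      unfolding cnj[symmetric] by (subst refl) (auto simp: right_diff_distrib cos_diff)
    finally show ?thesis using B[of "- 1 / 4" 0] by (simp add: norm_mult)
  qed
  have "integral {- 1 / 2..1 / 2} ?f = integral {- 1 / 2..- 1 / 4} ?f + (integral {- 1 / 4..1 / 4} ?f + integral {1 / 4..1 / 2} ?f)"
    using Henstock_Kurzweil_Integration.integral_combine[of "- 1 / 2" "- 1 / 4" "1 / 2" ?f]
      Henstock_Kurzweil_Integration.integral_combine[of "- 1 / 4" "1 / 4" "1 / 2" ?f] phase_integrable_on by simp
  also have "cmod \<dots> \<le> cmod (integral {- 1 / 2..- 1 / 4} ?f) + (cmod (integral {- 1 / 4..1 / 4} ?f) + cmod (integral {1 / 4..1 / 2} ?f))"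
    by (rule norm_triangle_le[OF add_left_mono[OF norm_triangle_ineq]])
  also have "\<dots> \<le> B + (B + B)" using 1 2 B[of "- 1 / 4" "1 / 4"] by (intro add_mono) auto
  finally show ?thesis by simp
qed

lemma phase_full_abs:
  "cmod (integral {- 1 / 2..1 / 2} (\<lambda>x. cis (phase r m x))) = cmod (integral {- 1 / 2..1 / 2} (\<lambda>x. cis (phase r \<bar>m\<bar> x)))"
proof (cases "m \<ge> 0")
  case False
  have "integral {0 - 1 / 2..0 - (- 1 / 2)} (\<lambda>x. cis (phase r m (0 - x))) = integral {- 1 / 2..1 / 2} (\<lambda>x. cis (phase r m x))"
    by (rule integral_flip[OF phase_integrable_on])
  moreover have "phase r m (0 - x) = phase r \<bar>m\<bar> x" for x using False by (simp add: phase_def)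
  ultimately show ?thesis by simp
qed simp

text \<open>Up to a unimodular factor, \<open>kernel1 t m\<close> is the Bessel function \<open>J\<^sub>m\<close> at \<open>2 t\<close>.\<close>
definition kernel1 :: "real \<Rightarrow> int \<Rightarrow> complex" where
  "kernel1 t m = integral {- 1 / 2..1 / 2} (\<lambda>x. cis (2 * pi * m * x - t * (4 * (sin (pi * x))\<^sup>2)))"

lemma norm_kernel1: "cmod (kernel1 t m) = cmod (integral {- 1 / 2..1 / 2} (\<lambda>x. cis (phase (2 * t) \<bar>m\<bar> x)))"
proof -
  have *: "2 * pi * m * x - t * (4 * (sin (pi * x))\<^sup>2) = - (2 * t) + phase (2 * t) m x" for x
  proof -
    have s: "4 * (sin (pi * x))\<^sup>2 = 2 - 2 * cos (2 * pi * x)"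
      using cos_double_sin[of "pi * x"] by (simp add: mult.assoc)
    show ?thesis unfolding s phase_def by (simp add: algebra_simps)
  qed
  have "kernel1 t m = cis (- (2 * t)) * integral {- 1 / 2..1 / 2} (\<lambda>x. cis (phase (2 * t) m x))"
    unfolding kernel1_def * cis_mult[symmetric] by (rule integral_mult_right)
  then show ?thesis using phase_full_abs[of "2 * t" m] by (simp add: norm_mult)
qed

lemma continuous_on_kernel1: "continuous_on UNIV (\<lambda>t. kernel1 t m)"
proof -
  have "continuous_on UNIV (\<lambda>t. integral (cbox (- 1 / 2) (1 / 2)) (\<lambda>x. cis (2 * pi * m * x - t * (4 * (sin (pi * x))\<^sup>2))))"
    by (rule integral_continuous_on_param) (auto intro!: continuous_intros simp: case_prod_unfold)
  then show ?thesis by (simp add: kernel1_def)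
qed

lemma kernel1_le_1: "cmod (kernel1 t m) \<le> 1"
proof -
  have cont: "continuous_on {- 1 / 2..1 / 2} (\<lambda>x. cis (2 * pi * m * x - t * (4 * (sin (pi * x))\<^sup>2)))"
    by (intro continuous_intros)
  show ?thesis unfolding kernel1_def using integral_bound[OF _ cont, of 1] by simp
qed

lemma kernel1_bound_cbrt:
  assumes "t > 0"
  shows "cmod (kernel1 t m) \<le> 27 * t powr (- 1 / 3)"
proof -
  have "cmod (kernel1 t m) \<le> 3 * (9 * (2 * t) powr (- 1 / 3))"
    unfolding norm_kernel1 using assms by (intro phase_full_bound phase_bound_cbrt) auto
  also have "\<dots> \<le> 3 * (9 * t powr (- 1 / 3))"
    using assms by (intro mult_left_mono powr_mono2') auto
  finally show ?thesis by simp
qed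

text \<open>With \<nu> = |m| / 2, the turning point, (2 t)^2 - m^2 = 4 (t + \<nu>)(t - \<nu>), and 4
  (t + \<nu>) is lowered to t.\<close>

lemma kernel1_bound_above:
  assumes "t > real_of_int \<bar>m\<bar> / 2"
  shows "cmod (kernel1 t m) \<le> 27 * (t * (t - real_of_int \<bar>m\<bar> / 2)) powr (- 1 / 4)"
proof -
  define \<nu> where "\<nu> = real_of_int \<bar>m\<bar> / 2"
  have t: "t > 0" "t > \<nu>" "\<nu> \<ge> 0" using assms by (auto simp: \<nu>_def)
  have "cmod (kernel1 t m) \<le> 3 * (9 * ((2 * t)\<^sup>2 - (real_of_int \<bar>m\<bar>)\<^sup>2) powr (- 1 / 4))"
    unfolding norm_kernel1 using assms by (intro phase_full_bound phase_bound_above) auto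
  also have "(2 * t)\<^sup>2 - (real_of_int \<bar>m\<bar>)\<^sup>2 = 4 * (t + \<nu>) * (t - \<nu>)"
    by (simp add: \<nu>_def power2_eq_square algebra_simps)
  also have "3 * (9 * (4 * (t + \<nu>) * (t - \<nu>)) powr (- 1 / 4)) \<le> 3 * (9 * (t * (t - \<nu>)) powr (- 1 / 4))"
    using t by (intro mult_left_mono powr_mono2' mult_right_mono) auto
  finally show ?thesis by (simp add: \<nu>_def)
qed

lemma kernel1_bound_below:
  assumes "0 < t" "t < real_of_int \<bar>m\<bar> / 2"
  shows "cmod (kernel1 t m) \<le> 27 / (real_of_int \<bar>m\<bar> / 2 - t)"
proof -
  have "cmod (kernel1 t m) \<le> 3 * (4 / (real_of_int \<bar>m\<bar> - 2 * t))"
    unfolding norm_kernel1 using assms by (intro phase_full_bound phase_bound_below) auto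
  also have "\<dots> \<le> 27 / (real_of_int \<bar>m\<bar> / 2 - t)" using assms by (simp add: field_simps)
  finally show ?thesis .
qed

section \<open>Decay of the one-dimensional propagator, integrated in time\<close>

lemma nn_integral_powr_tail:
  fixes L \<alpha> :: real
  assumes "L > 0" "\<alpha> > 1"
  shows "(\<integral>\<^sup>+u. ennreal (u powr (- \<alpha>)) * indicator {L..} u \<partial>lborel) = ennreal (L powr (1 - \<alpha>) / (\<alpha> - 1))"
proof -
  have "(\<integral>\<^sup>+u. ennreal (u powr (- \<alpha>)) * indicator {L..} u \<partial>lborel) = ennreal (0 - L powr (1 - \<alpha>) / (1 - \<alpha>))"
  proof (rule nn_integral_FTC_atLeast)
    fix x assume "L \<le> x"
    then show "((\<lambda>x. x powr (1 - \<alpha>) / (1 - \<alpha>)) has_real_derivative x powr (- \<alpha>)) (at x)"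
      using assms by (auto intro!: derivative_eq_intros)
  next
    have "((\<lambda>x. x powr (1 - \<alpha>) / (1 - \<alpha>)) \<longlongrightarrow> 0 / (1 - \<alpha>)) at_top"
      using assms by (intro tendsto_intros tendsto_neg_powr filterlim_ident) auto
    then show "((\<lambda>x. x powr (1 - \<alpha>) / (1 - \<alpha>)) \<longlongrightarrow> 0) at_top" by simp
  qed auto
  also have "0 - L powr (1 - \<alpha>) / (1 - \<alpha>) = L powr (1 - \<alpha>) / (\<alpha> - 1)"
    using assms by (simp add: field_simps)
  finally show ?thesis .
qed

text \<open>The window of half-width L around \<nu> contributes 2 L times 2 / L, that is 4. The
  other two parts become integrals from L to infinity in the distance to \<nu>, by translation and
  reflection.\<close>

lemma turning_point_bound:
  fixes h f2 f4 :: "real \<Rightarrow> real"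
  assumes L: "L > 0"
    and near: "\<And>t. t \<ge> 1 \<Longrightarrow> \<bar>t - \<nu>\<bar> \<le> L \<Longrightarrow> h t \<le> 2 / L"
    and far: "\<And>t. t \<ge> 1 \<Longrightarrow> t \<ge> \<nu> + L \<Longrightarrow> h t \<le> f2 (t - \<nu>)"
    and below: "\<And>t. t \<ge> 1 \<Longrightarrow> t \<le> \<nu> - L \<Longrightarrow> h t \<le> f4 (\<nu> - t)"
    and [measurable]: "f2 \<in> borel_measurable borel" "f4 \<in> borel_measurable borel"
    and f2: "(\<integral>\<^sup>+u. ennreal (f2 u) * indicator {L..} u \<partial>lborel) \<le> ennreal C2"
    and f4: "(\<integral>\<^sup>+u. ennreal (f4 u) * indicator {L..} u \<partial>lborel) \<le> ennreal C4"
    and C: "C2 \<ge> 0" "C4 \<ge> 0"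
  shows "(\<integral>\<^sup>+t. ennreal (h t) * indicator {1..} t \<partial>lborel) \<le> ennreal (4 + C2 + C4)"
proof -
  define F2 where "F2 u = ennreal (f2 u) * indicator {L..} u" for u
  define F4 where "F4 u = ennreal (f4 u) * indicator {L..} u" for u
  have [measurable]: "F2 \<in> borel_measurable borel" "F4 \<in> borel_measurable borel"
    unfolding F2_def F4_def by measurable
  have "ennreal (h t) * indicator {1..} t
      \<le> ennreal (2 / L) * indicator {\<nu> - L..\<nu> + L} t + F2 (- \<nu> + 1 * t) + F4 (\<nu> + (- 1) * t)" for t
  proof (cases "t \<ge> 1")
    case True
    consider "\<bar>t - \<nu>\<bar> \<le> L" | "t \<ge> \<nu> + L" | "t \<le> \<nu> - L" by linarith
    then show ?thesis
    proof cases
      case 1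
      then have "t \<in> {\<nu> - L..\<nu> + L}" by auto
      then have "ennreal (h t) * indicator {1..} t \<le> ennreal (2 / L) * indicator {\<nu> - L..\<nu> + L} t"
        using near[OF True 1] by (simp add: ennreal_leI True)
      then show ?thesis by (simp add: add.assoc add_increasing2)
    next
      case 2
      then have "ennreal (h t) * indicator {1..} t \<le> F2 (- \<nu> + 1 * t)"
        using far[OF True 2] by (simp add: F2_def ennreal_leI True)
      then show ?thesis by (meson add_increasing add_increasing2 zero_le)
    next
      case 3
      then have "ennreal (h t) * indicator {1..} t \<le> F4 (\<nu> + (- 1) * t)"
        using below[OF True 3] by (simp add: F4_def ennreal_leI True)
      then show ?thesis by (meson add_increasing zero_le)
    qed
  qed simp
  then have "(\<integral>\<^sup>+t. ennreal (h t) * indicator {1..} t \<partial>lborel)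
      \<le> (\<integral>\<^sup>+t. ennreal (2 / L) * indicator {\<nu> - L..\<nu> + L} t + F2 (- \<nu> + 1 * t) + F4 (\<nu> + (- 1) * t) \<partial>lborel)"
    by (intro nn_integral_mono)
  also have "\<dots> = (\<integral>\<^sup>+t. ennreal (2 / L) * indicator {\<nu> - L..\<nu> + L} t \<partial>lborel)
      + (\<integral>\<^sup>+t. F2 (- \<nu> + 1 * t) \<partial>lborel) + (\<integral>\<^sup>+t. F4 (\<nu> + (- 1) * t) \<partial>lborel)"
    by (simp add: nn_integral_add)
  also have "(\<integral>\<^sup>+t. F2 (- \<nu> + 1 * t) \<partial>lborel) = (\<integral>\<^sup>+t. F2 t \<partial>lborel)"
    using nn_integral_real_affine[of F2 1 "- \<nu>"] by simp
  also have "(\<integral>\<^sup>+t. F4 (\<nu> + (- 1) * t) \<partial>lborel) = (\<integral>\<^sup>+t. F4 t \<partial>lborel)"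
    using nn_integral_real_affine[of F4 "- 1" \<nu>] by simp
  also have "(\<integral>\<^sup>+t. ennreal (2 / L) * indicator {\<nu> - L..\<nu> + L} t \<partial>lborel) = ennreal 4"
    using L by (simp add: nn_integral_cmult_indicator ennreal_mult[symmetric])
  also have "ennreal 4 + (\<integral>\<^sup>+t. F2 t \<partial>lborel) + (\<integral>\<^sup>+t. F4 t \<partial>lborel) \<le> ennreal 4 + ennreal C2 + ennreal C4"
    using f2 f4 unfolding F2_def F4_def by (intro add_mono) auto
  also have "\<dots> = ennreal (4 + C2 + C4)" using C by (simp add: ennreal_plus)
  finally show ?thesis .
qed

context
  fixes k :: "real \<Rightarrow> real" and \<nu> :: real
  assumes k0: "\<And>t. k t \<ge> 0" and \<nu>: "\<nu> \<ge> 0"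
    and k1: "\<And>t. t > 0 \<Longrightarrow> k t \<le> t powr (- 1 / 3)"
    and k2: "\<And>t. t > \<nu> \<Longrightarrow> k t \<le> (t * (t - \<nu>)) powr (- 1 / 4)"
    and k3: "\<And>t. t > 0 \<Longrightarrow> t < \<nu> \<Longrightarrow> k t \<le> 1 / (\<nu> - t)"
begin

text \<open>The Airy scale \<nu>^(1/3): at this distance from \<nu> the three hypotheses on k give
  the same order \<nu>^(-1/3), since (\<nu> L)^(-1/4) = 1 / L = \<nu>^(-1/3).\<close>

definition turning_width :: real where "turning_width = max 1 \<nu> powr (1 / 3)"

lemma turning_width_ge_1: "turning_width \<ge> 1"
  unfolding turning_width_def by (rule ge_one_powr_ge_zero) auto

lemma turning_width_powr: "turning_width powr a = max 1 \<nu> powr (a / 3)"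
  by (simp add: turning_width_def powr_powr)

lemma \<nu>_le_turning_width: "\<nu> \<le> turning_width powr 3"
  unfolding turning_width_powr by simp

text \<open>In the window t is at least max 1 \<nu> / 8: for \<nu> \<le> 4 because t \<ge> 1, for
  larger \<nu> because the width is then at most \<nu> / 2. The cube root of 8 is the 2 in the
  claim.\<close>

lemma cbrt_decay_near:
  assumes t: "t \<ge> 1" "\<bar>t - \<nu>\<bar> \<le> turning_width"
  shows "t powr (- 1 / 3) \<le> 2 / turning_width"
proof -
  have "max 1 \<nu> \<le> 8 * t"
  proof (cases "\<nu> \<le> 4")
    case False
    have "turning_width \<le> (\<nu> powr 3 / 8) powr (1 / 3)"
    proof -
      have "\<nu> \<le> \<nu> powr 3 / 8"
      proof -
        have "8 * \<nu> \<le> \<nu>\<^sup>2 * \<nu>" using False power_mono[of 4 \<nu> 2] by (intro mult_right_mono) auto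
        then show ?thesis using False by (simp add: power2_eq_square power3_eq_cube)
      qed
      then show ?thesis unfolding turning_width_def using False by (intro powr_mono2) auto
    qed
    also have "\<dots> = \<nu> / 2"
    proof -
      have "\<nu> powr 3 / 8 = (\<nu> / 2) powr 3" using False by (simp add: power_divide)
      then show ?thesis using False by (simp add: powr_powr del: powr_numeral)
    qed
    finally show ?thesis using t by linarith
  qed (use t in auto)
  then have "t powr (- 1 / 3) \<le> (max 1 \<nu> / 8) powr (- 1 / 3)" by (intro powr_mono2') auto
  also have "\<dots> = 2 / turning_width"
  proof -
    have "(8::real) powr (1 / 3) = (2 powr 3) powr (1 / 3)" by simp
    also have "\<dots> = 2" unfolding powr_powr by simp
    finally show ?thesis by (simp add: powr_divide turning_width_def powr_minus_divide)
  qed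
  finally show ?thesis .
qed

text \<open>The endpoint s - 1 = 4/3 for five dimensions: in the window t^(4/3) t^(-5/3) = t^(-1/3)
  is of order 1 / L, so the window contributes a bounded amount and nothing better.\<close>

lemma nn_integral_cube_weight:
  "(\<integral>\<^sup>+t. ennreal (t powr (4 / 3) * k t ^ 5) * indicator {1..} t \<partial>lborel) \<le> ennreal (4 + 20 + 1)"
proof (rule turning_point_bound[where L = turning_width and \<nu> = \<nu>])
  let ?L = turning_width
  have L: "?L \<ge> 1" by (rule turning_width_ge_1)
  show "?L > 0" using L by simp
  show "t powr (4 / 3) * k t ^ 5 \<le> 2 / ?L" if t: "t \<ge> 1" "\<bar>t - \<nu>\<bar> \<le> ?L" for t
  proof -
    have "t powr (4 / 3) * k t ^ 5 \<le> t powr (4 / 3) * (t powr (- 1 / 3)) ^ 5"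
      using t by (intro mult_left_mono power_mono k1 k0) auto
    also have "\<dots> = t powr (4 / 3 + 5 * (- 1 / 3))"
      unfolding powr_add using t by (simp add: powr_realpow[symmetric] powr_powr)
    also have "\<dots> = t powr (- 1 / 3)" by simp
    also have "\<dots> \<le> 2 / ?L" using t by (rule cbrt_decay_near)
    finally show ?thesis .
  qed
  \<comment> \<open>Here t = \<nu> + u \<le> L^3 + u, so t^(1/12) is split into L^(1/4) and
    u^(1/12), with 2 covering the constant 2^(1/12). The two integrals from L on give 8 and 12
    L^(-1/6).\<close>
  define f2 where "f2 u = 2 * (?L powr (1 / 4) * u powr (- (5 / 4)) + u powr (- (7 / 6)))" for u
  show "t powr (4 / 3) * k t ^ 5 \<le> f2 (t - \<nu>)" if t: "t \<ge> 1" "t \<ge> \<nu> + ?L" for t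
  proof -
    define u where "u = t - \<nu>"
    have u: "u \<ge> 1" "t > \<nu>" "t > 0" using t L by (auto simp: u_def)
    have "t powr (4 / 3) * k t ^ 5 \<le> t powr (4 / 3) * ((t * u) powr (- 1 / 4)) ^ 5"
      unfolding u_def using u by (intro mult_left_mono power_mono k2 k0) auto
    also have "((t * u) powr (- 1 / 4)) ^ 5 = t powr (- (5 / 4)) * u powr (- (5 / 4))"
      using u by (simp add: powr_mult powr_realpow[symmetric] powr_powr)
    also have "t powr (4 / 3) * (t powr (- (5 / 4)) * u powr (- (5 / 4))) = t powr (1 / 12) * u powr (- (5 / 4))"
      using u by (simp add: mult.assoc[symmetric] powr_add[symmetric])
    also have "t powr (1 / 12) \<le> 2 * (?L powr (1 / 4) + u powr (1 / 12))"
    proof -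
      have two: "(2 * x) powr (1 / 12) \<le> 2 * x powr (1 / 12)" if "x \<ge> 0" for x :: real
      proof -
        have "2 powr (1 / 12) \<le> (2::real) powr 1" by (intro powr_mono) auto
        then show ?thesis using that by (simp add: powr_mult mult_right_mono)
      qed
      have tu: "t \<le> ?L powr 3 + u" using \<nu>_le_turning_width by (simp add: u_def del: powr_numeral)
      show ?thesis
      proof (cases "?L powr 3 \<le> u")
        case True
        then have "t powr (1 / 12) \<le> (2 * u) powr (1 / 12)" using tu u by (intro powr_mono2) auto
        also have "\<dots> \<le> 2 * u powr (1 / 12)" using u by (intro two) auto
        also have "\<dots> \<le> 2 * (?L powr (1 / 4) + u powr (1 / 12))" by simp
        finally show ?thesis .
      next
        case False
        then have "t powr (1 / 12) \<le> (2 * ?L powr 3) powr (1 / 12)" using tu u by (intro powr_mono2) auto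
        also have "\<dots> \<le> 2 * (?L powr 3) powr (1 / 12)" by (intro two powr_ge_zero)
        also have "(?L powr 3) powr (1 / 12) = ?L powr (1 / 4)" unfolding powr_powr by simp
        also have "2 * ?L powr (1 / 4) \<le> 2 * (?L powr (1 / 4) + u powr (1 / 12))" by simp
        finally show ?thesis .
      qed
    qed
    then have "t powr (1 / 12) * u powr (- (5 / 4)) \<le> 2 * (?L powr (1 / 4) + u powr (1 / 12)) * u powr (- (5 / 4))"
      by (intro mult_right_mono) auto
    also have "\<dots> = f2 u"
      using u by (simp add: f2_def algebra_simps powr_add[symmetric])
    finally show ?thesis by (simp add: u_def)
  qed
  define f4 where "f4 u = ?L powr 4 * u powr (- 5)" for u
  show "t powr (4 / 3) * k t ^ 5 \<le> f4 (\<nu> - t)" if t: "t \<ge> 1" "t \<le> \<nu> - ?L" for t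
  proof -
    have u: "\<nu> - t > 0" "t > 0" "t < \<nu>" using t L by auto
    have "t powr (4 / 3) \<le> (?L powr 3) powr (4 / 3)"
      using u order_trans[OF less_imp_le[OF u(3)] \<nu>_le_turning_width] by (intro powr_mono2) auto
    also have "(?L powr 3) powr (4 / 3) = ?L powr 4" unfolding powr_powr by simp
    finally have "t powr (4 / 3) * k t ^ 5 \<le> ?L powr 4 * (1 / (\<nu> - t)) ^ 5"
      using u by (intro mult_mono power_mono k3 k0) (auto intro: k0)
    also have "(1 / (\<nu> - t)) ^ 5 = (\<nu> - t) powr (- 5)" using u by (simp add: powr_minus_divide power_one_over)
    finally show ?thesis by (simp add: f4_def)
  qed
  show [measurable]: "f2 \<in> borel_measurable borel" "f4 \<in> borel_measurable borel"
    unfolding f2_def f4_def by measurable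
  show "(\<integral>\<^sup>+u. ennreal (f2 u) * indicator {?L..} u \<partial>lborel) \<le> ennreal 20"
  proof -
    have "(\<integral>\<^sup>+u. ennreal (f2 u) * indicator {?L..} u \<partial>lborel)
       = (\<integral>\<^sup>+u. ennreal (2 * ?L powr (1 / 4)) * (ennreal (u powr (- (5 / 4))) * indicator {?L..} u)
           + ennreal 2 * (ennreal (u powr (- (7 / 6))) * indicator {?L..} u) \<partial>lborel)"
      by (intro nn_integral_cong)
         (simp add: f2_def distrib_left ennreal_plus ennreal_mult mult.assoc distrib_right split: split_indicator)
    also have "\<dots> = ennreal (2 * ?L powr (1 / 4)) * ennreal (?L powr (1 - 5 / 4) / (5 / 4 - 1))
        + ennreal 2 * ennreal (?L powr (1 - 7 / 6) / (7 / 6 - 1))"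
      using L by (subst nn_integral_add; (simp only: nn_integral_cmult nn_integral_powr_tail)?) (auto simp: nn_integral_cmult nn_integral_powr_tail)
    also have "\<dots> = ennreal (8 * (?L powr (1 / 4) * ?L powr (- 1 / 4)) + 12 * ?L powr (- 1 / 6))"
      by (simp add: ennreal_mult[symmetric] ennreal_plus[symmetric] del: ennreal_plus ennreal_numeral)
    also have "?L powr (1 / 4) * ?L powr (- 1 / 4) = 1" using L by (simp add: powr_add[symmetric])
    also have "ennreal (8 * 1 + 12 * ?L powr (- 1 / 6)) \<le> ennreal 20"
      using powr_mono[of "- 1 / 6" 0 ?L] L by (intro ennreal_leI) simp
    finally show ?thesis .
  qed
  show "(\<integral>\<^sup>+u. ennreal (f4 u) * indicator {?L..} u \<partial>lborel) \<le> ennreal 1"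
  proof -
    have "(\<integral>\<^sup>+u. ennreal (f4 u) * indicator {?L..} u \<partial>lborel)
       = (\<integral>\<^sup>+u. ennreal (?L powr 4) * (ennreal (u powr (- 5)) * indicator {?L..} u) \<partial>lborel)"
      unfolding f4_def by (simp add: ennreal_mult mult.assoc del: powr_numeral powr_neg_numeral)
    also have "\<dots> = ennreal (?L powr 4) * ennreal (?L powr (1 - 5) / (5 - 1))"
      using L nn_integral_powr_tail[of ?L 5] by (subst nn_integral_cmult) (auto simp del: powr_numeral powr_neg_numeral)
    also have "\<dots> = ennreal ((?L powr 4 * ?L powr (- 4)) / 4)"
      by (simp add: ennreal_mult[symmetric] del: powr_numeral powr_neg_numeral)
    also have "?L powr 4 * ?L powr (- 4) = 1" using L by (simp add: powr_add[symmetric] del: powr_numeral powr_neg_numeral)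
    finally show ?thesis by (simp add: ennreal_leI)
  qed
qed auto

text \<open>Past the window the bounds leave t^(a-1) / u with u = t - \<nu> \<le> t, hence u^(a-2).
  Its integral is the source of 1 / (1 - a) and of the strict inequality a < 1.\<close>

lemma nn_integral_quartic_weight:
  assumes a: "0 \<le> a" "a < 1"
  shows "(\<integral>\<^sup>+t. ennreal (t powr a * k t ^ 4) * indicator {1..} t \<partial>lborel) \<le> ennreal (4 + 1 / (1 - a) + 1)"
proof (rule turning_point_bound[where L = turning_width and \<nu> = \<nu>])
  let ?L = turning_width
  have L: "?L \<ge> 1" by (rule turning_width_ge_1)
  show "?L > 0" using L by simp
  show "t powr a * k t ^ 4 \<le> 2 / ?L" if t: "t \<ge> 1" "\<bar>t - \<nu>\<bar> \<le> ?L" for t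
  proof -
    have "t powr a * k t ^ 4 \<le> t powr 1 * (t powr (- 1 / 3)) ^ 4"
      using t a by (intro mult_mono power_mono k1 k0 powr_mono) auto
    also have "\<dots> = t powr (1 + 4 * (- 1 / 3))"
      unfolding powr_add using t by (simp add: powr_realpow[symmetric] powr_powr)
    also have "\<dots> = t powr (- 1 / 3)" by simp
    also have "\<dots> \<le> 2 / ?L" using t by (rule cbrt_decay_near)
    finally show ?thesis .
  qed
  define f2 where "f2 u = u powr (- (2 - a))" for u :: real
  show "t powr a * k t ^ 4 \<le> f2 (t - \<nu>)" if t: "t \<ge> 1" "t \<ge> \<nu> + ?L" for t
  proof -
    define u where "u = t - \<nu>"
    have u: "u \<ge> 1" "t > \<nu>" "t > 0" "u \<le> t" using t L \<nu> by (auto simp: u_def)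
    have "t powr a * k t ^ 4 \<le> t powr a * ((t * u) powr (- 1 / 4)) ^ 4"
      unfolding u_def using u by (intro mult_left_mono power_mono k2 k0) auto
    also have "((t * u) powr (- 1 / 4)) ^ 4 = t powr (- 1) * u powr (- 1)"
      using u by (simp add: powr_mult powr_realpow[symmetric] powr_powr)
    also have "t powr a * (t powr (- 1) * u powr (- 1)) = t powr (a - 1) * u powr (- 1)"
      using u by (simp add: mult.assoc[symmetric] powr_diff powr_minus_divide)
    also have "\<dots> \<le> u powr (a - 1) * u powr (- 1)"
      using u a by (intro mult_right_mono powr_mono2') auto
    also have "\<dots> = f2 u" unfolding f2_def powr_add[symmetric] by simp
    finally show ?thesis by (simp add: u_def)
  qed
  define f4 where "f4 u = ?L powr 3 * u powr (- 4)" for u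
  show "t powr a * k t ^ 4 \<le> f4 (\<nu> - t)" if t: "t \<ge> 1" "t \<le> \<nu> - ?L" for t
  proof -
    have u: "\<nu> - t > 0" "t > 0" "t < \<nu>" using t L by auto
    have "t powr a \<le> t powr 1" using t a by (intro powr_mono) auto
    also have "\<dots> \<le> ?L powr 3" using u \<nu>_le_turning_width by (simp del: powr_numeral)
    finally have "t powr a * k t ^ 4 \<le> ?L powr 3 * (1 / (\<nu> - t)) ^ 4"
      using u by (intro mult_mono power_mono k3 k0) (auto intro: k0)
    also have "(1 / (\<nu> - t)) ^ 4 = (\<nu> - t) powr (- 4)" using u by (simp add: powr_minus_divide power_one_over)
    finally show ?thesis by (simp add: f4_def)
  qed
  show [measurable]: "f2 \<in> borel_measurable borel" "f4 \<in> borel_measurable borel"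
    unfolding f2_def f4_def by measurable
  show "(\<integral>\<^sup>+u. ennreal (f2 u) * indicator {?L..} u \<partial>lborel) \<le> ennreal (1 / (1 - a))"
  proof -
    have "(\<integral>\<^sup>+u. ennreal (f2 u) * indicator {?L..} u \<partial>lborel) = ennreal (?L powr (1 - (2 - a)) / ((2 - a) - 1))"
      unfolding f2_def using L a by (intro nn_integral_powr_tail) auto
    also have "\<dots> \<le> ennreal (1 / (1 - a))"
      using powr_mono[of "a - 1" 0 ?L] L a by (intro ennreal_leI) (auto simp: divide_right_mono)
    finally show ?thesis .
  qed
  show "(\<integral>\<^sup>+u. ennreal (f4 u) * indicator {?L..} u \<partial>lborel) \<le> ennreal 1"
  proof -
    have "(\<integral>\<^sup>+u. ennreal (f4 u) * indicator {?L..} u \<partial>lborel)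
       = (\<integral>\<^sup>+u. ennreal (?L powr 3) * (ennreal (u powr (- 4)) * indicator {?L..} u) \<partial>lborel)"
      unfolding f4_def by (simp add: ennreal_mult mult.assoc del: powr_numeral powr_neg_numeral)
    also have "\<dots> = ennreal (?L powr 3) * ennreal (?L powr (1 - 4) / (4 - 1))"
      using L nn_integral_powr_tail[of ?L 4] by (subst nn_integral_cmult) (auto simp del: powr_numeral powr_neg_numeral)
    also have "\<dots> = ennreal ((?L powr 3 * ?L powr (- 3)) / 3)"
      by (simp add: ennreal_mult[symmetric] del: powr_numeral powr_neg_numeral)
    also have "?L powr 3 * ?L powr (- 3) = 1" using L by (simp add: powr_add[symmetric] del: powr_numeral powr_neg_numeral)
    finally show ?thesis by (simp add: ennreal_leI)
  qed
qed (use a in auto)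

end

text \<open>For d \<ge> 5, d - 5 of the d factors are spent as t^(-1/3), which lowers the largest
  weight exponent (d - 1) / 3 to 4/3 and leaves a fifth power. For d = 4 the quartic estimate
  applies as it stands. On [0, 1] the kernel is at most 1.\<close>

lemma kernel1_time_bound:
  fixes d :: nat and a :: real
  assumes ad: "0 \<le> a" "d = 4 \<and> a < 1 \<or> d \<ge> 5 \<and> a \<le> (real d - 1) / 3"
  shows "\<exists>C\<ge>0. \<forall>m. (\<integral>\<^sup>+t. ennreal ((1 + t) powr a * cmod (kernel1 t m) ^ d) * indicator {0..} t \<partial>lborel) \<le> ennreal C"
proof -
  obtain p q C0 B where C0: "C0 \<ge> 0" "B \<ge> 0"
    and main: "\<And>k \<nu>. (\<And>t. k t \<ge> 0) \<Longrightarrow> \<nu> \<ge> 0 \<Longrightarrow> (\<And>t. t > 0 \<Longrightarrow> k t \<le> t powr (- 1 / 3)) \<Longrightarrow>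
      (\<And>t. t > \<nu> \<Longrightarrow> k t \<le> (t * (t - \<nu>)) powr (- 1 / 4)) \<Longrightarrow>
      (\<And>t. t > 0 \<Longrightarrow> t < \<nu> \<Longrightarrow> k t \<le> 1 / (\<nu> - t)) \<Longrightarrow>
      (\<integral>\<^sup>+t. ennreal (t powr p * k t ^ q) * indicator {1..} t \<partial>lborel) \<le> ennreal C0"
    and red: "\<And>k t. k \<ge> 0 \<Longrightarrow> t \<ge> 1 \<Longrightarrow> k \<le> t powr (- 1 / 3) \<Longrightarrow> (1 + t) powr a * (27 * k) ^ d \<le> B * (t powr p * k ^ q)"
  proof (cases "d = 4 \<and> a < 1")
    case True
    show thesis
    proof (rule that[of "4 + 1 / (1 - a) + 1" "2 powr a * 27 ^ 4" a 4])
      show "(1 + t) powr a * (27 * k) ^ d \<le> (2 powr a * 27 ^ 4) * (t powr a * k ^ 4)" if "k \<ge> 0" "t \<ge> 1" for k t :: real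
      proof -
        have "(1 + t) powr a \<le> (2 * t) powr a" using that ad by (intro powr_mono2) auto
        also have "\<dots> = 2 powr a * t powr a" using that by (simp add: powr_mult)
        finally have "(1 + t) powr a * (27 * k) ^ d \<le> 2 powr a * t powr a * (27 * k) ^ d"
          using that by (intro mult_right_mono) auto
        then show ?thesis using True by (simp add: power_mult_distrib mult_ac)
      qed
    qed (use ad True nn_integral_quartic_weight in auto)
  next
    case False
    then have d: "d \<ge> 5" "a \<le> (real d - 1) / 3" using ad by auto
    define A where "A = (real d - 1) / 3"
    show thesis
    proof (rule that[of "4 + 20 + 1" "2 powr A * 27 ^ d" "4 / 3" 5])
      show "(1 + t) powr a * (27 * k) ^ d \<le> (2 powr A * 27 ^ d) * (t powr (4 / 3) * k ^ 5)"
        if k: "k \<ge> 0" "t \<ge> 1" "k \<le> t powr (- 1 / 3)" for k t :: real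
      proof -
        have "(1 + t) powr a \<le> (1 + t) powr A" using k d by (intro powr_mono) (auto simp: A_def)
        also have "\<dots> \<le> (2 * t) powr A" using k d by (intro powr_mono2) (auto simp: A_def)
        also have "\<dots> = 2 powr A * t powr A" using k by (simp add: powr_mult)
        finally have 1: "(1 + t) powr a \<le> 2 powr A * t powr A" .
        have "(27 * k) ^ d = 27 ^ d * (k ^ 5 * k ^ (d - 5))"
          using d by (simp add: power_mult_distrib power_add[symmetric])
        also have "\<dots> \<le> 27 ^ d * (k ^ 5 * (t powr (- 1 / 3)) ^ (d - 5))"
          using k by (intro mult_left_mono power_mono) auto
        also have "(t powr (- 1 / 3)) ^ (d - 5) = t powr (- 1 / 3 * real (d - 5))"
          using k by (simp add: powr_realpow[symmetric] powr_powr)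
        also have "- 1 / 3 * real (d - 5) = - (real d - 5) / 3"
        proof -
          have e: "real (d - 5) = real d - 5" using d by (simp add: of_nat_diff)
          show ?thesis unfolding e by linarith
        qed
        finally have 2: "(27 * k) ^ d \<le> 27 ^ d * (k ^ 5 * t powr (- (real d - 5) / 3))" .
        have "(1 + t) powr a * (27 * k) ^ d \<le> (2 powr A * t powr A) * (27 ^ d * (k ^ 5 * t powr (- (real d - 5) / 3)))"
          using 1 2 k by (intro mult_mono) auto
        also have "\<dots> = (2 powr A * 27 ^ d) * ((t powr A * t powr (- (real d - 5) / 3)) * k ^ 5)" by (simp add: mult_ac)
        also have "t powr A * t powr (- (real d - 5) / 3) = t powr (4 / 3)"
          unfolding powr_add[symmetric] A_def by (rule arg_cong[where f = "\<lambda>x. t powr x"]) (simp add: field_simps)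
        finally show ?thesis .
      qed
    qed (use nn_integral_cube_weight in auto)
  qed
  show ?thesis
  proof (intro exI[of _ "2 powr a + B * C0"] conjI allI)
    show "0 \<le> 2 powr a + B * C0" using C0 by simp
    fix m :: int
    define \<nu> where "\<nu> = real_of_int \<bar>m\<bar> / 2"
    \<comment> \<open>Division by 27 normalises all three kernel bounds to constant one.\<close>
    define k where "k t = cmod (kernel1 t m) / 27" for t
    have k0: "k t \<ge> 0" for t by (simp add: k_def)
    have k1: "k t \<le> t powr (- 1 / 3)" if "t > 0" for t
      using kernel1_bound_cbrt[OF that, of m] by (simp add: k_def)
    have k2: "k t \<le> (t * (t - \<nu>)) powr (- 1 / 4)" if "t > \<nu>" for t
      using kernel1_bound_above[of m t] that by (simp add: k_def \<nu>_def)
    have k3: "k t \<le> 1 / (\<nu> - t)" if "t > 0" "t < \<nu>" for t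
      using kernel1_bound_below[of t m] that by (simp add: k_def \<nu>_def)
    have le: "ennreal ((1 + t) powr a * cmod (kernel1 t m) ^ d) * indicator {0..} t
        \<le> ennreal (2 powr a) * indicator {0..1} t + ennreal B * (ennreal (t powr p * k t ^ q) * indicator {1..} t)" for t
    proof -
      consider "t < 0" | "0 \<le> t" "t < 1" | "t \<ge> 1" by linarith
      then show ?thesis
      proof cases
        case 2
        have "(1 + t) powr a * cmod (kernel1 t m) ^ d \<le> 2 powr a * 1 ^ d"
          using 2 ad kernel1_le_1[of t m] by (intro mult_mono power_mono powr_mono2) auto
        then show ?thesis using 2 by (simp add: ennreal_leI)
      next
        case 3
        have "(1 + t) powr a * cmod (kernel1 t m) ^ d \<le> B * (t powr p * k t ^ q)"
          using red[of "k t" t] 3 k0 k1[of t] by (simp add: k_def)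
        then have "ennreal ((1 + t) powr a * cmod (kernel1 t m) ^ d) \<le> ennreal B * ennreal (t powr p * k t ^ q)"
          using C0 k0 by (simp add: ennreal_mult[symmetric] ennreal_leI)
        then show ?thesis using 3 by (simp add: add_increasing)
      qed simp
    qed
    have [measurable]: "k \<in> borel_measurable borel"
      unfolding k_def using continuous_on_kernel1[of m]
      by (intro borel_measurable_continuous_onI continuous_intros) auto
    have "(\<integral>\<^sup>+t. ennreal ((1 + t) powr a * cmod (kernel1 t m) ^ d) * indicator {0..} t \<partial>lborel)
       \<le> (\<integral>\<^sup>+t. ennreal (2 powr a) * indicator {0..1} t + ennreal B * (ennreal (t powr p * k t ^ q) * indicator {1..} t) \<partial>lborel)"
      by (intro nn_integral_mono le)
    also have "\<dots> = ennreal (2 powr a) + ennreal B * (\<integral>\<^sup>+t. ennreal (t powr p * k t ^ q) * indicator {1..} t \<partial>lborel)"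
      by (simp add: nn_integral_add nn_integral_cmult nn_integral_cmult_indicator)
    also have "\<dots> \<le> ennreal (2 powr a) + ennreal B * ennreal C0"
      using main[OF k0 _ k1 k2 k3] by (intro add_left_mono mult_left_mono) (auto simp: \<nu>_def)
    also have "\<dots> = ennreal (2 powr a + B * C0)" using C0 by (simp add: ennreal_mult ennreal_plus)
    finally show "(\<integral>\<^sup>+t. ennreal ((1 + t) powr a * cmod (kernel1 t m) ^ d) * indicator {0..} t \<partial>lborel) \<le> ennreal (2 powr a + B * C0)" .
  qed
qed

section \<open>Fourier analysis on the torus\<close>

text \<open>The sign is opposite to that in \<open>fourier_transform\<close>: integration against
  \<open>character n\<close> recovers coefficients, and the partial sums of a transform carry
  conjugates.\<close>

definition character :: "int ^ 'd \<Rightarrow> real ^ 'd \<Rightarrow> complex" where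
  "character n \<xi> = cis (2 * pi * (\<Sum>j\<in>UNIV. of_int (n $ j) * \<xi> $ j))"

text \<open>A compact version of \<open>torus\<close>, differing by a null set, on which the
  integration theory for boxes is available.\<close>

definition cube :: "(real ^ 'd) set" where
  "cube = cbox (\<chi> i. - 1 / 2) (\<chi> i. 1 / 2)"

lemma mem_cube: "\<xi> \<in> cube \<longleftrightarrow> (\<forall>j. - 1 / 2 \<le> \<xi> $ j \<and> \<xi> $ j \<le> 1 / 2)"
  by (simp add: cube_def mem_box_cart)

lemma compact_cube: "compact cube" by (simp add: cube_def)

lemma torus_subset_cube: "torus \<subseteq> (cube :: (real ^ 'd::finite) set)"
proof
  fix \<xi> :: "real ^ 'd" assume "\<xi> \<in> torus"
  then have "\<forall>j. - 1 / 2 < \<xi> $ j \<and> \<xi> $ j \<le> 1 / 2" by (simp add: torus_def)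
  then show "\<xi> \<in> cube" unfolding mem_cube by (meson less_imp_le)
qed

lemma negligible_cube_diff_torus: "negligible (cube - torus :: (real ^ 'd::finite) set)"
proof (rule negligible_subset)
  have "negligible {\<xi> :: real ^ 'd. \<xi> $ j = - 1 / 2}" for j
    using negligible_standard_hyperplane[of "axis j 1 :: real ^ 'd" "- 1 / 2"]
    by (simp add: cart_eq_inner_axis axis_in_Basis_iff)
  then show "negligible (\<Union>j::'d. {\<xi> :: real ^ 'd. \<xi> $ j = - 1 / 2})"
    by (intro negligible_Union) auto
  show "cube - torus \<subseteq> (\<Union>j::'d. {\<xi> :: real ^ 'd. \<xi> $ j = - 1 / 2})"
  proof
    fix \<xi> :: "real ^ 'd" assume "\<xi> \<in> cube - torus"
    then have "\<xi> \<in> cube" "\<xi> \<notin> torus" by auto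
    from this(1) have c: "\<forall>j. - 1 / 2 \<le> \<xi> $ j \<and> \<xi> $ j \<le> 1 / 2" by (simp add: mem_cube)
    have "\<not> (\<forall>j. - 1 / 2 < \<xi> $ j \<and> \<xi> $ j \<le> 1 / 2)"
      using \<open>\<xi> \<notin> torus\<close> unfolding torus_def mem_Collect_eq .
    then obtain j where "\<not> - 1 / 2 < \<xi> $ j" "- 1 / 2 \<le> \<xi> $ j" using c by blast
    then show "\<xi> \<in> (\<Union>j. {\<xi>. \<xi> $ j = - 1 / 2})" by (intro UN_I[of j]) auto
  qed
qed

lemma integral_cube_of_real: "f integrable_on cube \<Longrightarrow> integral cube (\<lambda>\<xi>. complex_of_real (f \<xi>)) = of_real (integral cube f)"
  using integral_linear[OF _ bounded_linear_of_real, of f cube] by (simp add: o_def)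

lemma integral_cube_Re: "f integrable_on cube \<Longrightarrow> integral cube (\<lambda>\<xi>. Re (f \<xi>)) = Re (integral cube f)"
  using integral_linear[OF _ bounded_linear_Re, of f cube] by (simp add: o_def)

lemma torus_lebesgue: "(torus :: (real ^ 'd::finite) set) \<in> sets lebesgue"
proof -
  have "(torus :: (real ^ 'd) set) = cube - (cube - torus)" using torus_subset_cube by auto
  also have "\<dots> \<in> sets lebesgue"
    by (rule sets.Diff[OF _ negligible_imp_sets[OF negligible_cube_diff_torus]]) (simp add: cube_def)
  finally show ?thesis .
qed

lemma continuous_integrable_torus:
  fixes f :: "real ^ 'd \<Rightarrow> 'b::euclidean_space"
  assumes "continuous_on cube f"
  shows "integrable (lebesgue_on torus) f" "integral\<^sup>L (lebesgue_on torus) f = integral cube f"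
proof -
  have "f absolutely_integrable_on cube"
    using assms absolutely_integrable_continuous unfolding cube_def by blast
  then have "f absolutely_integrable_on torus"
    by (rule set_integrable_subset) (use torus_lebesgue torus_subset_cube in auto)
  then show i: "integrable (lebesgue_on torus) f"
    by (simp add: integrable_restrict_space set_integrable_def torus_lebesgue)
  have "integral\<^sup>L (lebesgue_on torus) f = integral torus f"
    by (rule lebesgue_integral_eq_integral[OF i torus_lebesgue])
  also have "\<dots> = integral cube f"
    by (rule integral_spike_set)
       (use torus_subset_cube negligible_cube_diff_torus in \<open>auto intro: negligible_subset\<close>)
  finally show "integral\<^sup>L (lebesgue_on torus) f = integral cube f" .
qed

lemma cube_integrable: "continuous_on UNIV f \<Longrightarrow> f integrable_on cube"
  for f :: "real ^ 'd \<Rightarrow> 'b::banach"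
  unfolding cube_def by (intro integrable_continuous) (auto intro: continuous_on_subset)

text \<open>Lebesgue measure is the image of a product measure indexed by \<open>Basis\<close>. Once
  the indicator of the cube is distributed over the factors, Fubini for finite products
  applies.\<close>

lemma integral_cube_prod:
  fixes f :: "'d::finite \<Rightarrow> real \<Rightarrow> complex"
  assumes cont: "\<And>j. continuous_on UNIV (f j)"
  shows "integral cube (\<lambda>\<xi>. \<Prod>j\<in>UNIV. f j (\<xi> $ j)) = (\<Prod>j\<in>UNIV. integral {- 1 / 2..1 / 2} (f j))"
proof -
  let ?F = "\<lambda>\<xi> :: real ^ 'd. \<Prod>j\<in>UNIV. f j (\<xi> $ j)"
  define h where "h j x = indicator {- 1 / 2..1 / 2} x *\<^sub>R f j x" for j x
  \<comment> \<open>The product measure is indexed by basis vectors, the integrand by coordinates;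
    \<open>ix\<close> translates back.\<close>
  define ix :: "real ^ 'd \<Rightarrow> 'd" where "ix = inv (\<lambda>j. axis j 1)"
  have inj: "inj (\<lambda>j. axis j (1::real) :: real ^ 'd)" by (auto simp: inj_def axis_eq_axis)
  have ix: "ix (axis j 1) = j" for j unfolding ix_def by (rule inv_f_f[OF inj])
  have Basis: "(Basis :: (real ^ 'd) set) = range (\<lambda>j. axis j 1)" by (auto simp: Basis_vec_def)
  have hint: "set_integrable lborel {- 1 / 2..1 / 2} (f j)" for j
    using borel_integrable_atLeastAtMost'[of "- 1 / 2" "1 / 2" "f j"] continuous_on_subset[OF cont] by simp
  have comp: "(\<Sum>b\<in>Basis. g b *\<^sub>R b) $ j = g (axis j 1)" for g :: "real ^ 'd \<Rightarrow> real" and j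
  proof -
    have "(\<Sum>b\<in>Basis. g b *\<^sub>R b) $ j = (\<Sum>i\<in>UNIV. g (axis i 1) * (axis i 1 :: real ^ 'd) $ j)"
      by (simp add: Basis sum.reindex[OF inj] o_def)
    also have "\<dots> = (\<Sum>i\<in>UNIV. if i = j then g (axis j 1) else 0)"
      by (intro sum.cong refl) (auto simp: axis_def)
    finally show ?thesis by simp
  qed
  have Fm: "(\<lambda>\<xi>. indicator cube \<xi> *\<^sub>R ?F \<xi>) \<in> borel_measurable borel"
    by (intro borel_measurable_scaleR borel_measurable_indicator borel_measurable_continuous_onI
        continuous_intros continuous_on_compose2[OF cont]) (auto simp: cube_def)
  have ind: "indicator cube \<xi> *\<^sub>R ?F \<xi> = (\<Prod>j\<in>UNIV. h j (\<xi> $ j))" for \<xi>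
  proof (cases "\<xi> \<in> cube")
    case True
    then show ?thesis by (simp add: h_def mem_cube)
  next
    case False
    then obtain j where "\<xi> $ j \<notin> {- 1 / 2..1 / 2}" by (auto simp: mem_cube)
    then have "h j (\<xi> $ j) = 0" by (simp add: h_def)
    then have "(\<Prod>j\<in>UNIV. h j (\<xi> $ j)) = 0" by (metis UNIV_I finite_class.finite_UNIV prod_zero)
    then show ?thesis using False by simp
  qed
  define M where "M = (\<Pi>\<^sub>M b\<in>(Basis :: (real ^ 'd) set). (lborel :: real measure))"
  interpret product_sigma_finite "\<lambda>b :: real ^ 'd. lborel :: real measure" by standard
  have si: "set_integrable lborel cube ?F"
    unfolding cube_def by (rule borel_integrable_compact[unfolded set_integrable_def[symmetric]])
      (auto intro!: continuous_intros continuous_on_compose2[OF cont])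
  have "integral cube ?F = (LINT \<xi>|lborel. indicator cube \<xi> *\<^sub>R ?F \<xi>)"
    using set_borel_integral_eq_integral(2)[OF si] by (simp add: set_lebesgue_integral_def)
  also have "\<dots> = (LINT g|M. indicator cube (\<Sum>b\<in>Basis. g b *\<^sub>R b) *\<^sub>R ?F (\<Sum>b\<in>Basis. g b *\<^sub>R b))"
    unfolding M_def by (subst lborel_eq) (rule integral_distr[OF _ Fm], measurable)
  also have "\<dots> = (LINT g|M. (\<Prod>b\<in>(Basis :: (real ^ 'd) set). h (ix b) (g b)))"
  proof (rule Bochner_Integration.integral_cong[OF refl])
    fix g :: "real ^ 'd \<Rightarrow> real"
    have "indicator cube (\<Sum>b\<in>Basis. g b *\<^sub>R b) *\<^sub>R ?F (\<Sum>b\<in>Basis. g b *\<^sub>R b) = (\<Prod>j\<in>UNIV. h j (g (axis j 1)))"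
      by (subst ind) (simp only: comp)
    then show "indicator cube (\<Sum>b\<in>Basis. g b *\<^sub>R b) *\<^sub>R ?F (\<Sum>b\<in>Basis. g b *\<^sub>R b)
        = (\<Prod>b\<in>(Basis :: (real ^ 'd) set). h (ix b) (g b))"
      unfolding Basis by (simp add: prod.reindex[OF inj] o_def ix)
  qed
  also have "\<dots> = (\<Prod>b\<in>(Basis :: (real ^ 'd) set). (LINT x|lborel. h (ix b) x))"
    unfolding M_def
    using hint by (intro product_integral_prod) (auto simp: h_def set_integrable_def)
  also have "\<dots> = (\<Prod>j\<in>UNIV. (LINT x|lborel. h j x))"
    by (simp add: Basis prod.reindex[OF inj] o_def ix)
  also have "\<dots> = (\<Prod>j\<in>UNIV. integral {- 1 / 2..1 / 2} (f j))"
    using set_borel_integral_eq_integral(2)[OF hint] by (simp add: set_lebesgue_integral_def h_def)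
  finally show ?thesis .
qed

lemma cis_sum: "cis (\<Sum>i\<in>A. f i) = (\<Prod>i\<in>A. cis (f i))"
  by (induction A rule: infinite_finite_induct) (auto simp: cis_mult[symmetric])

lemma character_prod: "character n \<xi> = (\<Prod>j\<in>UNIV. cis (2 * pi * of_int (n $ j) * \<xi> $ j))"
  unfolding character_def sum_distrib_left cis_sum by (simp add: mult.assoc)

lemma character_add: "character (n + m) \<xi> = character n \<xi> * character m \<xi>"
  by (simp add: character_def cis_mult sum.distrib distrib_left distrib_right)

lemma character_uminus: "character (- n) \<xi> = cnj (character n \<xi>)"
  by (simp add: character_def cis_cnj sum_negf)

lemma character_diff: "character (n - m) \<xi> = character n \<xi> * cnj (character m \<xi>)"
  using character_add[of n "- m"] by (simp add: character_uminus)

lemma character_0 [simp]: "character 0 \<xi> = 1" by (simp add: character_def)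

lemma norm_character [simp]: "cmod (character n \<xi>) = 1" by (simp add: character_def)

lemma continuous_on_character [continuous_intros]: "continuous_on S (character n)"
  unfolding character_def by (intro continuous_intros)

lemma integral_cis_period:
  "integral {- 1 / 2..1 / 2} (\<lambda>x. cis (2 * pi * of_int m * x)) = (if m = 0 then 1 else 0)"
proof (cases "m = 0")
  case False
  define c where "c = 1 / (\<i> * complex_of_real (2 * pi * of_int m))"
  have nz: "\<i> * complex_of_real (2 * pi * of_int m) \<noteq> 0" using False by simp
  have d: "((\<lambda>x. c * cis (2 * pi * of_int m * x)) has_vector_derivative cis (2 * pi * of_int m * x)) (at x)" for x
  proof -
    have "((\<lambda>x. 2 * pi * of_int m * x) has_real_derivative (2 * pi * of_int m)) (at x)"
      by (auto intro!: derivative_eq_intros)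
    from has_vector_derivative_mult_right[OF has_vector_derivative_cis[OF this], of c]
    show ?thesis using nz by (simp add: c_def)
  qed
  have "((\<lambda>x. cis (2 * pi * of_int m * x)) has_integral
      (c * cis (2 * pi * of_int m * (1 / 2)) - c * cis (2 * pi * of_int m * (- 1 / 2)))) {- 1 / 2..1 / 2}"
    by (rule fundamental_theorem_of_calculus[where f = "\<lambda>x. c * cis (2 * pi * of_int m * x)"])
       (auto intro: has_vector_derivative_at_within d)
  moreover have "cis (2 * pi * of_int m * (1 / 2)) = cis (2 * pi * of_int m * (- 1 / 2)) * cis (2 * pi * of_int m)"
    unfolding cis_mult by simp
  moreover have "cis (2 * pi * of_int m) = 1" by (rule cis_multiple_2pi) simp
  ultimately show ?thesis using False by (simp add: integral_unique)
qed simp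

lemma integral_character: "integral cube (character n) = (if n = 0 then 1 else 0)"
proof -
  have "integral cube (character n) = (\<Prod>j\<in>UNIV. integral {- 1 / 2..1 / 2} (\<lambda>x. cis (2 * pi * of_int (n $ j) * x)))"
    unfolding character_prod[abs_def] by (rule integral_cube_prod) (intro continuous_intros)
  also have "\<dots> = (\<Prod>j\<in>UNIV. if n $ j = 0 then 1 else 0)" by (simp only: integral_cis_period)
  also have "\<dots> = (if n = 0 then 1 else 0)"
    by (auto simp: vec_eq_iff intro: prod_zero)
  finally show ?thesis .
qed

lemma continuous_on_laplace_symbol [continuous_intros]: "continuous_on S laplace_symbol"
  unfolding laplace_symbol_def by (intro continuous_intros)

definition kernel :: "real \<Rightarrow> int ^ 'd \<Rightarrow> complex" where
  "kernel t n = integral cube (\<lambda>\<xi>. character n \<xi> * cis (- (t * laplace_symbol \<xi>)))"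

lemma kernel_prod: "kernel t n = (\<Prod>j\<in>UNIV. kernel1 t (n $ j))"
proof -
  have "character n \<xi> * cis (- (t * laplace_symbol \<xi>))
     = (\<Prod>j\<in>UNIV. cis (2 * pi * of_int (n $ j) * \<xi> $ j - t * (4 * (sin (pi * \<xi> $ j))\<^sup>2)))" for \<xi>
    unfolding character_def laplace_symbol_def cis_mult cis_sum[symmetric]
    by (simp add: sum_subtractf sum_distrib_left mult_ac)
  then have "kernel t n = integral cube (\<lambda>\<xi>. \<Prod>j\<in>UNIV. cis (2 * pi * of_int (n $ j) * \<xi> $ j - t * (4 * (sin (pi * \<xi> $ j))\<^sup>2)))"
    by (simp add: kernel_def)
  also have "\<dots> = (\<Prod>j\<in>UNIV. kernel1 t (n $ j))"
    unfolding kernel1_def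
    by (rule integral_cube_prod[where f = "\<lambda>j x. cis (2 * pi * of_int (n $ j) * x - t * (4 * (sin (pi * x))\<^sup>2))"])
       (intro continuous_intros)
  finally show ?thesis .
qed

lemma continuous_on_kernel: "continuous_on S (\<lambda>t. kernel t n)"
  unfolding kernel_prod
  by (intro continuous_intros continuous_on_subset[OF continuous_on_kernel1]) auto

definition trig_poly :: "(int ^ 'd) set \<Rightarrow> (int ^ 'd \<Rightarrow> complex) \<Rightarrow> real ^ 'd \<Rightarrow> complex" where
  "trig_poly A c \<xi> = (\<Sum>n\<in>A. c n * character n \<xi>)"

lemma continuous_on_trig_poly [continuous_intros]: "continuous_on S (trig_poly A c)"
  unfolding trig_poly_def by (intro continuous_intros)

lemma trig_poly_parseval:
  assumes "finite A"
  shows "integral cube (\<lambda>\<xi>. (cmod (trig_poly A c \<xi>))\<^sup>2) = (\<Sum>n\<in>A. (cmod (c n))\<^sup>2)"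
proof -
  have "complex_of_real (integral cube (\<lambda>\<xi>. (cmod (trig_poly A c \<xi>))\<^sup>2))
      = integral cube (\<lambda>\<xi>. complex_of_real ((cmod (trig_poly A c \<xi>))\<^sup>2))"
    by (rule integral_cube_of_real[symmetric]) (intro cube_integrable continuous_intros)
  also have "\<dots> = integral cube (\<lambda>\<xi>. \<Sum>n\<in>A. \<Sum>m\<in>A. (c n * cnj (c m)) * character (n - m) \<xi>)"
  proof (rule integral_cong)
    fix \<xi> :: "real ^ 'a"
    show "complex_of_real ((cmod (trig_poly A c \<xi>))\<^sup>2) = (\<Sum>n\<in>A. \<Sum>m\<in>A. (c n * cnj (c m)) * character (n - m) \<xi>)"
      unfolding complex_norm_square trig_poly_def cnj_sum sum_product character_diff
      by (simp add: mult_ac)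
  qed
  also have "\<dots> = (\<Sum>n\<in>A. \<Sum>m\<in>A. (c n * cnj (c m)) * integral cube (character (n - m)))"
    using assms by (subst integral_sum; (intro integrable_sum cube_integrable continuous_intros)?)
      (auto intro!: sum.cong integral_sum[THEN trans] cube_integrable continuous_intros)
  also have "\<dots> = (\<Sum>n\<in>A. \<Sum>m\<in>A. if m = n then c n * cnj (c n) else 0)"
    by (intro sum.cong refl) (auto simp: integral_character)
  also have "\<dots> = complex_of_real (\<Sum>n\<in>A. (cmod (c n))\<^sup>2)"
    using assms by (simp add: complex_norm_square[symmetric])
  finally show ?thesis using of_real_eq_iff by blast
qed

text \<open>Expand the integral of the squared distance between G and its partial sum. It supplies
  the square summability of the resolvent kernel in \<open>coord_resolvent_ket\<close>.\<close>

lemma bessel_inequality: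
  fixes G :: "real ^ 'd \<Rightarrow> complex"
  assumes G: "continuous_on UNIV G" and A: "finite A"
  shows "(\<Sum>n\<in>A. (cmod (integral cube (\<lambda>\<xi>. G \<xi> * cnj (character n \<xi>))))\<^sup>2) \<le> integral cube (\<lambda>\<xi>. (cmod (G \<xi>))\<^sup>2)"
proof -
  define c where "c n = integral cube (\<lambda>\<xi>. G \<xi> * cnj (character n \<xi>))" for n
  let ?P = "trig_poly A c"
  have "0 \<le> integral cube (\<lambda>\<xi>. (cmod (G \<xi> - ?P \<xi>))\<^sup>2)"
    by (intro integral_nonneg cube_integrable continuous_intros G) auto
  also have "\<dots> = integral cube (\<lambda>\<xi>. (cmod (G \<xi>))\<^sup>2 + (cmod (?P \<xi>))\<^sup>2 - 2 * Re (G \<xi> * cnj (?P \<xi>)))"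
    by (intro integral_cong) (simp only: cmod_power2, simp add: power2_eq_square algebra_simps)
  also have "\<dots> = integral cube (\<lambda>\<xi>. (cmod (G \<xi>))\<^sup>2) + integral cube (\<lambda>\<xi>. (cmod (?P \<xi>))\<^sup>2)
      - 2 * integral cube (\<lambda>\<xi>. Re (G \<xi> * cnj (?P \<xi>)))"
    by (subst integral_diff integral_add integral_mult_right; (intro integrable_add integrable_cmul cube_integrable continuous_intros G)?)+
      auto
  also have "integral cube (\<lambda>\<xi>. Re (G \<xi> * cnj (?P \<xi>))) = Re (integral cube (\<lambda>\<xi>. G \<xi> * cnj (?P \<xi>)))"
    by (rule integral_cube_Re) (intro cube_integrable continuous_intros G)
  also have "integral cube (\<lambda>\<xi>. G \<xi> * cnj (?P \<xi>)) = integral cube (\<lambda>\<xi>. \<Sum>n\<in>A. cnj (c n) * (G \<xi> * cnj (character n \<xi>)))"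
    by (simp add: trig_poly_def sum_distrib_left mult_ac)
  also have "\<dots> = (\<Sum>n\<in>A. integral cube (\<lambda>\<xi>. cnj (c n) * (G \<xi> * cnj (character n \<xi>))))"
    by (intro integral_sum A cube_integrable continuous_intros G)
  also have "\<dots> = (\<Sum>n\<in>A. complex_of_real ((cmod (c n))\<^sup>2))"
    unfolding complex_norm_square by (simp add: c_def mult.commute)
  also have "integral cube (\<lambda>\<xi>. (cmod (?P \<xi>))\<^sup>2) = (\<Sum>n\<in>A. (cmod (c n))\<^sup>2)" by (rule trig_poly_parseval[OF A])
  finally show ?thesis by (simp add: c_def)
qed

section \<open>The lattice Laplacian\<close>

definition unit_vec :: "'d \<Rightarrow> int ^ 'd" where "unit_vec j = axis j 1"

text \<open>Built from shifts, so that boundedness and symmetry are immediate. That it agrees with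
  the Fourier multiplier is \<open>discrete_laplacian_coord\<close>.\<close>

definition lattice_laplacian :: "(int ^ 'd::finite) ell2 \<Rightarrow> (int ^ 'd) ell2" where
  "lattice_laplacian x = (\<Sum>j\<in>UNIV. 2 *\<^sub>C x - (shiftop (unit_vec j) x + shiftop (- unit_vec j) x))"

lemma coord_lattice_laplacian:
  "coord (lattice_laplacian x) n = (\<Sum>j\<in>UNIV. 2 * coord x n - (coord x (n + unit_vec j) + coord x (n - unit_vec j)))"
  by (simp add: lattice_laplacian_def)

lemma clin_lattice_laplacian: "clin lattice_laplacian"
  unfolding lattice_laplacian_def
  by (intro clin_sum_op clin_diff_op clin_add_op clin_scaleC_op clin_shiftop)

lemma symop_lattice_laplacian: "symop lattice_laplacian"
  unfolding symop_def lattice_laplacian_def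
  using clin_lattice_laplacian[unfolded lattice_laplacian_def]
  by (auto simp: inner_sum_left inner_sum_right inner_diff_left inner_diff_right inner_add_left inner_add_right
      inner_shiftop inner_scaleC_left intro!: sum.cong)

interpretation L: selfadjoint lattice_laplacian
  by standard (rule symop_lattice_laplacian)

lemma laplace_symbol_character:
  "complex_of_real (laplace_symbol \<xi>) = (\<Sum>j\<in>UNIV. 2 - (character (unit_vec j) \<xi> + character (- unit_vec j) \<xi>))"
proof -
  have 1: "(\<Sum>i\<in>UNIV. real_of_int (unit_vec j $ i) * \<xi> $ i) = \<xi> $ j" for j
    by (simp add: unit_vec_def axis_def if_distrib[of real_of_int] if_distrib[of "\<lambda>x. x * _"] sum.delta cong: if_cong)
  have "complex_of_real (4 * (sin (pi * \<xi> $ j))\<^sup>2) = 2 - (character (unit_vec j) \<xi> + character (- unit_vec j) \<xi>)" for j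
  proof -
    have s: "4 * (sin (pi * \<xi> $ j))\<^sup>2 = 2 - 2 * cos (2 * pi * \<xi> $ j)"
      using cos_double_sin[of "pi * \<xi> $ j"] by (simp add: mult.assoc)
    show ?thesis unfolding s character_uminus unfolding character_def 1
      by (simp add: complex_eq_iff)
  qed
  then show ?thesis by (simp add: laplace_symbol_def sum_distrib_left)
qed

definition resolvent_kernel :: "complex \<Rightarrow> int ^ 'd \<Rightarrow> complex" where
  "resolvent_kernel z n = integral cube (\<lambda>\<xi>. character n \<xi> / (complex_of_real (laplace_symbol \<xi>) - z))"

definition ket :: "'a \<Rightarrow> 'a ell2" where "ket k = ell2_of (\<lambda>n. if n = k then 1 else 0)"

lemma coord_ket [simp]: "coord (ket k) n = (if n = k then 1 else 0)"
proof -
  have "(\<lambda>n. if n = k then 1 else 0 :: complex) \<in> lp_space 2"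
  proof (rule ell2_boundI(1)[of _ 1])
    fix A :: "'a set" assume "finite A"
    then have "(\<Sum>n\<in>A. (cmod (if n = k then 1 else 0))\<^sup>2) = (if k \<in> A then 1 else 0)"
      by (simp add: if_distrib[of cmod] if_distrib[of "\<lambda>x. x\<^sup>2"] cong: if_cong)
    then show "(\<Sum>n\<in>A. (cmod (if n = k then 1 else 0))\<^sup>2) \<le> 1\<^sup>2" by simp
  qed
  then show ?thesis by (simp add: ket_def ell2_of_inverse)
qed

lemma symbol_minus_nz: "Im z \<noteq> 0 \<Longrightarrow> complex_of_real r - z \<noteq> 0"
  by (auto simp: complex_eq_iff)

text \<open>The translated kernel is square summable by Bessel, and it solves the equation with a
  point mass on the right because the shifts multiply \<open>character\<close> by characters that
  add up to the symbol. Uniqueness of the resolvent identifies it.\<close>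

lemma coord_resolvent_ket:
  fixes k :: "int ^ 'd::finite"
  assumes z: "Im z \<noteq> 0"
  shows "coord (resolvent lattice_laplacian z (ket k)) m = resolvent_kernel z (m - k)"
proof -
  have nz: "complex_of_real (laplace_symbol \<xi>) - z \<noteq> 0" for \<xi> :: "real ^ 'd"
    using z by (rule symbol_minus_nz)
  let ?G = "\<lambda>\<xi> :: real ^ 'd. 1 / (complex_of_real (laplace_symbol \<xi>) - z)"
  have contG: "continuous_on UNIV ?G" by (intro continuous_intros) (use nz in auto)
  have rk: "resolvent_kernel z (m - k) = integral cube (\<lambda>\<xi>. ?G \<xi> * cnj (character (k - m) \<xi>))" for m
    unfolding resolvent_kernel_def by (simp add: character_uminus[symmetric])
  define B where "B = integral cube (\<lambda>\<xi>. (cmod (?G \<xi>))\<^sup>2)"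
  have B0: "B \<ge> 0" unfolding B_def by (intro integral_nonneg cube_integrable continuous_intros contG) auto
  have l2: "(\<lambda>m. resolvent_kernel z (m - k)) \<in> lp_space 2"
  proof (rule ell2_boundI(1)[where B = "sqrt B"])
    fix A :: "(int ^ 'd) set" assume A: "finite A"
    have "(\<Sum>m\<in>A. (cmod (resolvent_kernel z (m - k)))\<^sup>2)
        = (\<Sum>n\<in>(\<lambda>m. k - m) ` A. (cmod (integral cube (\<lambda>\<xi>. ?G \<xi> * cnj (character n \<xi>))))\<^sup>2)"
      unfolding rk by (subst sum.reindex) (auto simp: inj_on_def)
    also have "\<dots> \<le> B" unfolding B_def using A by (intro bessel_inequality contG) auto
    finally show "(\<Sum>m\<in>A. (cmod (resolvent_kernel z (m - k)))\<^sup>2) \<le> (sqrt B)\<^sup>2" using B0 by simp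
  qed
  define u where "u = ell2_of (\<lambda>m. resolvent_kernel z (m - k))"
  have u: "coord u m = resolvent_kernel z (m - k)" for m
    unfolding u_def using l2 by (simp add: ell2_of_inverse)
  have int: "(\<lambda>\<xi>. character n \<xi> / (complex_of_real (laplace_symbol \<xi>) - z)) integrable_on cube" for n :: "int ^ 'd"
    by (intro cube_integrable continuous_intros) (use nz in auto)
  have "lattice_laplacian u - z *\<^sub>C u = ket k"
  proof (rule ell2_eqI)
    fix m
    let ?c = "\<lambda>n \<xi>. character n \<xi> / (complex_of_real (laplace_symbol \<xi>) - z)"
    have "coord (lattice_laplacian u - z *\<^sub>C u) m
       = (\<Sum>j\<in>UNIV. 2 * integral cube (?c (m - k)) - (integral cube (?c (m - k + unit_vec j)) + integral cube (?c (m - k - unit_vec j))))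
         - z * integral cube (?c (m - k))"
      by (simp add: coord_lattice_laplacian u resolvent_kernel_def algebra_simps)
    also have "\<dots> = integral cube (\<lambda>\<xi>. (\<Sum>j\<in>UNIV. 2 * ?c (m - k) \<xi> - (?c (m - k + unit_vec j) \<xi> + ?c (m - k - unit_vec j) \<xi>)) - z * ?c (m - k) \<xi>)"
    proof (rule integral_unique[symmetric])
      show "((\<lambda>\<xi>. (\<Sum>j\<in>UNIV. 2 * ?c (m - k) \<xi> - (?c (m - k + unit_vec j) \<xi> + ?c (m - k - unit_vec j) \<xi>)) - z * ?c (m - k) \<xi>) has_integral
          ((\<Sum>j\<in>UNIV. 2 * integral cube (?c (m - k)) - (integral cube (?c (m - k + unit_vec j)) + integral cube (?c (m - k - unit_vec j))))
         - z * integral cube (?c (m - k)))) cube"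
        by (intro has_integral_diff has_integral_sum has_integral_add has_integral_mult_right integrable_integral int) auto
    qed
    also have "\<dots> = integral cube (character (m - k))"
    proof (rule integral_cong)
      fix \<xi> :: "real ^ 'd"
      have "(\<Sum>j\<in>UNIV. 2 * ?c (m - k) \<xi> - (?c (m - k + unit_vec j) \<xi> + ?c (m - k - unit_vec j) \<xi>)) - z * ?c (m - k) \<xi>
          = ((\<Sum>j\<in>UNIV. 2 - (character (unit_vec j) \<xi> + character (- unit_vec j) \<xi>)) - z) * ?c (m - k) \<xi>"
      proof -
        have t: "?c (m - k + unit_vec j) \<xi> = character (unit_vec j) \<xi> * ?c (m - k) \<xi>"
          "?c (m - k - unit_vec j) \<xi> = character (- unit_vec j) \<xi> * ?c (m - k) \<xi>" for j
          using character_add[of "m - k" "unit_vec j" \<xi>] character_add[of "m - k" "- unit_vec j" \<xi>] by simp_all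
        show ?thesis unfolding t by (simp only: left_diff_distrib sum_distrib_right distrib_right)
      qed
      also have "\<dots> = character (m - k) \<xi>"
        unfolding laplace_symbol_character[symmetric] using nz by simp
      finally show "(\<Sum>j\<in>UNIV. 2 * ?c (m - k) \<xi> - (?c (m - k + unit_vec j) \<xi> + ?c (m - k - unit_vec j) \<xi>)) - z * ?c (m - k) \<xi>
          = character (m - k) \<xi>" .
    qed
    also have "\<dots> = coord (ket k) m" by (simp add: integral_character)
    finally show "coord (lattice_laplacian u - z *\<^sub>C u) m = coord (ket k) m" .
  qed
  then have "resolvent lattice_laplacian z (ket k) = u" by (rule L.resolvent_unique[OF z])
  then show ?thesis by (simp add: u)
qed

section \<open>The discrete Laplacian as a difference operator\<close>

definition fourier_sum :: "(int ^ 'd \<Rightarrow> complex) \<Rightarrow> (int ^ 'd) set \<Rightarrow> real ^ 'd \<Rightarrow> complex" where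
  "fourier_sum f A \<xi> = (\<Sum>n\<in>A. f n * cnj (character n \<xi>))"

lemma fourier_transform_iff:
  "fourier_transform f F \<longleftrightarrow> f \<in> lp_space 2 \<and> F \<in> torus_L2 \<and>
     ((\<lambda>A. LINT \<xi>|lebesgue_on torus. (cmod (F \<xi> - fourier_sum f A \<xi>))\<^sup>2) \<longlongrightarrow> 0) (finite_subsets_at_top UNIV)"
  by (simp add: fourier_transform_def fourier_sum_def character_def cis_cnj)

lemma continuous_on_fourier_sum [continuous_intros]: "continuous_on S (fourier_sum f A)"
  unfolding fourier_sum_def by (intro continuous_intros)

lemma fourier_sum_parseval:
  fixes f :: "int ^ 'd::finite \<Rightarrow> complex"
  assumes "finite A"
  shows "(LINT \<xi>|lebesgue_on torus. (cmod (fourier_sum f A \<xi>))\<^sup>2) = (\<Sum>n\<in>A. (cmod (f n))\<^sup>2)"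
proof -
  have e: "fourier_sum f A \<xi> = trig_poly (uminus ` A) (\<lambda>n. f (- n)) \<xi>" for \<xi>
    by (simp add: fourier_sum_def trig_poly_def sum.reindex inj_on_def character_uminus)
  have "(LINT \<xi>|lebesgue_on torus. (cmod (fourier_sum f A \<xi>))\<^sup>2) = integral cube (\<lambda>\<xi>. (cmod (fourier_sum f A \<xi>))\<^sup>2)"
    by (intro continuous_integrable_torus(2) continuous_intros)
  also have "\<dots> = (\<Sum>n\<in>uminus ` A. (cmod (f (- n)))\<^sup>2)"
    unfolding e using assms by (intro trig_poly_parseval) auto
  also have "\<dots> = (\<Sum>n\<in>A. (cmod (f n))\<^sup>2)" by (simp add: sum.reindex inj_on_def)
  finally show ?thesis .
qed

lemma fourier_sum_diff:
  "finite B \<Longrightarrow> A \<subseteq> B \<Longrightarrow> fourier_sum f B \<xi> - fourier_sum f A \<xi> = fourier_sum f (B - A) \<xi>"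
  unfolding fourier_sum_def by (simp add: sum_diff finite_subset)

lemma measurable_continuous_torus:
  fixes f :: "real ^ 'd::finite \<Rightarrow> complex"
  assumes "continuous_on UNIV f"
  shows "f \<in> borel_measurable (lebesgue_on torus)"
proof -
  have "f \<in> borel_measurable lborel"
    using borel_measurable_continuous_onI[OF assms] by simp
  then have "f \<in> borel_measurable lebesgue" by (rule measurable_completion)
  then show ?thesis by (rule measurable_restrict_space1)
qed

lemma finite_measure_torus: "finite_measure (lebesgue_on (torus :: (real ^ 'd::finite) set))"
proof
  have "emeasure lebesgue (torus :: (real ^ 'd) set) \<le> emeasure lebesgue (cube :: (real ^ 'd) set)"
    by (rule emeasure_mono[OF torus_subset_cube]) (simp add: cube_def)
  also have "\<dots> = emeasure lborel (cube :: (real ^ 'd) set)" by (simp add: cube_def)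
  also have "\<dots> < \<infinity>" by (rule emeasure_compact_finite[OF compact_cube])
  finally show "emeasure (lebesgue_on (torus :: (real ^ 'd) set)) (space (lebesgue_on torus)) \<noteq> \<infinity>"
    by (simp add: emeasure_restrict_space torus_lebesgue)
qed

lemma square_add_le: "(cmod (x + y))\<^sup>2 \<le> 2 * (cmod x)\<^sup>2 + 2 * (cmod y)\<^sup>2"
proof -
  have "(cmod (x + y))\<^sup>2 \<le> (cmod x + cmod y)\<^sup>2" by (intro power_mono norm_triangle_ineq) auto
  also have "\<dots> \<le> 2 * (cmod x)\<^sup>2 + 2 * (cmod y)\<^sup>2"
    using sum_squares_bound[of "cmod x" "cmod y"] by (simp add: power2_sum)
  finally show ?thesis .
qed

lemma torus_L2_add: "F \<in> torus_L2 \<Longrightarrow> G \<in> torus_L2 \<Longrightarrow> (\<lambda>\<xi>. F \<xi> + G \<xi>) \<in> torus_L2"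
proof -
  assume F: "F \<in> torus_L2" and G: "G \<in> torus_L2"
  then have [measurable]: "F \<in> borel_measurable (lebesgue_on torus)" "G \<in> borel_measurable (lebesgue_on torus)"
    by (auto simp: torus_L2_def)
  have "integrable (lebesgue_on torus) (\<lambda>\<xi>. 2 * (cmod (F \<xi>))\<^sup>2 + 2 * (cmod (G \<xi>))\<^sup>2)"
    using F G by (auto simp: torus_L2_def)
  then have "integrable (lebesgue_on torus) (\<lambda>\<xi>. (cmod (F \<xi> + G \<xi>))\<^sup>2)"
    by (rule Bochner_Integration.integrable_bound) (auto intro!: square_add_le)
  then show ?thesis by (simp add: torus_L2_def)
qed

lemma torus_L2_mult:
  fixes c F :: "real ^ 'd::finite \<Rightarrow> complex"
  assumes "F \<in> torus_L2" "continuous_on UNIV c" "\<And>\<xi>. cmod (c \<xi>) \<le> K"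
  shows "(\<lambda>\<xi>. c \<xi> * F \<xi>) \<in> torus_L2"
proof -
  have [measurable]: "F \<in> borel_measurable (lebesgue_on torus)" "c \<in> borel_measurable (lebesgue_on torus)"
    using assms by (auto simp: torus_L2_def intro: measurable_continuous_torus)
  have "integrable (lebesgue_on torus) (\<lambda>\<xi>. K\<^sup>2 * (cmod (F \<xi>))\<^sup>2)"
    using assms by (auto simp: torus_L2_def)
  then have "integrable (lebesgue_on torus) (\<lambda>\<xi>. (cmod (c \<xi> * F \<xi>))\<^sup>2)"
    by (rule Bochner_Integration.integrable_bound)
       (auto simp: norm_mult power_mult_distrib intro!: mult_right_mono power_mono assms)
  then show ?thesis by (simp add: torus_L2_def)
qed

lemma torus_L2_continuous:
  fixes F :: "real ^ 'd::finite \<Rightarrow> complex"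
  assumes "continuous_on UNIV F"
  shows "F \<in> torus_L2"
  unfolding torus_L2_def
  using assms by (auto intro!: measurable_continuous_torus continuous_integrable_torus(1) continuous_intros
      intro: continuous_on_subset)

lemma torus_L2_diff: "F \<in> torus_L2 \<Longrightarrow> G \<in> torus_L2 \<Longrightarrow> (\<lambda>\<xi>. F \<xi> - G \<xi>) \<in> torus_L2" for F G :: "real ^ 'd::finite \<Rightarrow> complex"
  using torus_L2_add[of F "\<lambda>\<xi>. - 1 * G \<xi>"] torus_L2_mult[of G "\<lambda>_. - 1" 1] by simp

lemma torus_L2_square_integrable: "F \<in> torus_L2 \<Longrightarrow> integrable (lebesgue_on torus) (\<lambda>\<xi>. (cmod (F \<xi>))\<^sup>2)"
  by (simp add: torus_L2_def)

lemma torus_L2_fourier_sum: "fourier_sum f A \<in> torus_L2" for f :: "int ^ 'd::finite \<Rightarrow> complex"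
  by (intro torus_L2_continuous continuous_intros)

lemma torus_L2_add_integral_le:
  fixes F G :: "real ^ 'd::finite \<Rightarrow> complex"
  assumes "F \<in> torus_L2" "G \<in> torus_L2"
  shows "(LINT \<xi>|lebesgue_on torus. (cmod (F \<xi> + G \<xi>))\<^sup>2)
    \<le> 2 * (LINT \<xi>|lebesgue_on torus. (cmod (F \<xi>))\<^sup>2) + 2 * (LINT \<xi>|lebesgue_on torus. (cmod (G \<xi>))\<^sup>2)"
proof -
  have "(LINT \<xi>|lebesgue_on torus. (cmod (F \<xi> + G \<xi>))\<^sup>2)
      \<le> (LINT \<xi>|lebesgue_on torus. 2 * (cmod (F \<xi>))\<^sup>2 + 2 * (cmod (G \<xi>))\<^sup>2)"
    using assms torus_L2_add[OF assms]
    by (intro integral_mono square_add_le) (auto intro!: Bochner_Integration.integrable_add torus_L2_square_integrable)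
  also have "\<dots> = 2 * (LINT \<xi>|lebesgue_on torus. (cmod (F \<xi>))\<^sup>2) + 2 * (LINT \<xi>|lebesgue_on torus. (cmod (G \<xi>))\<^sup>2)"
    using assms by (simp add: torus_L2_square_integrable)
  finally show ?thesis .
qed

text \<open>The elementary |F| \<le> |F|^2 / c + c stands in for Cauchy-Schwarz; the free c lets
  each use balance the two terms.\<close>

lemma torus_L2_integrable:
  fixes F :: "real ^ 'd::finite \<Rightarrow> complex"
  assumes F: "F \<in> torus_L2" and c: "c > 0"
  shows "integrable (lebesgue_on torus) F"
    and "(LINT \<xi>|lebesgue_on torus. cmod (F \<xi>)) \<le> (1 / c) * (LINT \<xi>|lebesgue_on torus. (cmod (F \<xi>))\<^sup>2) + c * measure lebesgue (torus :: (real ^ 'd) set)"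
proof -
  interpret finite_measure "lebesgue_on (torus :: (real ^ 'd) set)" by (rule finite_measure_torus)
  have b: "cmod x \<le> (1 / c) * (cmod x)\<^sup>2 + c" for x
  proof -
    have "2 * cmod x * c \<le> (cmod x)\<^sup>2 + c\<^sup>2" by (rule sum_squares_bound)
    moreover have "0 \<le> cmod x * c" using c by simp
    ultimately have "cmod x * c \<le> (cmod x)\<^sup>2 + c\<^sup>2" by linarith
    then show ?thesis using c by (simp add: field_simps power2_eq_square)
  qed
  have i: "integrable (lebesgue_on torus) (\<lambda>\<xi>. (1 / c) * (cmod (F \<xi>))\<^sup>2 + c)"
    using F by (auto intro!: torus_L2_square_integrable)
  have "F \<in> borel_measurable (lebesgue_on torus)" using F by (simp add: torus_L2_def)
  then show iF: "integrable (lebesgue_on torus) F"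
    using i by (intro Bochner_Integration.integrable_bound[OF i]) (auto intro!: AE_I2 order_trans[OF b] abs_ge_self)
  have "(LINT \<xi>|lebesgue_on torus. cmod (F \<xi>)) \<le> (LINT \<xi>|lebesgue_on torus. (1 / c) * (cmod (F \<xi>))\<^sup>2 + c)"
    using iF i b by (intro integral_mono) auto
  also have "\<dots> = (1 / c) * (LINT \<xi>|lebesgue_on torus. (cmod (F \<xi>))\<^sup>2) + c * measure lebesgue (torus :: (real ^ 'd) set)"
    using F by (simp add: torus_L2_square_integrable measure_restrict_space torus_lebesgue)
  finally show "(LINT \<xi>|lebesgue_on torus. cmod (F \<xi>)) \<le> (1 / c) * (LINT \<xi>|lebesgue_on torus. (cmod (F \<xi>))\<^sup>2) + c * measure lebesgue (torus :: (real ^ 'd) set)" .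
qed

text \<open>Riesz--Fischer: a rapidly converging subsequence of the partial sums converges almost everywhere.\<close>
lemma fourier_transform_exists:
  fixes f :: "int ^ 'd::finite \<Rightarrow> complex"
  assumes f: "f \<in> lp_space 2"
  shows "\<exists>F. fourier_transform f F"
proof -
  let ?\<mu> = "lebesgue_on (torus :: (real ^ 'd) set)"
  interpret finite_measure ?\<mu> by (rule finite_measure_torus)
  have sq: "(\<lambda>n. (cmod (f n))\<^sup>2) summable_on UNIV" using f by (simp add: lp_space_2_iff)
  define N where "N = (\<Sum>\<^sub>\<infinity>n. (cmod (f n))\<^sup>2)"
  \<comment> \<open>Tails of size 4^(-k) make consecutive partial sums 2^(-k)-close in L^2, hence
    summably close in L^1.\<close>
  have "\<exists>A. finite A \<and> N - (1 / 4) ^ k \<le> (\<Sum>n\<in>A. (cmod (f n))\<^sup>2)" for k :: nat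
  proof -
    have "((\<lambda>A. \<Sum>n\<in>A. (cmod (f n))\<^sup>2) \<longlongrightarrow> N) (finite_subsets_at_top UNIV)"
      unfolding N_def by (rule infsum_tendsto[OF sq])
    then have "\<forall>\<^sub>F A in finite_subsets_at_top UNIV. N - (1 / 4) ^ k < (\<Sum>n\<in>A. (cmod (f n))\<^sup>2)"
      by (rule order_tendstoD) simp
    then show ?thesis unfolding eventually_finite_subsets_at_top by (meson less_imp_le order_refl subset_UNIV)
  qed
  then obtain A0 where A0: "\<And>k. finite (A0 k)" "\<And>k. N - (1 / 4) ^ k \<le> (\<Sum>n\<in>A0 k. (cmod (f n))\<^sup>2)" by metis
  define A where "A k = (\<Union>i\<le>k. A0 i)" for k
  have A: "finite (A k)" for k using A0 by (simp add: A_def)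
  have Amono: "A k \<subseteq> A m" if "k \<le> m" for k m using that unfolding A_def by fastforce
  have tail: "(\<Sum>n\<in>B - A k. (cmod (f n))\<^sup>2) \<le> (1 / 4) ^ k" if B: "finite B" "A k \<subseteq> B" for B k
  proof -
    have "(\<Sum>n\<in>A0 k. (cmod (f n))\<^sup>2) \<le> (\<Sum>n\<in>A k. (cmod (f n))\<^sup>2)" by (intro sum_mono2 A) (auto simp: A_def)
    moreover have "(\<Sum>n\<in>B. (cmod (f n))\<^sup>2) \<le> N" unfolding N_def using B by (intro finite_sum_le_infsum sq) auto
    moreover have "(\<Sum>n\<in>B - A k. (cmod (f n))\<^sup>2) = (\<Sum>n\<in>B. (cmod (f n))\<^sup>2) - (\<Sum>n\<in>A k. (cmod (f n))\<^sup>2)"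
      using B by (rule sum_diff)
    ultimately show ?thesis using A0(2)[of k] by linarith
  qed
  define S where "S k = fourier_sum f (A k)" for k
  have Sm [measurable]: "S k \<in> borel_measurable ?\<mu>" for k
    unfolding S_def by (intro measurable_continuous_torus continuous_intros)
  have SL: "S k \<in> torus_L2" for k unfolding S_def by (rule torus_L2_fourier_sum)
  have close: "(LINT \<xi>|?\<mu>. (cmod (fourier_sum f B \<xi> - S k \<xi>))\<^sup>2) \<le> (1 / 4) ^ k" if B: "finite B" "A k \<subseteq> B" for B k
  proof -
    have e: "fourier_sum f B \<xi> - S k \<xi> = fourier_sum f (B - A k) \<xi>" for \<xi>
      unfolding S_def using B by (rule fourier_sum_diff)
    show ?thesis unfolding e using B tail[OF B] by (subst fourier_sum_parseval) auto
  qed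
  have closeS: "(LINT \<xi>|?\<mu>. (cmod (S m \<xi> - S k \<xi>))\<^sup>2) \<le> (1 / 4) ^ k" if "k \<le> m" for k m
    unfolding S_def[of m] using A Amono[OF that] by (rule close)
  define D where "D k \<xi> = S (Suc k) \<xi> - S k \<xi>" for k \<xi>
  have DL: "D k \<in> torus_L2" for k unfolding D_def by (intro torus_L2_diff SL)
  have Dm [measurable]: "D k \<in> borel_measurable ?\<mu>" for k unfolding D_def by measurable
  define M where "M = 1 + measure lebesgue (torus :: (real ^ 'd) set)"
  \<comment> \<open>The parameter c = 2^(-k) balances 4^(-k) / c against c.\<close>
  have Dint: "(LINT \<xi>|?\<mu>. cmod (D k \<xi>)) \<le> M * (1 / 2) ^ k" for k
  proof -
    have "(LINT \<xi>|?\<mu>. cmod (D k \<xi>)) \<le> (1 / (1 / 2) ^ k) * (LINT \<xi>|?\<mu>. (cmod (D k \<xi>))\<^sup>2) + (1 / 2) ^ k * measure lebesgue (torus :: (real ^ 'd) set)"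
      by (rule torus_L2_integrable(2)[OF DL]) simp
    also have "\<dots> \<le> (1 / (1 / 2) ^ k) * (1 / 4) ^ k + (1 / 2) ^ k * measure lebesgue (torus :: (real ^ 'd) set)"
      using closeS[of k "Suc k"] by (intro add_right_mono mult_left_mono) (auto simp: D_def)
    also have "(1 / (1 / 2) ^ k) * (1 / 4) ^ k = (1 / 2 :: real) ^ k"
      by (simp add: power_divide field_simps power_mult_distrib[symmetric])
    finally show ?thesis by (simp add: M_def algebra_simps)
  qed
  have "(\<integral>\<^sup>+\<xi>. (\<Sum>k. ennreal (cmod (D k \<xi>))) \<partial>?\<mu>) = (\<Sum>k. \<integral>\<^sup>+\<xi>. ennreal (cmod (D k \<xi>)) \<partial>?\<mu>)"
    by (rule nn_integral_suminf) measurable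
  also have "\<dots> \<le> (\<Sum>k. ennreal (M * (1 / 2) ^ k))"
  proof (intro suminf_le summableI)
    fix k
    have "(\<integral>\<^sup>+\<xi>. ennreal (cmod (D k \<xi>)) \<partial>?\<mu>) = ennreal (LINT \<xi>|?\<mu>. cmod (D k \<xi>))"
      using torus_L2_integrable(1)[OF DL, of 1] by (intro nn_integral_eq_integral) auto
    then show "(\<integral>\<^sup>+\<xi>. ennreal (cmod (D k \<xi>)) \<partial>?\<mu>) \<le> ennreal (M * (1 / 2) ^ k)" using Dint[of k] by (simp add: ennreal_leI)
  qed
  also have "\<dots> < \<infinity>"
  proof -
    have "summable (\<lambda>k. M * (1 / 2 :: real) ^ k)" by (intro summable_mult summable_geometric) simp
    then show ?thesis by (subst suminf_ennreal2) (auto simp: M_def)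
  qed
  finally have "AE \<xi> in ?\<mu>. (\<Sum>k. ennreal (cmod (D k \<xi>))) \<noteq> \<infinity>"
    by (intro nn_integral_PInf_AE) auto
  then have conv: "AE \<xi> in ?\<mu>. convergent (\<lambda>k. S k \<xi>)"
  proof eventually_elim
    case (elim \<xi>)
    then have "summable (\<lambda>k. cmod (D k \<xi>))" by (intro summable_suminf_not_top) auto
    then have "summable (\<lambda>k. D k \<xi>)" by (rule summable_norm_cancel)
    then have "convergent (\<lambda>n. \<Sum>k<n. D k \<xi>)" by (simp add: summable_iff_convergent)
    moreover have "(\<Sum>k<n. D k \<xi>) = S n \<xi> - S 0 \<xi>" for n
      unfolding D_def by (rule sum_lessThan_telescope)
    ultimately have "convergent (\<lambda>n. S n \<xi> - S 0 \<xi>)" by simp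
    from convergent_add[OF this convergent_const[of "S 0 \<xi>"]] show ?case by simp
  qed
  define F where "F \<xi> = lim (\<lambda>k. S k \<xi>)" for \<xi>
  have Fm [measurable]: "F \<in> borel_measurable ?\<mu>" unfolding F_def by measurable
  \<comment> \<open>Only convergence almost everywhere is known so far; Fatou's lemma transfers the
    uniform L^2 bounds to the limit.\<close>
  have fatou: "(\<integral>\<^sup>+\<xi>. ennreal ((cmod (F \<xi> - S k \<xi>))\<^sup>2) \<partial>?\<mu>) \<le> ennreal ((1 / 4) ^ k)" for k
  proof -
    have "(\<integral>\<^sup>+\<xi>. ennreal ((cmod (F \<xi> - S k \<xi>))\<^sup>2) \<partial>?\<mu>) = (\<integral>\<^sup>+\<xi>. liminf (\<lambda>m. ennreal ((cmod (S m \<xi> - S k \<xi>))\<^sup>2)) \<partial>?\<mu>)"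
      using conv
    proof (intro nn_integral_cong_AE, eventually_elim)
      case (elim \<xi>)
      then have "(\<lambda>m. S m \<xi>) \<longlonglongrightarrow> F \<xi>" by (simp add: F_def convergent_LIMSEQ_iff)
      then have "(\<lambda>m. ennreal ((cmod (S m \<xi> - S k \<xi>))\<^sup>2)) \<longlonglongrightarrow> ennreal ((cmod (F \<xi> - S k \<xi>))\<^sup>2)"
        by (intro tendsto_intros)
      then show ?case by (rule lim_imp_Liminf[symmetric, OF sequentially_bot])
    qed
    also have "\<dots> \<le> liminf (\<lambda>m. \<integral>\<^sup>+\<xi>. ennreal ((cmod (S m \<xi> - S k \<xi>))\<^sup>2) \<partial>?\<mu>)"
      by (rule nn_integral_liminf) measurable
    also have "\<dots> \<le> ennreal ((1 / 4) ^ k)"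
    proof (rule Liminf_le)
      have "(\<integral>\<^sup>+\<xi>. ennreal ((cmod (S m \<xi> - S k \<xi>))\<^sup>2) \<partial>?\<mu>) \<le> ennreal ((1 / 4) ^ k)" if "m \<ge> k" for m
      proof -
        have "(\<integral>\<^sup>+\<xi>. ennreal ((cmod (S m \<xi> - S k \<xi>))\<^sup>2) \<partial>?\<mu>) = ennreal (LINT \<xi>|?\<mu>. (cmod (S m \<xi> - S k \<xi>))\<^sup>2)"
          by (intro nn_integral_eq_integral torus_L2_square_integrable torus_L2_diff SL) auto
        then show ?thesis using closeS[OF that] by (simp add: ennreal_leI)
      qed
      then show "\<forall>\<^sub>F m in sequentially. (\<integral>\<^sup>+\<xi>. ennreal ((cmod (S m \<xi> - S k \<xi>))\<^sup>2) \<partial>?\<mu>) \<le> ennreal ((1 / 4) ^ k)"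
        by (auto simp: eventually_sequentially)
    qed simp
    finally show ?thesis .
  qed
  have FS: "(\<lambda>\<xi>. F \<xi> - S k \<xi>) \<in> torus_L2" for k
    using order.strict_trans1[OF fatou[of k] ennreal_less_top]
    by (auto simp: torus_L2_def intro!: integrableI_nonneg)
  then have FL: "F \<in> torus_L2" using torus_L2_add[OF FS[of 0] SL[of 0]] by simp
  have FSint: "(LINT \<xi>|?\<mu>. (cmod (F \<xi> - S k \<xi>))\<^sup>2) \<le> (1 / 4) ^ k" for k
    using nn_integral_eq_integral[OF torus_L2_square_integrable[OF FS[of k]]] fatou[of k] by simp
  have "((\<lambda>B. LINT \<xi>|?\<mu>. (cmod (F \<xi> - fourier_sum f B \<xi>))\<^sup>2) \<longlongrightarrow> 0) (finite_subsets_at_top UNIV)"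
  proof (rule tendstoI)
    fix e :: real assume e: "e > 0"
    obtain k where k: "(1 / 4 :: real) ^ k < e / 4" using real_arch_pow_inv[of "e / 4" "1 / 4"] e by auto
    have "(LINT \<xi>|?\<mu>. (cmod (F \<xi> - fourier_sum f B \<xi>))\<^sup>2) < e" if B: "finite B" "A k \<subseteq> B" for B
    proof -
      have "(LINT \<xi>|?\<mu>. (cmod ((F \<xi> - S k \<xi>) + (S k \<xi> - fourier_sum f B \<xi>)))\<^sup>2)
         \<le> 2 * (LINT \<xi>|?\<mu>. (cmod (F \<xi> - S k \<xi>))\<^sup>2) + 2 * (LINT \<xi>|?\<mu>. (cmod (S k \<xi> - fourier_sum f B \<xi>))\<^sup>2)"
        by (intro torus_L2_add_integral_le FS torus_L2_diff SL torus_L2_fourier_sum)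
      also have "\<dots> \<le> 2 * (1 / 4) ^ k + 2 * (1 / 4) ^ k"
        using FSint[of k] close[OF B] by (intro add_mono mult_left_mono) (auto simp: norm_minus_commute)
      also have "\<dots> < e" using k by simp
      finally show ?thesis by simp
    qed
    then show "\<forall>\<^sub>F B in finite_subsets_at_top UNIV. dist (LINT \<xi>|?\<mu>. (cmod (F \<xi> - fourier_sum f B \<xi>))\<^sup>2) 0 < e"
      unfolding eventually_finite_subsets_at_top using A[of k] by (intro exI[of _ "A k"]) (auto simp: dist_norm)
  qed
  then show ?thesis using f FL by (auto simp: fourier_transform_iff)
qed

text \<open>Coefficients are continuous in L^2, and partial sums whose index set contains n have
  coefficient f n by orthogonality. A sequence is thus determined by any representative of its
  transform, which gives uniqueness for the \<open>THE\<close> in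
  \<open>fourier_multiplier\<close>.\<close>

lemma fourier_coefficient:
  fixes f :: "int ^ 'd::finite \<Rightarrow> complex"
  assumes F: "fourier_transform f F"
  shows "(LINT \<xi>|lebesgue_on torus. character n \<xi> * F \<xi>) = f n"
proof -
  let ?\<mu> = "lebesgue_on (torus :: (real ^ 'd) set)"
  let ?m = "measure lebesgue (torus :: (real ^ 'd) set)"
  have FL: "F \<in> torus_L2" and lim: "((\<lambda>A. LINT \<xi>|?\<mu>. (cmod (F \<xi> - fourier_sum f A \<xi>))\<^sup>2) \<longlongrightarrow> 0) (finite_subsets_at_top UNIV)"
    using F by (auto simp: fourier_transform_iff)
  have int: "integrable ?\<mu> (\<lambda>\<xi>. character n \<xi> * G \<xi>)" if "G \<in> torus_L2" for G
    by (rule torus_L2_integrable(1)[OF torus_L2_mult[where c = "character n" and K = 1, OF that], of 1]) (auto intro: continuous_intros)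
  have coeff: "(LINT \<xi>|?\<mu>. character n \<xi> * fourier_sum f A \<xi>) = f n" if "finite A" "n \<in> A" for A
  proof -
    have "(LINT \<xi>|?\<mu>. character n \<xi> * fourier_sum f A \<xi>) = integral cube (\<lambda>\<xi>. character n \<xi> * fourier_sum f A \<xi>)"
      by (intro continuous_integrable_torus continuous_intros)
    also have "\<dots> = integral cube (\<lambda>\<xi>. \<Sum>m\<in>A. f m * character (n - m) \<xi>)"
      by (simp add: fourier_sum_def sum_distrib_left character_diff mult_ac)
    also have "\<dots> = (\<Sum>m\<in>A. integral cube (\<lambda>\<xi>. f m * character (n - m) \<xi>))"
      by (intro integral_sum that cube_integrable continuous_intros)
    also have "\<dots> = (\<Sum>m\<in>A. if m = n then f n else 0)"
      by (intro sum.cong refl) (auto simp: integral_character)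
    finally show ?thesis using that by simp
  qed
  have "cmod ((LINT \<xi>|?\<mu>. character n \<xi> * F \<xi>) - f n) \<le> 0"
  proof (rule field_le_epsilon)
    fix e :: real assume e: "e > 0"
    \<comment> \<open>The measure plus one is safely positive as a denominator.\<close>
    define M where "M = ?m + 1"
    have M: "M > 0" "?m \<le> M" by (auto simp: M_def add_nonneg_pos)
    define c where "c = e / (2 * M)"
    have c: "c > 0" using e M by (simp add: c_def)
    have cm: "c * ?m \<le> e / 2" using mult_left_mono[OF M(2), of c] c M by (simp add: c_def)
    have "\<forall>\<^sub>F A in finite_subsets_at_top UNIV. (LINT \<xi>|?\<mu>. (cmod (F \<xi> - fourier_sum f A \<xi>))\<^sup>2) < c * e / 2"
      by (rule order_tendstoD(2)[OF lim]) (use c e in simp)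
    then obtain X where X: "finite X" "\<And>A. finite A \<Longrightarrow> X \<subseteq> A \<Longrightarrow> (LINT \<xi>|?\<mu>. (cmod (F \<xi> - fourier_sum f A \<xi>))\<^sup>2) < c * e / 2"
      unfolding eventually_finite_subsets_at_top by auto
    let ?A = "insert n X"
    have GL: "(\<lambda>\<xi>. F \<xi> - fourier_sum f ?A \<xi>) \<in> torus_L2" by (intro torus_L2_diff FL torus_L2_fourier_sum)
    have "(LINT \<xi>|?\<mu>. character n \<xi> * F \<xi>) - f n = (LINT \<xi>|?\<mu>. character n \<xi> * F \<xi> - character n \<xi> * fourier_sum f ?A \<xi>)"
      using coeff[of ?A] X int[OF FL] int[OF torus_L2_fourier_sum] by simp
    also have "\<dots> = (LINT \<xi>|?\<mu>. character n \<xi> * (F \<xi> - fourier_sum f ?A \<xi>))" by (simp add: right_diff_distrib)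
    also have "cmod \<dots> \<le> (LINT \<xi>|?\<mu>. cmod (character n \<xi> * (F \<xi> - fourier_sum f ?A \<xi>)))" by (rule integral_norm_bound)
    also have "\<dots> = (LINT \<xi>|?\<mu>. cmod (F \<xi> - fourier_sum f ?A \<xi>))" by (simp add: norm_mult)
    also have "\<dots> \<le> (1 / c) * (LINT \<xi>|?\<mu>. (cmod (F \<xi> - fourier_sum f ?A \<xi>))\<^sup>2) + c * ?m"
      by (rule torus_L2_integrable(2)[OF GL c])
    also have "\<dots> \<le> (1 / c) * (c * e / 2) + e / 2"
      using less_imp_le[OF X(2)[of ?A]] X(1) c cm by (intro add_mono mult_left_mono) auto
    also have "\<dots> = e" using c by simp
    finally show "cmod ((LINT \<xi>|?\<mu>. character n \<xi> * F \<xi>) - f n) \<le> 0 + e" by simp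
  qed
  then show ?thesis by simp
qed

lemma fourier_transform_add:
  fixes f g :: "int ^ 'd::finite \<Rightarrow> complex"
  assumes F: "fourier_transform f F" and G: "fourier_transform g G"
  shows "fourier_transform (\<lambda>n. f n + g n) (\<lambda>\<xi>. F \<xi> + G \<xi>)"
proof -
  let ?\<mu> = "lebesgue_on (torus :: (real ^ 'd) set)"
  note F' = F[unfolded fourier_transform_iff] and G' = G[unfolded fourier_transform_iff]
  have e: "fourier_sum (\<lambda>n. f n + g n) A \<xi> = fourier_sum f A \<xi> + fourier_sum g A \<xi>" for A \<xi>
    by (simp add: fourier_sum_def sum.distrib distrib_right)
  have "((\<lambda>A. 2 * (LINT \<xi>|?\<mu>. (cmod (F \<xi> - fourier_sum f A \<xi>))\<^sup>2) + 2 * (LINT \<xi>|?\<mu>. (cmod (G \<xi> - fourier_sum g A \<xi>))\<^sup>2)) \<longlongrightarrow> 2 * 0 + 2 * 0)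
     (finite_subsets_at_top UNIV)"
    using F' G' by (intro tendsto_intros) auto
  then have "((\<lambda>A. LINT \<xi>|?\<mu>. (cmod ((F \<xi> + G \<xi>) - fourier_sum (\<lambda>n. f n + g n) A \<xi>))\<^sup>2) \<longlongrightarrow> 0) (finite_subsets_at_top UNIV)"
  proof (rule Lim_null_comparison[rotated, OF tendsto_eq_rhs], simp, intro always_eventually allI)
    fix A
    have "(LINT \<xi>|?\<mu>. (cmod ((F \<xi> - fourier_sum f A \<xi>) + (G \<xi> - fourier_sum g A \<xi>)))\<^sup>2)
      \<le> 2 * (LINT \<xi>|?\<mu>. (cmod (F \<xi> - fourier_sum f A \<xi>))\<^sup>2) + 2 * (LINT \<xi>|?\<mu>. (cmod (G \<xi> - fourier_sum g A \<xi>))\<^sup>2)"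
      using F' G' by (intro torus_L2_add_integral_le torus_L2_diff torus_L2_fourier_sum) auto
    then show "norm (LINT \<xi>|?\<mu>. (cmod ((F \<xi> + G \<xi>) - fourier_sum (\<lambda>n. f n + g n) A \<xi>))\<^sup>2)
      \<le> 2 * (LINT \<xi>|?\<mu>. (cmod (F \<xi> - fourier_sum f A \<xi>))\<^sup>2) + 2 * (LINT \<xi>|?\<mu>. (cmod (G \<xi> - fourier_sum g A \<xi>))\<^sup>2)"
      by (simp add: e algebra_simps)
  qed
  then show ?thesis using F' G' by (simp add: fourier_transform_iff lp_space_2_add torus_L2_add)
qed

lemma fourier_transform_scale:
  fixes f :: "int ^ 'd::finite \<Rightarrow> complex"
  assumes F: "fourier_transform f F"
  shows "fourier_transform (\<lambda>n. c * f n) (\<lambda>\<xi>. c * F \<xi>)"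
proof -
  let ?\<mu> = "lebesgue_on (torus :: (real ^ 'd) set)"
  note F' = F[unfolded fourier_transform_iff]
  have e: "(LINT \<xi>|?\<mu>. (cmod (c * F \<xi> - fourier_sum (\<lambda>n. c * f n) A \<xi>))\<^sup>2) = (cmod c)\<^sup>2 * (LINT \<xi>|?\<mu>. (cmod (F \<xi> - fourier_sum f A \<xi>))\<^sup>2)" for A
  proof -
    have "c * F \<xi> - fourier_sum (\<lambda>n. c * f n) A \<xi> = c * (F \<xi> - fourier_sum f A \<xi>)" for \<xi>
      by (simp add: fourier_sum_def sum_distrib_left right_diff_distrib mult_ac)
    then show ?thesis by (simp add: norm_mult power_mult_distrib)
  qed
  have "((\<lambda>A. (cmod c)\<^sup>2 * (LINT \<xi>|?\<mu>. (cmod (F \<xi> - fourier_sum f A \<xi>))\<^sup>2)) \<longlongrightarrow> (cmod c)\<^sup>2 * 0) (finite_subsets_at_top UNIV)"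
    using F' by (intro tendsto_intros) auto
  then show ?thesis
    using F' by (auto simp: fourier_transform_iff e intro!: lp_space_2_mult torus_L2_mult continuous_intros)
qed

lemma fourier_transform_shift:
  fixes f :: "int ^ 'd::finite \<Rightarrow> complex"
  assumes F: "fourier_transform f F"
  shows "fourier_transform (\<lambda>n. f (n + k)) (\<lambda>\<xi>. character k \<xi> * F \<xi>)"
proof -
  let ?\<mu> = "lebesgue_on (torus :: (real ^ 'd) set)"
  note F' = F[unfolded fourier_transform_iff]
  have "(LINT \<xi>|?\<mu>. (cmod (character k \<xi> * F \<xi> - fourier_sum (\<lambda>n. f (n + k)) A \<xi>))\<^sup>2)
     = (LINT \<xi>|?\<mu>. (cmod (F \<xi> - fourier_sum f ((\<lambda>n. n + k) ` A) \<xi>))\<^sup>2)" for A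
  proof -
    have kk: "character k \<xi> * cnj (character k \<xi>) = 1" for \<xi>
      by (simp add: complex_norm_square[symmetric])
    have "character k \<xi> * fourier_sum f ((\<lambda>n. n + k) ` A) \<xi>
        = (\<Sum>n\<in>A. f (n + k) * cnj (character n \<xi>) * (character k \<xi> * cnj (character k \<xi>)))" for \<xi>
      by (simp add: fourier_sum_def sum.reindex inj_on_def character_add sum_distrib_left mult_ac)
    then have "character k \<xi> * F \<xi> - fourier_sum (\<lambda>n. f (n + k)) A \<xi>
        = character k \<xi> * (F \<xi> - fourier_sum f ((\<lambda>n. n + k) ` A) \<xi>)" for \<xi>
      unfolding kk by (simp add: fourier_sum_def right_diff_distrib)
    then show ?thesis by (simp add: norm_mult)
  qed
  moreover have "((\<lambda>A. LINT \<xi>|?\<mu>. (cmod (F \<xi> - fourier_sum f ((\<lambda>n. n + k) ` A) \<xi>))\<^sup>2) \<longlongrightarrow> 0) (finite_subsets_at_top UNIV)"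
  proof -
    \<comment> \<open>A translation permutes the finite sets and so preserves the filter along which
      the partial sums converge.\<close>
    have "surj (\<lambda>n. n + k)" by (rule surjI[where f = "\<lambda>n. n - k"]) simp
    then have "filtermap ((`) (\<lambda>n. n + k)) (finite_subsets_at_top UNIV) = finite_subsets_at_top UNIV"
      by (subst filtermap_image_finite_subsets_at_top) (auto simp: inj_on_def)
    then have "filterlim ((`) (\<lambda>n. n + k)) (finite_subsets_at_top UNIV) (finite_subsets_at_top UNIV)"
      by (simp add: filterlim_def)
    then show ?thesis using F' filterlim_compose by fastforce
  qed
  moreover have "(\<lambda>n. f (n + k)) \<in> lp_space 2"
  proof -
    have "(\<lambda>n. f (n + k)) = coord (shiftop k (ell2_of f))"
      using F' by (intro ext) (simp add: ell2_of_inverse)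
    then show ?thesis by simp
  qed
  ultimately show ?thesis
    using F' by (auto simp: fourier_transform_iff intro!: torus_L2_mult continuous_intros)
qed

lemma fourier_transform_sum:
  fixes f :: "'i \<Rightarrow> int ^ 'd::finite \<Rightarrow> complex"
  assumes "finite I" "\<And>i. i \<in> I \<Longrightarrow> fourier_transform (f i) (F i)"
  shows "fourier_transform (\<lambda>n. \<Sum>i\<in>I. f i n) (\<lambda>\<xi>. \<Sum>i\<in>I. F i \<xi>)"
  using assms
proof (induction I rule: finite_induct)
  case empty
  show ?case
    by (simp add: fourier_transform_iff fourier_sum_def lp_space_2_iff torus_L2_def)
next
  case (insert i I)
  then show ?case using fourier_transform_add[of "f i" "F i" "\<lambda>n. \<Sum>i\<in>I. f i n" "\<lambda>\<xi>. \<Sum>i\<in>I. F i \<xi>"] by simp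
qed

lemma fourier_transform_laplacian:
  fixes f :: "int ^ 'd::finite \<Rightarrow> complex"
  assumes F: "fourier_transform f F"
  shows "fourier_transform (\<lambda>n. \<Sum>j\<in>UNIV. 2 * f n - (f (n + unit_vec j) + f (n - unit_vec j)))
    (\<lambda>\<xi>. complex_of_real (laplace_symbol \<xi>) * F \<xi>)"
proof -
  have "fourier_transform (\<lambda>n. 2 * f n + - 1 * (f (n + unit_vec j) + f (n + - unit_vec j)))
      (\<lambda>\<xi>. 2 * F \<xi> + - 1 * (character (unit_vec j) \<xi> * F \<xi> + character (- unit_vec j) \<xi> * F \<xi>))" for j
    by (intro fourier_transform_add fourier_transform_scale fourier_transform_shift F)
  then have "fourier_transform (\<lambda>n. \<Sum>j\<in>UNIV. 2 * f n + - 1 * (f (n + unit_vec j) + f (n + - unit_vec j)))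
      (\<lambda>\<xi>. \<Sum>j\<in>UNIV. 2 * F \<xi> + - 1 * (character (unit_vec j) \<xi> * F \<xi> + character (- unit_vec j) \<xi> * F \<xi>))"
    by (intro fourier_transform_sum) auto
  moreover have "(\<Sum>j\<in>UNIV. 2 * F \<xi> + - 1 * (character (unit_vec j) \<xi> * F \<xi> + character (- unit_vec j) \<xi> * F \<xi>))
     = complex_of_real (laplace_symbol \<xi>) * F \<xi>" for \<xi>
    unfolding laplace_symbol_character sum_distrib_right by (intro sum.cong refl) (simp add: algebra_simps)
  moreover have "2 * f n + - 1 * (f (n + unit_vec j) + f (n + - unit_vec j)) = 2 * f n - (f (n + unit_vec j) + f (n - unit_vec j))" for n j
    by simp
  ultimately show ?thesis by (simp only:)
qed

text \<open>Existence uses some transform F of f. For uniqueness, a competing g and the difference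
  expression share the representative symbol times G, hence all coefficients.\<close>

lemma discrete_laplacian_eq:
  fixes f :: "int ^ 'd::finite \<Rightarrow> complex"
  assumes f: "f \<in> lp_space 2"
  shows "discrete_laplacian f = (\<lambda>n. \<Sum>j\<in>UNIV. 2 * f n - (f (n + unit_vec j) + f (n - unit_vec j)))"
proof -
  let ?L = "\<lambda>n. \<Sum>j\<in>UNIV. 2 * f n - (f (n + unit_vec j) + f (n - unit_vec j))"
  obtain F where F: "fourier_transform f F" using fourier_transform_exists[OF f] by blast
  show ?thesis
    unfolding discrete_laplacian_def fourier_multiplier_def
  proof (rule the_equality)
    show "\<exists>F. fourier_transform f F \<and> fourier_transform ?L (\<lambda>\<xi>. complex_of_real (laplace_symbol \<xi>) * F \<xi>)"
      using F fourier_transform_laplacian by blast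
  next
    fix g
    assume "\<exists>G. fourier_transform f G \<and> fourier_transform g (\<lambda>\<xi>. complex_of_real (laplace_symbol \<xi>) * G \<xi>)"
    then obtain G where G: "fourier_transform f G" "fourier_transform g (\<lambda>\<xi>. complex_of_real (laplace_symbol \<xi>) * G \<xi>)" by blast
    show "g = ?L"
      using fourier_coefficient[OF G(2)] fourier_coefficient[OF fourier_transform_laplacian[OF G(1)]] by (metis ext)
  qed
qed

lemma discrete_laplacian_coord: "discrete_laplacian (coord x) = coord (lattice_laplacian x)"
  by (simp add: discrete_laplacian_eq coord_lattice_laplacian[abs_def] fun_eq_iff coord_lattice_laplacian)

section \<open>Interpolation\<close>

text \<open>The maximum modulus principle on a rectangle so tall that the horizontal sides
  contribute at most \<epsilon>.\<close>

lemma maximum_principle_strip: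
  fixes f :: "complex \<Rightarrow> complex"
  assumes f: "f holomorphic_on UNIV"
    and left: "\<And>\<zeta>. Re \<zeta> = a \<Longrightarrow> cmod (f \<zeta>) \<le> B" and right: "\<And>\<zeta>. Re \<zeta> = b \<Longrightarrow> cmod (f \<zeta>) \<le> B"
    and decay: "\<And>\<epsilon>. \<epsilon> > 0 \<Longrightarrow> \<exists>R. \<forall>\<zeta>. a \<le> Re \<zeta> \<and> Re \<zeta> \<le> b \<and> R \<le> \<bar>Im \<zeta>\<bar> \<longrightarrow> cmod (f \<zeta>) \<le> \<epsilon>"
    and \<zeta>: "a \<le> Re \<zeta>" "Re \<zeta> \<le> b"
  shows "cmod (f \<zeta>) \<le> B"
proof (rule field_le_epsilon)
  fix \<epsilon> :: real assume \<epsilon>: "\<epsilon> > 0"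
  have B: "0 \<le> B" using left[of "Complex a 0"] norm_ge_zero order_trans by (metis complex.sel(1))
  obtain R0 where R0: "\<And>\<zeta>. a \<le> Re \<zeta> \<Longrightarrow> Re \<zeta> \<le> b \<Longrightarrow> R0 \<le> \<bar>Im \<zeta>\<bar> \<Longrightarrow> cmod (f \<zeta>) \<le> \<epsilon>"
    using decay[OF \<epsilon>] by blast
  \<comment> \<open>Exceeding |Im \<zeta>| places \<zeta> in the rectangle.\<close>
  define R where "R = max R0 (\<bar>Im \<zeta>\<bar> + 1)"
  let ?S = "cbox (Complex a (- R)) (Complex b R)"
  show "cmod (f \<zeta>) \<le> B + \<epsilon>"
  proof (rule maximum_modulus_frontier[of f ?S])
    show "f holomorphic_on interior ?S" using f by (rule holomorphic_on_subset) simp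
    show "continuous_on (closure ?S) f"
      using holomorphic_on_imp_continuous_on[OF f] by (rule continuous_on_subset) simp
    show "bounded ?S" by (rule bounded_cbox)
    show "\<zeta> \<in> ?S" using \<zeta> by (auto simp: R_def in_cbox_complex_iff)
    fix w assume w: "w \<in> frontier ?S"
    then have in_S: "w \<in> ?S" and nb: "w \<notin> box (Complex a (- R)) (Complex b R)"
      by (auto simp: frontier_def interior_cbox)
    then consider "Re w = a" | "Re w = b" | "Im w = - R" | "Im w = R"
      by (force simp: in_cbox_complex_iff in_box_complex_iff)
    then show "cmod (f w) \<le> B + \<epsilon>"
    proof cases
      case 3
      then have "cmod (f w) \<le> \<epsilon>" using in_S by (intro R0) (auto simp: in_cbox_complex_iff R_def)
      then show ?thesis using B by simp
    next
      case 4
      then have "cmod (f w) \<le> \<epsilon>" using in_S by (intro R0) (auto simp: in_cbox_complex_iff R_def)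
      then show ?thesis using B by simp
    qed (use left[of w] right[of w] \<epsilon> in auto)
  qed
qed

section \<open>Time weights and oscillating time integrals\<close>

definition tpow :: "complex \<Rightarrow> real \<Rightarrow> complex" where
  "tpow \<zeta> t = exp (\<zeta> * complex_of_real (ln (1 + t)))"

lemma norm_tpow: "t \<ge> 0 \<Longrightarrow> cmod (tpow \<zeta> t) = (1 + t) powr Re \<zeta>"
  by (simp add: tpow_def powr_def mult.commute)

lemma tpow_deriv:
  assumes "t \<ge> 0"
  shows "(tpow \<zeta> has_vector_derivative (\<zeta> * tpow (\<zeta> - 1) t)) (at t)"
proof -
  have "((\<lambda>t. ln (1 + t)) has_real_derivative (1 / (1 + t))) (at t)"
    using assms by (auto intro!: derivative_eq_intros)
  then have 1: "((\<lambda>t. complex_of_real (ln (1 + t))) has_vector_derivative of_real (1 / (1 + t))) (at t)"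
    by (intro has_vector_derivative_of_real) (simp add: has_real_derivative_iff_has_vector_derivative)
  have 2: "((\<lambda>x. exp (\<zeta> * x)) has_field_derivative (exp (\<zeta> * complex_of_real (ln (1 + t))) * \<zeta>)) (at (complex_of_real (ln (1 + t))))"
    by (auto intro!: derivative_eq_intros)
  have "complex_of_real (1 / (1 + t)) = exp (- complex_of_real (ln (1 + t)))"
    using assms by (simp add: exp_minus exp_of_real inverse_eq_divide)
  then have "of_real (1 / (1 + t)) * (exp (\<zeta> * complex_of_real (ln (1 + t))) * \<zeta>) = \<zeta> * tpow (\<zeta> - 1) t"
    by (simp add: tpow_def mult_exp_exp algebra_simps)
  then show ?thesis
    using field_vector_diff_chain_at[OF 1 2] by (simp add: o_def tpow_def[abs_def])
qed

lemma exp_time_deriv: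
  "((\<lambda>t. exp (\<i> * of_real t * w)) has_vector_derivative (\<i> * w * exp (\<i> * of_real t * w))) (at t)"
proof -
  have 1: "(complex_of_real has_vector_derivative 1) (at t)"
    using has_vector_derivative_of_real[OF DERIV_ident, of "at t"] by simp
  have 2: "((\<lambda>x. exp (\<i> * x * w)) has_field_derivative (exp (\<i> * complex_of_real t * w) * (\<i> * w))) (at (complex_of_real t))"
    by (auto intro!: derivative_eq_intros)
  show ?thesis using field_vector_diff_chain_at[OF 1 2] by (simp add: o_def mult_ac)
qed

lemma norm_exp_time: "cmod (exp (\<i> * of_real t * w)) = exp (- t * Im w)"
  by simp

lemma norm_exp_time_le: "t \<ge> 0 \<Longrightarrow> Im w \<ge> 0 \<Longrightarrow> cmod (exp (\<i> * of_real t * w)) \<le> 1"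
  unfolding norm_exp_time by (simp add: mult_nonneg_nonneg)

lemma continuous_on_tpow [continuous_intros]: "(\<And>t. t \<in> S \<Longrightarrow> f t \<ge> 0) \<Longrightarrow> continuous_on S f \<Longrightarrow> continuous_on S (\<lambda>t. tpow \<zeta> (f t))"
  unfolding tpow_def by (intro continuous_intros) (auto simp: add_nonneg_eq_0_iff)

lemma norm_diff3: "norm a \<le> x \<Longrightarrow> norm b \<le> y \<Longrightarrow> norm c \<le> z \<Longrightarrow> norm (a - b - c) \<le> x + y + z"
  for a b c :: "'a::real_normed_vector"
  using norm_triangle_ineq4[of "a - b" c] norm_triangle_ineq4[of a b] by linarith

text \<open>At \<open>\<zeta> = -1 + i y\<close> the time integral is a truncated oscillating logarithm; split it at \<open>t = 1 / |w|\<close>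
  and integrate by parts in opposite directions on the two pieces.\<close>
lemma oscillating_time_integral:
  assumes w: "Im w \<ge> 0" and T: "T \<ge> 0" and \<zeta>: "Re \<zeta> = - 1"
  shows "cmod (integral {0..T} (\<lambda>t. (\<zeta> + 1) * tpow \<zeta> t * exp (\<i> * of_real t * w))) \<le> 3 + 3 * \<bar>Im \<zeta>\<bar> + (Im \<zeta>)\<^sup>2"
proof -
  define y where "y = \<bar>Im \<zeta>\<bar>"
  have y0: "y \<ge> 0" by (simp add: y_def)
  have z1: "cmod (\<zeta> + 1) = y" using \<zeta> by (simp add: cmod_def y_def)
  have z2: "cmod \<zeta> \<le> 1 + y" using cmod_le[of \<zeta>] \<zeta> by (simp add: y_def)
  let ?e = "\<lambda>t. exp (\<i> * complex_of_real t * w)"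
  let ?f = "\<lambda>t. (\<zeta> + 1) * tpow \<zeta> t * ?e t"
  have ce: "continuous_on S ?e" for S by (intro continuous_intros)
  have cf: "continuous_on {s..t} ?f" if "s \<ge> 0" for s t
    using that by (intro continuous_intros) auto
  have intf: "?f integrable_on {s..t}" if "s \<ge> 0" for s t
    using cf[OF that] by (rule integrable_continuous_real)
  have n1: "cmod (tpow (\<zeta> + 1) t) = 1" "cmod (tpow \<zeta> t) = 1 / (1 + t)" "cmod (tpow (\<zeta> - 1) t) = 1 / (1 + t)\<^sup>2" if "t \<ge> 0" for t
    using that \<zeta> by (simp_all add: norm_tpow powr_minus_divide)
  \<comment> \<open>Up to 1 / |w| the exponential hardly oscillates. The power times \<zeta> + 1 is
    the derivative of \<open>tpow (\<zeta> + 1)\<close>, which has modulus one: two boundary terms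
    and a remainder |w| \<tau> \<le> 1 add up to 3.\<close>
  have first: "cmod (integral {0..\<tau>} ?f) \<le> 3" if \<tau>: "\<tau> \<ge> 0" "cmod w * \<tau> \<le> 1" for \<tau>
  proof -
    let ?g = "\<lambda>t. tpow (\<zeta> + 1) t * (\<i> * w * ?e t)"
    have d: "((\<lambda>t. tpow (\<zeta> + 1) t * ?e t) has_vector_derivative (?g t + ?f t)) (at t)" if "t \<ge> 0" for t
      using has_vector_derivative_mult[OF tpow_deriv[OF that, of "\<zeta> + 1"] exp_time_deriv[of w t]] by simp
    have i: "((\<lambda>t. ?g t + ?f t) has_integral (tpow (\<zeta> + 1) \<tau> * ?e \<tau> - tpow (\<zeta> + 1) 0 * ?e 0)) {0..\<tau>}"
      by (rule fundamental_theorem_of_calculus[OF \<tau>(1), of "\<lambda>t. tpow (\<zeta> + 1) t * ?e t" "\<lambda>t. ?g t + ?f t"])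
         (rule has_vector_derivative_at_within[OF d], simp)
    have cg: "continuous_on {0..\<tau>} ?g" by (intro continuous_intros) auto
    have "integral {0..\<tau>} ?g + integral {0..\<tau>} ?f = tpow (\<zeta> + 1) \<tau> * ?e \<tau> - tpow (\<zeta> + 1) 0 * ?e 0"
      by (rule trans[OF Henstock_Kurzweil_Integration.integral_add[symmetric, OF integrable_continuous_real[OF cg] intf[OF order_refl]] integral_unique[OF i]])
    then have e: "integral {0..\<tau>} ?f = tpow (\<zeta> + 1) \<tau> * ?e \<tau> - tpow (\<zeta> + 1) 0 * ?e 0 - integral {0..\<tau>} ?g"
      by (simp add: algebra_simps)
    have "cmod (integral {0..\<tau>} ?g) \<le> cmod w * (\<tau> - 0)"
    proof (rule integral_bound[OF \<tau>(1) cg])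
      fix t assume "t \<in> {0..\<tau>}"
      then show "cmod (?g t) \<le> cmod w"
        using norm_exp_time_le[of t w] w n1(1)[of t] mult_left_le[of "cmod (?e t)" "cmod w"] by (simp only: norm_mult) simp
    qed
    moreover have "cmod (tpow (\<zeta> + 1) \<tau> * ?e \<tau>) \<le> 1" "cmod (tpow (\<zeta> + 1) 0 * ?e 0) \<le> 1"
      using n1(1) norm_exp_time_le w \<tau> by (simp_all only: norm_mult mult_1_left order_refl)
    ultimately have "cmod (integral {0..\<tau>} ?f) \<le> 1 + 1 + cmod w * (\<tau> - 0)"
      unfolding e by (intro norm_diff3)
    then show ?thesis using \<tau> by simp
  qed
  \<comment> \<open>From 1 / |w| on the exponential is integrated and the power differentiated. As
    |w| (1 + \<tau>) \<ge> 1, the boundary terms are at most y each and the remainder at most y (1 +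
    y).\<close>
  have second: "cmod (integral {\<tau>..T} ?f) \<le> 2 * y + y * (1 + y)" if \<tau>: "\<tau> \<ge> 0" "\<tau> \<le> T" "cmod w * \<tau> = 1" for \<tau>
  proof -
    have w0: "w \<noteq> 0" using \<tau> by auto
    let ?G = "\<lambda>t. ((\<zeta> + 1) / (\<i> * w)) * (tpow \<zeta> t * ?e t)"
    let ?g = "\<lambda>t. ((\<zeta> + 1) / (\<i> * w)) * (\<zeta> * tpow (\<zeta> - 1) t * ?e t)"
    have d: "(?G has_vector_derivative (?g t + ?f t)) (at t)" if "t \<ge> 0" for t
      using has_vector_derivative_mult_right[OF has_vector_derivative_mult[OF tpow_deriv[OF that, of \<zeta>] exp_time_deriv[of w t]], of "(\<zeta> + 1) / (\<i> * w)"]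
      using w0 by (simp add: field_simps)
    have i: "((\<lambda>t. ?g t + ?f t) has_integral (?G T - ?G \<tau>)) {\<tau>..T}"
      by (rule fundamental_theorem_of_calculus[OF \<tau>(2), of ?G "\<lambda>t. ?g t + ?f t"])
         (rule has_vector_derivative_at_within[OF d], use \<tau> in simp)
    have cg: "continuous_on {\<tau>..T} ?g" using \<tau> by (intro continuous_intros) auto
    have "integral {\<tau>..T} ?g + integral {\<tau>..T} ?f = ?G T - ?G \<tau>"
      by (rule trans[OF Henstock_Kurzweil_Integration.integral_add[symmetric, OF integrable_continuous_real[OF cg] intf[OF \<tau>(1)]] integral_unique[OF i]])
    then have e: "integral {\<tau>..T} ?f = ?G T - ?G \<tau> - integral {\<tau>..T} ?g"
      by (simp add: algebra_simps)
    have G: "cmod (?G t) \<le> y" if "t \<ge> \<tau>" for t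
    proof -
      have t: "t \<ge> 0" using that \<tau> by simp
      have "1 \<le> cmod w * (1 + t)" using \<tau> that mult_left_mono[of \<tau> "1 + t" "cmod w"] by simp
      then have "y * (cmod (?e t) / (cmod w * (1 + t))) \<le> y * 1"
        using norm_exp_time_le[OF t w] y0 w0 by (intro mult_left_mono) (auto simp: divide_le_eq_1 simp del: norm_exp_eq_Re)
      then show ?thesis
        using t w0 by (simp add: norm_mult norm_divide z1 n1(2) mult_ac del: norm_exp_eq_Re)
    qed
    define q where "q t = (y * (1 + y) / cmod w) * (1 / (1 + t)\<^sup>2)" for t
    have iq: "(q has_integral ((y * (1 + y) / cmod w) * (- 1 / (1 + T)) - (y * (1 + y) / cmod w) * (- 1 / (1 + \<tau>)))) {\<tau>..T}"
    proof (rule fundamental_theorem_of_calculus[OF \<tau>(2)])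
      fix t assume "t \<in> {\<tau>..T}"
      then have t: "t \<ge> 0" using \<tau> by auto
      have "((\<lambda>t. (y * (1 + y) / cmod w) * (- 1 / (1 + t))) has_real_derivative q t) (at t)"
        unfolding q_def using t w0 by (auto intro!: derivative_eq_intros simp: power2_eq_square)
      then show "((\<lambda>t. (y * (1 + y) / cmod w) * (- 1 / (1 + t))) has_vector_derivative q t) (at t within {\<tau>..T})"
        by (simp add: has_real_derivative_iff_has_vector_derivative has_vector_derivative_at_within)
    qed
    have "cmod (integral {\<tau>..T} ?g) \<le> integral {\<tau>..T} q"
    proof (rule Henstock_Kurzweil_Integration.integral_norm_bound_integral[OF integrable_continuous_real[OF cg] has_integral_integrable[OF iq]])
      fix t assume "t \<in> {\<tau>..T}"
      then have t: "t \<ge> 0" using \<tau> by auto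
      have "cmod (?g t) = y / cmod w * (cmod \<zeta> * (1 / (1 + t)\<^sup>2) * cmod (?e t))"
        using t by (simp add: norm_mult norm_divide z1 n1(3) del: norm_exp_eq_Re)
      also have "\<dots> \<le> y / cmod w * ((1 + y) * (1 / (1 + t)\<^sup>2) * 1)"
        using z2 norm_exp_time_le[OF t w] y0 by (intro mult_left_mono mult_mono) (auto simp del: norm_exp_eq_Re)
      finally show "cmod (?g t) \<le> q t" by (simp add: q_def)
    qed
    also have "\<dots> \<le> y * (1 + y) / cmod w * (1 / (1 + \<tau>))"
      unfolding integral_unique[OF iq] using T y0 by (simp add: field_simps)
    also have "\<dots> = y * (1 + y) * (1 / (cmod w * (1 + \<tau>)))" by simp
    also have "\<dots> \<le> y * (1 + y) * 1"
      using \<tau>(3) y0 norm_ge_zero[of w] by (intro mult_left_mono) (auto simp: distrib_left divide_le_eq_1 simp del: norm_ge_zero)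
    finally have "cmod (integral {\<tau>..T} ?g) \<le> y * (1 + y)" by simp
    then show ?thesis unfolding e
      using G[of T] G[of \<tau>] \<tau> norm_triangle_ineq4[of "?G T - ?G \<tau>" "integral {\<tau>..T} ?g"] norm_triangle_ineq4[of "?G T" "?G \<tau>"] by linarith
  qed
  have "cmod (integral {0..T} ?f) \<le> 3 + (2 * y + y * (1 + y))"
  proof (cases "cmod w * T \<le> 1")
    case True
    then show ?thesis using first[OF T] y0 by (intro order_trans[OF first[OF T True]]) simp
  next
    case False
    then have w0: "w \<noteq> 0" by auto
    define \<tau> where "\<tau> = 1 / cmod w"
    have \<tau>: "\<tau> \<ge> 0" "\<tau> \<le> T" "cmod w * \<tau> = 1" using False w0 by (auto simp: \<tau>_def field_simps)
    have "integral {0..T} ?f = integral {0..\<tau>} ?f + integral {\<tau>..T} ?f"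
      using Henstock_Kurzweil_Integration.integral_combine[OF \<tau>(1,2) intf[OF order_refl]] by simp
    then show ?thesis
      using norm_triangle_ineq[of "integral {0..\<tau>} ?f" "integral {\<tau>..T} ?f"] first[of \<tau>] second[OF \<tau>] \<tau> by simp
  qed
  then show ?thesis by (simp add: y_def power2_eq_square algebra_simps)
qed

text \<open>The largest factor dominates. This decouples the coordinates: the time integral of the
  d-dimensional kernel is bounded by d one-dimensional integrals, each uniform in its own
  coordinate.\<close>

lemma prod_le_sum_power:
  fixes x :: "'d::finite \<Rightarrow> real"
  assumes "\<And>j. x j \<ge> 0"
  shows "(\<Prod>j\<in>UNIV. x j) \<le> (\<Sum>j\<in>UNIV. x j ^ CARD('d))"
proof -
  have "Max (range x) \<in> range x" by (intro Max_in) auto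
  then obtain k where k: "Max (range x) = x k" by (rule imageE)
  have le: "x j \<le> x k" for j unfolding k[symmetric] by (intro Max_ge) auto
  have "(\<Prod>j\<in>UNIV. x j) \<le> (\<Prod>j\<in>(UNIV :: 'd set). x k)" by (intro prod_mono) (auto simp: assms le)
  also have "\<dots> = x k ^ CARD('d)" by simp
  also have "\<dots> \<le> (\<Sum>j\<in>UNIV. x j ^ CARD('d))" by (intro member_le_sum) (auto simp: assms)
  finally show ?thesis .
qed

lemma kernel_time_bound:
  assumes "0 \<le> a" "CARD('d::finite) = 4 \<and> a < 1 \<or> CARD('d) \<ge> 5 \<and> a \<le> (real CARD('d) - 1) / 3"
  shows "\<exists>C\<ge>0. \<forall>(n :: int ^ 'd) T. integral {0..T} (\<lambda>t. (1 + t) powr a * cmod (kernel t n)) \<le> C"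
proof -
  let ?d = "CARD('d)"
  obtain C where C: "C \<ge> 0"
    and b: "\<And>m. (\<integral>\<^sup>+t. ennreal ((1 + t) powr a * cmod (kernel1 t m) ^ ?d) * indicator {0..} t \<partial>lborel) \<le> ennreal C"
    using kernel1_time_bound[OF assms] by blast
  have [measurable]: "(\<lambda>t. kernel1 t m) \<in> borel_measurable borel" for m
    by (rule borel_measurable_continuous_onI) (rule continuous_on_kernel1)
  have [measurable]: "(\<lambda>t. kernel t n) \<in> borel_measurable borel" for n :: "int ^ 'd"
    by (rule borel_measurable_continuous_onI) (rule continuous_on_kernel)
  show ?thesis
  proof (intro exI[of _ "real ?d * C"] conjI allI)
    fix n :: "int ^ 'd" and T :: real
    let ?g = "\<lambda>t. (1 + t) powr a * cmod (kernel t n)"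
    define g where "g t = (if t \<in> {0..T} then ?g t else 0)" for t
    have "continuous_on {0..T} ?g"
      by (intro continuous_intros continuous_on_kernel) (auto simp: add_nonneg_eq_0_iff)
    then have "(?g has_integral integral {0..T} ?g) {0..T}"
      by (intro integrable_integral integrable_continuous_real)
    then have "(g has_integral integral {0..T} ?g) UNIV"
      unfolding g_def has_integral_restrict_UNIV .
    moreover have "g \<in> borel_measurable borel" "\<And>t. 0 \<le> g t" 
    proof -
      have "g = (\<lambda>t. indicator {0..T} t * ?g t)" by (auto simp: g_def indicator_def)
      then show "g \<in> borel_measurable borel" by simp
      show "0 \<le> g t" for t by (simp add: g_def)
    qed
    ultimately have "ennreal (integral {0..T} ?g) = (\<integral>\<^sup>+t. ennreal (g t) \<partial>lborel)"
      using nn_integral_has_integral_lborel[of g] by simp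
    also have "\<dots> \<le> (\<integral>\<^sup>+t. (\<Sum>j\<in>UNIV. ennreal ((1 + t) powr a * cmod (kernel1 t (n $ j)) ^ ?d) * indicator {0..} t) \<partial>lborel)"
    proof (rule nn_integral_mono)
      fix t :: real
      show "ennreal (g t) \<le> (\<Sum>j\<in>UNIV. ennreal ((1 + t) powr a * cmod (kernel1 t (n $ j)) ^ ?d) * indicator {0..} t)"
      proof (cases "t \<in> {0..T}")
        case True
        have "?g t \<le> (1 + t) powr a * (\<Sum>j\<in>UNIV. cmod (kernel1 t (n $ j)) ^ ?d)"
          unfolding kernel_prod prod_norm[symmetric] by (intro mult_left_mono prod_le_sum_power) auto
        then have "ennreal (?g t) \<le> ennreal (\<Sum>j\<in>UNIV. (1 + t) powr a * cmod (kernel1 t (n $ j)) ^ ?d)"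
          by (intro ennreal_leI) (simp add: sum_distrib_left)
        then show ?thesis using True by (simp add: g_def sum_ennreal)
      next
        case False
        then have "g t = 0" unfolding g_def by (simp only: if_False)
        then show ?thesis by simp
      qed
    qed
    also have "\<dots> = (\<Sum>j\<in>UNIV. (\<integral>\<^sup>+t. ennreal ((1 + t) powr a * cmod (kernel1 t (n $ j)) ^ ?d) * indicator {0..} t \<partial>lborel))"
      by (rule nn_integral_sum) measurable
    also have "\<dots> \<le> (\<Sum>j\<in>(UNIV :: 'd set). ennreal C)" by (intro sum_mono b)
    also have "\<dots> = ennreal (real ?d * C)" using C by (simp add: ennreal_mult ennreal_of_nat_eq_real_of_nat)
    finally show "integral {0..T} ?g \<le> real ?d * C" using C by simp
  qed (use C in simp)
qed

lemma integral_swap_time: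
  fixes f :: "real \<Rightarrow> real ^ 'd::finite \<Rightarrow> complex"
  assumes "continuous_on ({0..T} \<times> cube) (\<lambda>(t, \<xi>). f t \<xi>)"
  shows "integral {0..T} (\<lambda>t. integral cube (f t)) = integral cube (\<lambda>\<xi>. integral {0..T} (\<lambda>t. f t \<xi>))"
  using integral_swap_continuous[of 0 "\<chi> i. - 1 / 2 :: real ^ 'd" T "\<chi> i. 1 / 2" f] assms
  by (simp add: cube_def cbox_Pair_eq)

context
  fixes \<phi> :: "real \<Rightarrow> complex" and T :: real
  assumes \<phi>: "continuous_on {0..T} \<phi>"
begin

lemma continuous_on_time_symbol:
  "continuous_on ({0..T} \<times> S) (\<lambda>(t, \<xi>). \<phi> t * cis (- (t * laplace_symbol \<xi>)))"
  unfolding case_prod_unfold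
  by (intro continuous_intros continuous_on_compose2[OF \<phi>] continuous_on_compose2[OF continuous_on_laplace_symbol[of UNIV]]) auto

lemma continuous_on_time_integral:
  "continuous_on UNIV (\<lambda>\<xi> :: real ^ 'd. integral {0..T} (\<lambda>t. \<phi> t * cis (- (t * laplace_symbol \<xi>))))"
proof -
  have "continuous_on (UNIV \<times> cbox 0 T) (\<lambda>(\<xi> :: real ^ 'd, t). \<phi> t * cis (- (t * laplace_symbol \<xi>)))"
    unfolding case_prod_unfold
    by (intro continuous_intros continuous_on_compose2[OF \<phi>] continuous_on_compose2[OF continuous_on_laplace_symbol[of UNIV]]) auto
  from integral_continuous_on_param[OF this] show ?thesis by simp
qed

lemma time_integral_kernel:
  fixes n :: "int ^ 'd::finite"
  shows "integral {0..T} (\<lambda>t. \<phi> t * kernel t n)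
    = integral cube (\<lambda>\<xi>. character n \<xi> * integral {0..T} (\<lambda>t. \<phi> t * cis (- (t * laplace_symbol \<xi>))))"
proof -
  have "integral {0..T} (\<lambda>t. \<phi> t * kernel t n)
      = integral {0..T} (\<lambda>t. integral cube (\<lambda>\<xi>. character n \<xi> * (\<phi> t * cis (- (t * laplace_symbol \<xi>)))))"
  proof (rule integral_cong)
    fix t
    have "\<phi> t * kernel t n = integral cube (\<lambda>\<xi>. \<phi> t * (character n \<xi> * cis (- (t * laplace_symbol \<xi>))))"
      unfolding kernel_def by (rule integral_mult_right[symmetric])
    then show "\<phi> t * kernel t n = integral cube (\<lambda>\<xi>. character n \<xi> * (\<phi> t * cis (- (t * laplace_symbol \<xi>))))"
      by (simp add: mult_ac)
  qed
  also have "\<dots> = integral cube (\<lambda>\<xi>. integral {0..T} (\<lambda>t. character n \<xi> * (\<phi> t * cis (- (t * laplace_symbol \<xi>)))))"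
  proof (rule integral_swap_time)
    show "continuous_on ({0..T} \<times> cube) (\<lambda>(t, \<xi>). character n \<xi> * (\<phi> t * cis (- (t * laplace_symbol \<xi>))))"
      unfolding case_prod_unfold
      by (intro continuous_on_mult[OF _ continuous_on_time_symbol[unfolded case_prod_unfold]]
          continuous_on_compose2[OF continuous_on_character[of UNIV]] continuous_intros) auto
  qed
  finally show ?thesis by simp
qed

text \<open>On the Fourier side the form is multiplication by a symbol of modulus at most M between
  two trigonometric polynomials, whose L^2 norms Parseval bounds by one.\<close>

lemma bilinear_kernel_bound:
  fixes a b :: "int ^ 'd::finite \<Rightarrow> complex"
  assumes A: "finite A" and M: "\<And>\<xi> :: real ^ 'd. cmod (integral {0..T} (\<lambda>t. \<phi> t * cis (- (t * laplace_symbol \<xi>)))) \<le> M"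
    and a: "(\<Sum>m\<in>A. (cmod (a m))\<^sup>2) \<le> 1" and b: "(\<Sum>n\<in>A. (cmod (b n))\<^sup>2) \<le> 1"
  shows "cmod (\<Sum>m\<in>A. \<Sum>n\<in>A. a m * b n * integral {0..T} (\<lambda>t. \<phi> t * kernel t (m - n))) \<le> M"
proof -
  let ?\<Phi> = "\<lambda>\<xi> :: real ^ 'd. integral {0..T} (\<lambda>t. \<phi> t * cis (- (t * laplace_symbol \<xi>)))"
  let ?P = "trig_poly A a" and ?Q = "trig_poly A (\<lambda>n. cnj (b n))"
  have M0: "0 \<le> M" using M[of 0] norm_ge_zero order_trans by blast
  have "(\<Sum>m\<in>A. \<Sum>n\<in>A. a m * b n * integral {0..T} (\<lambda>t. \<phi> t * kernel t (m - n)))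
      = (\<Sum>m\<in>A. \<Sum>n\<in>A. integral cube (\<lambda>\<xi>. a m * b n * (character (m - n) \<xi> * ?\<Phi> \<xi>)))"
    unfolding time_integral_kernel by simp
  also have "\<dots> = integral cube (\<lambda>\<xi>. \<Sum>m\<in>A. \<Sum>n\<in>A. a m * b n * (character (m - n) \<xi> * ?\<Phi> \<xi>))"
  proof (rule integral_unique[symmetric])
    show "((\<lambda>\<xi>. \<Sum>m\<in>A. \<Sum>n\<in>A. a m * b n * (character (m - n) \<xi> * ?\<Phi> \<xi>)) has_integral
      (\<Sum>m\<in>A. \<Sum>n\<in>A. integral cube (\<lambda>\<xi>. a m * b n * (character (m - n) \<xi> * ?\<Phi> \<xi>)))) cube"
      by (intro has_integral_sum A integrable_integral cube_integrable continuous_intros continuous_on_time_integral)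
  qed
  also have "(\<lambda>\<xi>. \<Sum>m\<in>A. \<Sum>n\<in>A. a m * b n * (character (m - n) \<xi> * ?\<Phi> \<xi>)) = (\<lambda>\<xi>. ?P \<xi> * cnj (?Q \<xi>) * ?\<Phi> \<xi>)"
  proof
    fix \<xi>
    have "?P \<xi> * cnj (?Q \<xi>) = (\<Sum>m\<in>A. \<Sum>n\<in>A. a m * b n * character (m - n) \<xi>)"
      by (simp add: trig_poly_def sum_product character_diff mult_ac)
    then show "(\<Sum>m\<in>A. \<Sum>n\<in>A. a m * b n * (character (m - n) \<xi> * ?\<Phi> \<xi>)) = ?P \<xi> * cnj (?Q \<xi>) * ?\<Phi> \<xi>"
      by (simp add: sum_distrib_right mult.assoc)
  qed
  finally have e: "(\<Sum>m\<in>A. \<Sum>n\<in>A. a m * b n * integral {0..T} (\<lambda>t. \<phi> t * kernel t (m - n)))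
      = integral cube (\<lambda>\<xi>. ?P \<xi> * cnj (?Q \<xi>) * ?\<Phi> \<xi>)" .
  have "cmod (integral cube (\<lambda>\<xi>. ?P \<xi> * cnj (?Q \<xi>) * ?\<Phi> \<xi>))
      \<le> integral cube (\<lambda>\<xi>. M / 2 * (cmod (?P \<xi>))\<^sup>2 + M / 2 * (cmod (?Q \<xi>))\<^sup>2)"
  proof (rule Henstock_Kurzweil_Integration.integral_norm_bound_integral)
    fix \<xi> :: "real ^ 'd"
    have "cmod (?P \<xi> * cnj (?Q \<xi>) * ?\<Phi> \<xi>) \<le> (cmod (?P \<xi>) * cmod (?Q \<xi>)) * M"
      unfolding norm_mult using M by (intro mult_mono) auto
    also have "\<dots> \<le> (((cmod (?P \<xi>))\<^sup>2 + (cmod (?Q \<xi>))\<^sup>2) / 2) * M"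
      using sum_squares_bound[of "cmod (?P \<xi>)" "cmod (?Q \<xi>)"] M0 by (intro mult_right_mono) auto
    finally show "cmod (?P \<xi> * cnj (?Q \<xi>) * ?\<Phi> \<xi>) \<le> M / 2 * (cmod (?P \<xi>))\<^sup>2 + M / 2 * (cmod (?Q \<xi>))\<^sup>2"
      by (simp add: algebra_simps)
  qed (intro cube_integrable continuous_intros continuous_on_time_integral)+
  also have "\<dots> = M / 2 * integral cube (\<lambda>\<xi>. (cmod (?P \<xi>))\<^sup>2) + M / 2 * integral cube (\<lambda>\<xi>. (cmod (?Q \<xi>))\<^sup>2)"
    by (intro integral_unique has_integral_add has_integral_mult_right integrable_integral cube_integrable continuous_intros)
  also have "\<dots> \<le> M / 2 * 1 + M / 2 * 1"
    unfolding trig_poly_parseval[OF A] using a b M0 by (intro add_mono mult_left_mono) auto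
  finally show ?thesis unfolding e by simp
qed

end

text \<open>The cutoff T makes the integral entire in \<zeta>. It is removed only at \<zeta> = 0,
  where Im z > 0 gives convergence.\<close>

definition weighted_kernel :: "complex \<Rightarrow> complex \<Rightarrow> real \<Rightarrow> int ^ 'd \<Rightarrow> complex" where
  "weighted_kernel \<zeta> z T n = integral {0..T} (\<lambda>t. tpow \<zeta> t * exp (\<i> * of_real t * z) * kernel t n)"

lemma continuous_on_weight: "continuous_on {0..T} (\<lambda>t. tpow \<zeta> t * exp (\<i> * of_real t * z))"
  by (intro continuous_intros) auto

lemma weighted_kernel_holomorphic: "(\<lambda>\<zeta>. weighted_kernel \<zeta> z T n) holomorphic_on UNIV"
proof -
  have "(\<lambda>\<zeta>. integral (cbox 0 T) (\<lambda>t. tpow \<zeta> t * exp (\<i> * of_real t * z) * kernel t n)) holomorphic_on UNIV"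
  proof (rule leibniz_rule_holomorphic)
    fix \<zeta> t
    show "((\<lambda>\<zeta>. tpow \<zeta> t * exp (\<i> * of_real t * z) * kernel t n) has_field_derivative
       of_real (ln (1 + t)) * tpow \<zeta> t * exp (\<i> * of_real t * z) * kernel t n) (at \<zeta> within UNIV)"
      unfolding tpow_def by (auto intro!: derivative_eq_intros)
  next
    fix \<zeta>
    show "(\<lambda>t. tpow \<zeta> t * exp (\<i> * of_real t * z) * kernel t n) integrable_on cbox 0 T"
      unfolding box_real by (intro integrable_continuous_real continuous_on_mult[OF continuous_on_weight] continuous_on_kernel)
  next
    show "continuous_on (UNIV \<times> cbox 0 T) (\<lambda>(\<zeta>, t). of_real (ln (1 + t)) * tpow \<zeta> t * exp (\<i> * of_real t * z) * kernel t n)"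
      unfolding case_prod_unfold tpow_def
      by (intro continuous_intros continuous_on_compose2[OF continuous_on_kernel[of UNIV]]) (auto simp: add_nonneg_eq_0_iff)
  qed auto
  then show ?thesis by (simp add: weighted_kernel_def)
qed

lemma exp_minus_square_bounds:
  fixes y :: real
  shows "exp (- y\<^sup>2) \<le> 1" "\<bar>y\<bar> * exp (- y\<^sup>2) \<le> 1" "y\<^sup>2 * exp (- y\<^sup>2) \<le> 1"
proof -
  have e: "1 + y\<^sup>2 \<le> exp (y\<^sup>2)" by (rule exp_ge_add_one_self)
  have "\<bar>y\<bar> \<le> 1 + y\<^sup>2" using sum_squares_bound[of 1 "\<bar>y\<bar>"] by (simp add: power2_eq_square)
  then have "\<bar>y\<bar> \<le> exp (y\<^sup>2)" using e by linarith
  then show "\<bar>y\<bar> * exp (- y\<^sup>2) \<le> 1" by (simp add: exp_minus field_simps)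
  have "y\<^sup>2 \<le> exp (y\<^sup>2)" using e by linarith
  then show "y\<^sup>2 * exp (- y\<^sup>2) \<le> 1" by (simp add: exp_minus field_simps)
qed simp

lemma norm_exp_square: "cmod (exp (\<zeta>\<^sup>2)) = exp ((Re \<zeta>)\<^sup>2) * exp (- (Im \<zeta>)\<^sup>2)"
  by (simp add: exp_add[symmetric] power2_eq_square)

text \<open>Stein interpolation. On Re \<zeta> = -1 the weights are unimodular and the symbol bound
  applies; on Re \<zeta> = a the kernel is bounded and the weights are controlled by the (a + 1)-th
  power sum of W. The sum of the two line bounds serves as common bound on the strip, which contains
  0.\<close>

theorem truncated_bilinear_bound:
  fixes A :: "(int ^ 'd::finite) set" and W :: "int ^ 'd \<Rightarrow> real" and f g :: "int ^ 'd \<Rightarrow> complex"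
  assumes a: "a \<ge> 0" and Ca: "\<And>(n :: int ^ 'd) T. integral {0..T} (\<lambda>t. (1 + t) powr a * cmod (kernel t n)) \<le> Ca"
    and z: "Im z \<ge> 0" and T: "T \<ge> 0" and A: "finite A"
    and W: "\<And>n. n \<in> A \<Longrightarrow> W n > 0" "(\<Sum>n\<in>A. W n powr (a + 1)) \<le> 1"
    and f: "(\<Sum>n\<in>A. (cmod (f n))\<^sup>2) \<le> 1" and g: "(\<Sum>n\<in>A. (cmod (g n))\<^sup>2) \<le> 1"
  shows "cmod (\<Sum>m\<in>A. \<Sum>n\<in>A. (sqrt (W m) * g m) * (sqrt (W n) * f n) * weighted_kernel 0 z T (m - n))
     \<le> exp (a\<^sup>2) * (a + 2) * Ca + 7 * exp 1"
proof -
  \<comment> \<open>T = -1 gives an empty interval, so the integral is zero.\<close>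
  have Ca0: "Ca \<ge> 0" using Ca[of "- 1" 0] by simp
  \<comment> \<open>W^((\<zeta> + 1) / 2): of modulus one on the left line, sqrt W at 0, of modulus
    W^((a + 1) / 2) on the right line.\<close>
  define P where "P \<zeta> m = exp ((\<zeta> + 1) / 2 * complex_of_real (ln (W m)))" for \<zeta> m
  \<comment> \<open>Both prefactors are 1 at \<zeta> = 0. The factor \<zeta> + 1 makes the left line
    bounded, and exp(\<zeta>^2) compensates growth in Im \<zeta>.\<close>
  define F where "F \<zeta> = exp (\<zeta>\<^sup>2) * ((\<zeta> + 1) * (\<Sum>m\<in>A. \<Sum>n\<in>A. (P \<zeta> m * g m) * (P \<zeta> n * f n) * weighted_kernel \<zeta> z T (m - n)))" for \<zeta>
  have normP: "cmod (P \<zeta> m) = exp ((Re \<zeta> + 1) / 2 * ln (W m))" for \<zeta> m by (simp add: P_def)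
  have holF: "F holomorphic_on UNIV"
    unfolding F_def P_def by (intro holomorphic_intros weighted_kernel_holomorphic) auto
  have wk: "cmod (weighted_kernel \<zeta> z T n) \<le> Ca" if "Re \<zeta> \<le> a" for \<zeta> and n :: "int ^ 'd"
  proof -
    have "cmod (weighted_kernel \<zeta> z T n) \<le> integral {0..T} (\<lambda>t. (1 + t) powr a * cmod (kernel t n))"
      unfolding weighted_kernel_def
    proof (rule Henstock_Kurzweil_Integration.integral_norm_bound_integral)
      show "(\<lambda>t. tpow \<zeta> t * exp (\<i> * of_real t * z) * kernel t n) integrable_on {0..T}"
        by (intro integrable_continuous_real continuous_on_mult[OF continuous_on_weight] continuous_on_kernel)
      show "(\<lambda>t. (1 + t) powr a * cmod (kernel t n)) integrable_on {0..T}"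
        by (intro integrable_continuous_real continuous_intros continuous_on_kernel) (auto simp: add_nonneg_eq_0_iff)
      fix t assume t: "t \<in> {0..T}"
      have "(1 + t) powr Re \<zeta> \<le> (1 + t) powr a" using t that by (intro powr_mono) auto
      then have "((1 + t) powr Re \<zeta> * cmod (exp (\<i> * of_real t * z))) * cmod (kernel t n) \<le> ((1 + t) powr a * 1) * cmod (kernel t n)"
        using norm_exp_time_le[of t z] t z by (intro mult_right_mono mult_mono) auto
      then show "cmod (tpow \<zeta> t * exp (\<i> * of_real t * z) * kernel t n) \<le> (1 + t) powr a * cmod (kernel t n)"
        unfolding norm_mult using norm_tpow[of t \<zeta>] t by simp
    qed
    also have "\<dots> \<le> Ca" by (rule Ca)
    finally show ?thesis .
  qed
  have sum_bound: "cmod (\<Sum>m\<in>A. \<Sum>n\<in>A. (P \<zeta> m * g m) * (P \<zeta> n * f n) * weighted_kernel \<zeta> z T (m - n))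
      \<le> (\<Sum>m\<in>A. p m * cmod (g m)) * (\<Sum>n\<in>A. p n * cmod (f n)) * Ca"
    if "Re \<zeta> \<le> a" and p: "\<And>m. m \<in> A \<Longrightarrow> cmod (P \<zeta> m) \<le> p m" for \<zeta> p
  proof -
    have "cmod (\<Sum>m\<in>A. \<Sum>n\<in>A. (P \<zeta> m * g m) * (P \<zeta> n * f n) * weighted_kernel \<zeta> z T (m - n))
       \<le> (\<Sum>m\<in>A. \<Sum>n\<in>A. (p m * cmod (g m)) * (p n * cmod (f n)) * Ca)"
      using p order_trans[OF norm_ge_zero p]
      by (intro sum_norm_le) (auto simp: norm_mult intro!: mult_mono wk that mult_nonneg_nonneg)
    also have "\<dots> = (\<Sum>m\<in>A. p m * cmod (g m)) * (\<Sum>n\<in>A. p n * cmod (f n)) * Ca"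
      by (subst sum_product) (simp only: sum_distrib_right)
    finally show ?thesis .
  qed
  have zeta1: "cmod (\<zeta> + 1) \<le> a + 1 + \<bar>Im \<zeta>\<bar>" if "- 1 \<le> Re \<zeta>" "Re \<zeta> \<le> a" for \<zeta>
    using cmod_le[of "\<zeta> + 1"] that by simp
  define B where "B = exp (a\<^sup>2) * (a + 2) * Ca + 7 * exp 1"
  have "cmod (F 0) \<le> B"
  proof (rule maximum_principle_strip[OF holF, where a = "- 1" and b = a])
    fix \<zeta> assume \<zeta>: "Re \<zeta> = a"
    \<comment> \<open>Cauchy-Schwarz by 2 x y \<le> x^2 + y^2: the squared weight on this line is
      W^(a + 1), which sums to at most one.\<close>
    have half: "(\<Sum>m\<in>A. exp ((a + 1) / 2 * ln (W m)) * cmod (u m)) \<le> 1" if "(\<Sum>n\<in>A. (cmod (u n))\<^sup>2) \<le> 1" for u :: "int ^ 'd \<Rightarrow> complex"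
    proof -
      have "(\<Sum>m\<in>A. exp ((a + 1) / 2 * ln (W m)) * cmod (u m)) \<le> (\<Sum>m\<in>A. (W m powr (a + 1) + (cmod (u m))\<^sup>2) / 2)"
      proof (rule sum_mono)
        fix m assume "m \<in> A"
        then have "(exp ((a + 1) / 2 * ln (W m)))\<^sup>2 = W m powr (a + 1)"
          using W(1)[of m] by (simp add: powr_def exp_double[symmetric])
        then show "exp ((a + 1) / 2 * ln (W m)) * cmod (u m) \<le> (W m powr (a + 1) + (cmod (u m))\<^sup>2) / 2"
          using sum_squares_bound[of "exp ((a + 1) / 2 * ln (W m))" "cmod (u m)"] by simp
      qed
      also have "\<dots> = ((\<Sum>m\<in>A. W m powr (a + 1)) + (\<Sum>m\<in>A. (cmod (u m))\<^sup>2)) / 2"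
        by (simp add: sum.distrib sum_divide_distrib[symmetric])
      also have "\<dots> \<le> 1" using W(2) that by simp
      finally show ?thesis .
    qed
    have "cmod (\<Sum>m\<in>A. \<Sum>n\<in>A. (P \<zeta> m * g m) * (P \<zeta> n * f n) * weighted_kernel \<zeta> z T (m - n))
      \<le> (\<Sum>m\<in>A. exp ((a + 1) / 2 * ln (W m)) * cmod (g m)) * (\<Sum>n\<in>A. exp ((a + 1) / 2 * ln (W n)) * cmod (f n)) * Ca"
      using \<zeta> by (intro sum_bound) (auto simp: normP)
    also have "\<dots> \<le> 1 * 1 * Ca"
      using half[OF f] half[OF g] Ca0 by (intro mult_right_mono mult_mono) (auto intro!: sum_nonneg)
    finally have 1: "cmod (\<Sum>m\<in>A. \<Sum>n\<in>A. (P \<zeta> m * g m) * (P \<zeta> n * f n) * weighted_kernel \<zeta> z T (m - n)) \<le> Ca" by simp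
    have "exp (- (Im \<zeta>)\<^sup>2) * cmod (\<zeta> + 1) \<le> exp (- (Im \<zeta>)\<^sup>2) * (a + 1 + \<bar>Im \<zeta>\<bar>)"
      using zeta1[of \<zeta>] \<zeta> a by (intro mult_left_mono) auto
    also have "\<dots> = (a + 1) * exp (- (Im \<zeta>)\<^sup>2) + \<bar>Im \<zeta>\<bar> * exp (- (Im \<zeta>)\<^sup>2)" by (simp add: algebra_simps)
    also have "\<dots> \<le> (a + 1) * 1 + 1"
      using exp_minus_square_bounds[of "Im \<zeta>"] a by (intro add_mono mult_left_mono) auto
    finally have 2: "exp (- (Im \<zeta>)\<^sup>2) * cmod (\<zeta> + 1) \<le> a + 2" by simp
    have "cmod (F \<zeta>) = exp (a\<^sup>2) * (exp (- (Im \<zeta>)\<^sup>2) * cmod (\<zeta> + 1)) *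
        cmod (\<Sum>m\<in>A. \<Sum>n\<in>A. (P \<zeta> m * g m) * (P \<zeta> n * f n) * weighted_kernel \<zeta> z T (m - n))"
      unfolding F_def norm_mult norm_exp_square \<zeta> by simp
    also have "\<dots> \<le> exp (a\<^sup>2) * (a + 2) * Ca"
      using 1 2 a by (intro mult_mono) auto
    finally show "cmod (F \<zeta>) \<le> B" by (simp add: B_def add_increasing2)
  next
    fix \<zeta> assume \<zeta>: "Re \<zeta> = - 1"
    define y where "y = Im \<zeta>"
    define M where "M = 3 + 3 * \<bar>y\<bar> + y\<^sup>2"
    have P1: "cmod (P \<zeta> m) = 1" for m using \<zeta> by (simp add: normP)
    define \<phi> where "\<phi> t = (\<zeta> + 1) * (tpow \<zeta> t * exp (\<i> * of_real t * z))" for t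
    have c\<phi>: "continuous_on {0..T} \<phi>" unfolding \<phi>_def by (intro continuous_on_mult continuous_on_const continuous_on_weight)
    \<comment> \<open>Subtracting the real symbol from z leaves Im z \<ge> 0 unchanged, so one
      constant serves all frequencies.\<close>
    have M: "cmod (integral {0..T} (\<lambda>t. \<phi> t * cis (- (t * laplace_symbol \<xi>)))) \<le> M" for \<xi> :: "real ^ 'd"
    proof -
      have "\<phi> t * cis (- (t * laplace_symbol \<xi>)) = (\<zeta> + 1) * tpow \<zeta> t * exp (\<i> * of_real t * (z - of_real (laplace_symbol \<xi>)))" for t
        unfolding \<phi>_def cis_conv_exp by (simp add: mult.assoc exp_add[symmetric] algebra_simps)
      then show ?thesis
        using oscillating_time_integral[of "z - of_real (laplace_symbol \<xi>)" T \<zeta>] z T \<zeta> by (simp add: M_def y_def)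
    qed
    have "(\<zeta> + 1) * (\<Sum>m\<in>A. \<Sum>n\<in>A. (P \<zeta> m * g m) * (P \<zeta> n * f n) * weighted_kernel \<zeta> z T (m - n))
        = (\<Sum>m\<in>A. \<Sum>n\<in>A. (P \<zeta> m * g m) * (P \<zeta> n * f n) * integral {0..T} (\<lambda>t. \<phi> t * kernel t (m - n)))"
    proof -
      have "integral {0..T} (\<lambda>t. \<phi> t * kernel t n) = (\<zeta> + 1) * weighted_kernel \<zeta> z T n" for n :: "int ^ 'd"
        unfolding weighted_kernel_def \<phi>_def mult.assoc by (rule integral_mult_right)
      then show ?thesis by (simp add: sum_distrib_left mult_ac)
    qed
    also have "cmod \<dots> \<le> M"
      by (rule bilinear_kernel_bound[OF c\<phi> A M]) (use f g in \<open>simp_all add: norm_mult P1\<close>)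
    finally have 1: "cmod ((\<zeta> + 1) * (\<Sum>m\<in>A. \<Sum>n\<in>A. (P \<zeta> m * g m) * (P \<zeta> n * f n) * weighted_kernel \<zeta> z T (m - n))) \<le> M" .
    have "cmod (F \<zeta>) = exp 1 * exp (- y\<^sup>2) * cmod ((\<zeta> + 1) * (\<Sum>m\<in>A. \<Sum>n\<in>A. (P \<zeta> m * g m) * (P \<zeta> n * f n) * weighted_kernel \<zeta> z T (m - n)))"
      unfolding F_def norm_mult[of "exp (\<zeta>\<^sup>2)"] norm_exp_square \<zeta> y_def by simp
    also have "\<dots> \<le> exp 1 * exp (- y\<^sup>2) * M" using 1 by (intro mult_left_mono) auto
    also have "\<dots> = exp 1 * (3 * exp (- y\<^sup>2) + 3 * (\<bar>y\<bar> * exp (- y\<^sup>2)) + y\<^sup>2 * exp (- y\<^sup>2))"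
      by (simp add: M_def algebra_simps)
    \<comment> \<open>7 = 3 + 3 + 1 from the three terms of M, each damped below its coefficient;
      exp 1 is the value of exp((Re \<zeta>)^2) on this line.\<close>
    also have "\<dots> \<le> exp 1 * 7"
    proof (rule mult_left_mono)
      show "3 * exp (- y\<^sup>2) + 3 * (\<bar>y\<bar> * exp (- y\<^sup>2)) + y\<^sup>2 * exp (- y\<^sup>2) \<le> 7"
        using exp_minus_square_bounds[of y] by linarith
    qed simp
    also have "\<dots> \<le> B" using a Ca0 by (simp add: B_def)
    finally show "cmod (F \<zeta>) \<le> B" .
  next
    fix \<epsilon> :: real assume \<epsilon>: "\<epsilon> > 0"
    \<comment> \<open>A bound for \<open>P\<close> on the whole strip. The double sum is then
      bounded there and the Gaussian yields decay like 1 / |Im \<zeta>|.\<close>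
    define p where "p m = exp ((a + 1) / 2 * \<bar>ln (W m)\<bar>)" for m
    define D where "D = exp ((a + 1)\<^sup>2) * ((\<Sum>m\<in>A. p m * cmod (g m)) * (\<Sum>n\<in>A. p n * cmod (f n)) * Ca)"
    have D: "D \<ge> 0" unfolding D_def using Ca0 by (auto intro!: mult_nonneg_nonneg sum_nonneg simp: p_def)
    show "\<exists>R. \<forall>\<zeta>. - 1 \<le> Re \<zeta> \<and> Re \<zeta> \<le> a \<and> R \<le> \<bar>Im \<zeta>\<bar> \<longrightarrow> cmod (F \<zeta>) \<le> \<epsilon>"
    proof (intro exI[of _ "max 1 (D * (2 * (a + 2)) / \<epsilon>)"] allI impI, elim conjE)
      fix \<zeta> assume \<zeta>: "- 1 \<le> Re \<zeta>" "Re \<zeta> \<le> a" and R: "max 1 (D * (2 * (a + 2)) / \<epsilon>) \<le> \<bar>Im \<zeta>\<bar>"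
      define y where "y = \<bar>Im \<zeta>\<bar>"
      have y: "y \<ge> 1" "D * (2 * (a + 2)) \<le> y * \<epsilon>" using R \<epsilon> by (auto simp: y_def field_simps)
      have "cmod (P \<zeta> m) \<le> p m" for m
      proof -
        have "(Re \<zeta> + 1) / 2 * ln (W m) \<le> (Re \<zeta> + 1) / 2 * \<bar>ln (W m)\<bar>" using \<zeta> by (intro mult_left_mono) auto
        also have "\<dots> \<le> (a + 1) / 2 * \<bar>ln (W m)\<bar>" using \<zeta> by (intro mult_right_mono) auto
        finally show ?thesis by (simp add: normP p_def)
      qed
      then have 1: "cmod (\<Sum>m\<in>A. \<Sum>n\<in>A. (P \<zeta> m * g m) * (P \<zeta> n * f n) * weighted_kernel \<zeta> z T (m - n))
         \<le> (\<Sum>m\<in>A. p m * cmod (g m)) * (\<Sum>n\<in>A. p n * cmod (f n)) * Ca"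
        using \<zeta> by (intro sum_bound) auto
      have 2: "exp ((Re \<zeta>)\<^sup>2) \<le> exp ((a + 1)\<^sup>2)" using \<zeta> a by (simp add: abs_le_square_iff[symmetric])
      have 3: "exp (- y\<^sup>2) * cmod (\<zeta> + 1) \<le> 2 * (a + 2) / y"
      proof -
        have "cmod (\<zeta> + 1) \<le> a + 1 + y" using zeta1 \<zeta> by (simp add: y_def)
        also have "\<dots> \<le> (a + 2) * y" using y a mult_left_mono[of 1 y "a + 1"] by (simp add: algebra_simps)
        finally have "exp (- y\<^sup>2) * cmod (\<zeta> + 1) \<le> exp (- y\<^sup>2) * ((a + 2) * y)" by (intro mult_left_mono) auto
        also have "\<dots> = (a + 2) * (y\<^sup>2 * exp (- y\<^sup>2)) / y" using y by (simp add: power2_eq_square)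
        also have "\<dots> \<le> (a + 2) * 1 / y"
          using y a exp_minus_square_bounds(3)[of y] by (intro divide_right_mono mult_left_mono) auto
        also have "\<dots> \<le> 2 * (a + 2) / y" using y a by (intro divide_right_mono) auto
        finally show ?thesis .
      qed
      have "cmod (F \<zeta>) = exp ((Re \<zeta>)\<^sup>2) * (exp (- y\<^sup>2) * cmod (\<zeta> + 1)) *
        cmod (\<Sum>m\<in>A. \<Sum>n\<in>A. (P \<zeta> m * g m) * (P \<zeta> n * f n) * weighted_kernel \<zeta> z T (m - n))"
        unfolding F_def norm_mult norm_exp_square y_def by simp
      also have "\<dots> \<le> exp ((a + 1)\<^sup>2) * (2 * (a + 2) / y) * ((\<Sum>m\<in>A. p m * cmod (g m)) * (\<Sum>n\<in>A. p n * cmod (f n)) * Ca)"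
        using 1 2 3 y a by (intro mult_mono) auto
      also have "\<dots> = D * (2 * (a + 2)) / y" by (simp add: D_def)
      also have "\<dots> \<le> \<epsilon>" using y by (simp add: divide_le_eq mult.commute)
      finally show "cmod (F \<zeta>) \<le> \<epsilon>" .
    qed
  qed (use a in auto)
  moreover have "P 0 m = of_real (sqrt (W m))" if "m \<in> A" for m
  proof -
    have "exp (ln (sqrt (W m))) = sqrt (W m)" using W(1)[OF that] by simp
    then have "complex_of_real (exp (ln (W m) / 2)) = of_real (sqrt (W m))"
      using W(1)[OF that] by (simp add: ln_sqrt)
    then show ?thesis by (simp add: P_def exp_of_real[symmetric])
  qed
  then have "F 0 = (\<Sum>m\<in>A. \<Sum>n\<in>A. (sqrt (W m) * g m) * (sqrt (W n) * f n) * weighted_kernel 0 z T (m - n))"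
    by (simp add: F_def cong: sum.cong)
  ultimately show ?thesis by (simp add: B_def)
qed

text \<open>With h the symbol, the time integral is (exp(i T (z - h)) - 1) / (i (z - h)). The term
  -1 gives -i / (h - z); the other has modulus at most exp(-T Im z) / Im z, uniformly in the
  frequency.\<close>

lemma weighted_kernel_tendsto_resolvent:
  fixes n :: "int ^ 'd::finite"
  assumes z: "Im z > 0"
  shows "((\<lambda>T. weighted_kernel 0 z T n) \<longlongrightarrow> - \<i> * resolvent_kernel z n) at_top"
proof -
  have nz: "complex_of_real (laplace_symbol \<xi>) - z \<noteq> 0" for \<xi> :: "real ^ 'd"
    using z by (intro symbol_minus_nz) simp
  have "cmod (weighted_kernel 0 z T n - - \<i> * resolvent_kernel z n) \<le> exp (- (Im z * T)) / Im z" if T: "T \<ge> 0" for T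
  proof -
    let ?w = "\<lambda>\<xi> :: real ^ 'd. z - complex_of_real (laplace_symbol \<xi>)"
    have w: "?w \<xi> \<noteq> 0" "Im (?w \<xi>) = Im z" for \<xi> using nz[of \<xi>] by auto
    have inner: "integral {0..T} (\<lambda>t. exp (\<i> * of_real t * z) * cis (- (t * laplace_symbol \<xi>)))
        = (exp (\<i> * of_real T * ?w \<xi>) - 1) / (\<i> * ?w \<xi>)" for \<xi>
    proof (rule integral_unique)
      have d: "((\<lambda>t. (1 / (\<i> * ?w \<xi>)) * exp (\<i> * of_real t * ?w \<xi>)) has_vector_derivative exp (\<i> * of_real t * z) * cis (- (t * laplace_symbol \<xi>))) (at t)" for t
      proof -
        have "exp (\<i> * of_real t * z) * cis (- (t * laplace_symbol \<xi>)) = exp (\<i> * of_real t * ?w \<xi>)"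
          unfolding cis_conv_exp by (simp add: exp_add[symmetric] algebra_simps)
        then show ?thesis
          using has_vector_derivative_mult_right[OF exp_time_deriv[of "?w \<xi>" t], of "1 / (\<i> * ?w \<xi>)"] w(1)[of \<xi>] by simp
      qed
      show "((\<lambda>t. exp (\<i> * of_real t * z) * cis (- (t * laplace_symbol \<xi>))) has_integral (exp (\<i> * of_real T * ?w \<xi>) - 1) / (\<i> * ?w \<xi>)) {0..T}"
        using fundamental_theorem_of_calculus[OF T, of "\<lambda>t. (1 / (\<i> * ?w \<xi>)) * exp (\<i> * of_real t * ?w \<xi>)"
            "\<lambda>t. exp (\<i> * of_real t * z) * cis (- (t * laplace_symbol \<xi>))"] has_vector_derivative_at_within[OF d]
        by (simp add: diff_divide_distrib)
    qed
    have cont: "continuous_on UNIV (\<lambda>\<xi>. character n \<xi> / (complex_of_real (laplace_symbol \<xi>) - z))"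
      "continuous_on UNIV (\<lambda>\<xi>. character n \<xi> * ((exp (\<i> * of_real T * ?w \<xi>) - 1) / (\<i> * ?w \<xi>)))"
      "continuous_on UNIV (\<lambda>\<xi>. character n \<xi> * exp (\<i> * of_real T * ?w \<xi>) / (\<i> * ?w \<xi>))"
      using nz w by (auto intro!: continuous_intros)
    have "weighted_kernel 0 z T n = integral {0..T} (\<lambda>t. exp (\<i> * of_real t * z) * kernel t n)"
      by (simp add: weighted_kernel_def tpow_def)
    also have "\<dots> = integral cube (\<lambda>\<xi>. character n \<xi> * ((exp (\<i> * of_real T * ?w \<xi>) - 1) / (\<i> * ?w \<xi>)))"
      unfolding inner[symmetric] by (rule time_integral_kernel) (intro continuous_intros)
    finally have wk: "weighted_kernel 0 z T n = integral cube (\<lambda>\<xi>. character n \<xi> * ((exp (\<i> * of_real T * ?w \<xi>) - 1) / (\<i> * ?w \<xi>)))" .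
    have rk: "- \<i> * resolvent_kernel z n = integral cube (\<lambda>\<xi>. - \<i> * (character n \<xi> / (complex_of_real (laplace_symbol \<xi>) - z)))"
      unfolding resolvent_kernel_def by (rule integral_mult_right[symmetric])
    have "weighted_kernel 0 z T n - - \<i> * resolvent_kernel z n =
       integral cube (\<lambda>\<xi>. character n \<xi> * ((exp (\<i> * of_real T * ?w \<xi>) - 1) / (\<i> * ?w \<xi>)))
       - integral cube (\<lambda>\<xi>. - \<i> * (character n \<xi> / (complex_of_real (laplace_symbol \<xi>) - z)))"
      unfolding wk rk ..
    also have "\<dots> = integral cube (\<lambda>\<xi>. character n \<xi> * ((exp (\<i> * of_real T * ?w \<xi>) - 1) / (\<i> * ?w \<xi>))
        - (- \<i> * (character n \<xi> / (complex_of_real (laplace_symbol \<xi>) - z))))"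
      by (rule Henstock_Kurzweil_Integration.integral_diff[symmetric]) (intro cube_integrable cont continuous_on_mult continuous_on_const)+
    also have "\<dots> = integral cube (\<lambda>\<xi>. character n \<xi> * exp (\<i> * of_real T * ?w \<xi>) / (\<i> * ?w \<xi>))"
    proof (rule integral_cong)
      fix \<xi> :: "real ^ 'd"
      have "complex_of_real (laplace_symbol \<xi>) - z = - ?w \<xi>" by simp
      moreover have "\<i> * \<i> = - 1" by simp
      ultimately show "character n \<xi> * ((exp (\<i> * of_real T * ?w \<xi>) - 1) / (\<i> * ?w \<xi>)) - (- \<i> * (character n \<xi> / (complex_of_real (laplace_symbol \<xi>) - z)))
        = character n \<xi> * exp (\<i> * of_real T * ?w \<xi>) / (\<i> * ?w \<xi>)"
        using w(1)[of \<xi>] by (simp add: divide_simps) (simp add: algebra_simps)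
    qed
    also have "cmod \<dots> \<le> integral cube (\<lambda>\<xi> :: real ^ 'd. exp (- (Im z * T)) / Im z)"
    proof (rule Henstock_Kurzweil_Integration.integral_norm_bound_integral)
      fix \<xi> :: "real ^ 'd"
      have "Im z \<le> cmod (?w \<xi>)" using abs_Im_le_cmod[of "?w \<xi>"] w(2)[of \<xi>] z by simp
      then show "cmod (character n \<xi> * exp (\<i> * of_real T * ?w \<xi>) / (\<i> * ?w \<xi>)) \<le> exp (- (Im z * T)) / Im z"
        using z w(1)[of \<xi>] by (simp add: norm_mult norm_divide frac_le mult.commute)
    qed (intro cube_integrable cont continuous_on_const)+
    also have "\<dots> = exp (- (Im z * T)) / Im z * integral cube (\<lambda>\<xi> :: real ^ 'd. 1)"
      unfolding integral_mult_right[symmetric] by (simp only: mult_1_right)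
    also have "integral cube (\<lambda>\<xi> :: real ^ 'd. 1 :: real) = 1"
    proof -
      have "complex_of_real (integral cube (\<lambda>\<xi> :: real ^ 'd. 1)) = integral cube (\<lambda>\<xi> :: real ^ 'd. complex_of_real 1)"
        by (rule integral_cube_of_real[symmetric, OF cube_integrable[OF continuous_on_const]])
      also have "\<dots> = integral (cube :: (real ^ 'd) set) (character 0)" by (rule integral_cong) simp
      finally have "complex_of_real (integral cube (\<lambda>\<xi> :: real ^ 'd. 1)) = integral cube (character (0 :: int ^ 'd))" .
      then show ?thesis by (simp only: integral_character) simp
    qed
    finally show ?thesis by simp
  qed
  then have ev: "\<forall>\<^sub>F T in at_top. cmod (weighted_kernel 0 z T n - - \<i> * resolvent_kernel z n) \<le> exp (- (Im z * T)) / Im z"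
    by (intro eventually_at_top_linorderI[of 0]) auto
  have "((\<lambda>T. exp (- (Im z * T)) / Im z) \<longlongrightarrow> 0) at_top"
    using z by real_asymp
  then show ?thesis
    by (intro LIM_zero_cancel[OF Lim_null_comparison[OF ev]])
qed

theorem bilinear_resolvent_bound:
  fixes A :: "(int ^ 'd::finite) set" and W :: "int ^ 'd \<Rightarrow> real" and f g :: "int ^ 'd \<Rightarrow> complex"
  assumes a: "a \<ge> 0" and Ca: "\<And>(n :: int ^ 'd) T. integral {0..T} (\<lambda>t. (1 + t) powr a * cmod (kernel t n)) \<le> Ca"
    and z: "Im z > 0" and A: "finite A"
    and W: "\<And>n. n \<in> A \<Longrightarrow> W n > 0" "(\<Sum>n\<in>A. W n powr (a + 1)) \<le> 1"
    and f: "(\<Sum>n\<in>A. (cmod (f n))\<^sup>2) \<le> 1" and g: "(\<Sum>n\<in>A. (cmod (g n))\<^sup>2) \<le> 1"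
  shows "cmod (\<Sum>m\<in>A. \<Sum>n\<in>A. (sqrt (W m) * g m) * (sqrt (W n) * f n) * resolvent_kernel z (m - n))
     \<le> exp (a\<^sup>2) * (a + 2) * Ca + 7 * exp 1"
proof -
  have "((\<lambda>T. cmod (\<Sum>m\<in>A. \<Sum>n\<in>A. (sqrt (W m) * g m) * (sqrt (W n) * f n) * weighted_kernel 0 z T (m - n)))
     \<longlongrightarrow> cmod (\<Sum>m\<in>A. \<Sum>n\<in>A. (sqrt (W m) * g m) * (sqrt (W n) * f n) * (- \<i> * resolvent_kernel z (m - n)))) at_top"
    by (intro tendsto_intros weighted_kernel_tendsto_resolvent z)
  moreover have "\<forall>\<^sub>F T in at_top. cmod (\<Sum>m\<in>A. \<Sum>n\<in>A. (sqrt (W m) * g m) * (sqrt (W n) * f n) * weighted_kernel 0 z T (m - n))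
      \<le> exp (a\<^sup>2) * (a + 2) * Ca + 7 * exp 1"
    using z by (intro eventually_at_top_linorderI[of 0] truncated_bilinear_bound a Ca A W f g) auto
  ultimately have "cmod (\<Sum>m\<in>A. \<Sum>n\<in>A. (sqrt (W m) * g m) * (sqrt (W n) * f n) * (- \<i> * resolvent_kernel z (m - n)))
      \<le> exp (a\<^sup>2) * (a + 2) * Ca + 7 * exp 1"
    by (intro tendsto_upperbound) auto
  moreover have "(\<Sum>m\<in>A. \<Sum>n\<in>A. (sqrt (W m) * g m) * (sqrt (W n) * f n) * (- \<i> * resolvent_kernel z (m - n)))
     = - \<i> * (\<Sum>m\<in>A. \<Sum>n\<in>A. (sqrt (W m) * g m) * (sqrt (W n) * f n) * resolvent_kernel z (m - n))"
    unfolding sum_distrib_left by (simp add: mult_ac)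
  ultimately show ?thesis by (simp only: norm_mult) simp
qed

section \<open>Uniform resolvent bounds and unitary equivalence\<close>

lemma resolvent_kernel_cnj:
  fixes n :: "int ^ 'd::finite"
  shows "resolvent_kernel (cnj z) n = cnj (resolvent_kernel z (- n))"
  unfolding resolvent_kernel_def integral_cnj by (simp add: character_uminus)

text \<open>The normalised estimate rescaled by \<kappa>, p and q. The lower half plane follows by
  conjugation, which reflects the kernel; exchanging the two summations then swaps the roles of f
  and g.\<close>

lemma resolvent_bilinear_homogeneous:
  fixes A :: "(int ^ 'd::finite) set" and W :: "int ^ 'd \<Rightarrow> real" and f g :: "int ^ 'd \<Rightarrow> complex"
  assumes a: "a \<ge> 0" and Ca: "\<And>(n :: int ^ 'd) T. integral {0..T} (\<lambda>t. (1 + t) powr a * cmod (kernel t n)) \<le> Ca"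
    and z: "Im z \<noteq> 0" and A: "finite A"
    and W: "\<And>n. W n \<ge> 0" "(\<Sum>n\<in>A. W n powr (a + 1)) \<le> \<kappa> powr (a + 1)" and \<kappa>: "\<kappa> > 0"
    and f: "(\<Sum>n\<in>A. (cmod (f n))\<^sup>2) \<le> p\<^sup>2" and g: "(\<Sum>n\<in>A. (cmod (g n))\<^sup>2) \<le> q\<^sup>2" and pq: "p > 0" "q > 0"
  shows "cmod (\<Sum>m\<in>A. \<Sum>n\<in>A. (sqrt (W m) * g m) * (sqrt (W n) * f n) * resolvent_kernel z (m - n))
     \<le> (exp (a\<^sup>2) * (a + 2) * Ca + 7 * exp 1) * \<kappa> * p * q"
proof -
  define C where "C = exp (a\<^sup>2) * (a + 2) * Ca + 7 * exp 1"
  have upper: "cmod (\<Sum>m\<in>A. \<Sum>n\<in>A. (sqrt (W m) * g m) * (sqrt (W n) * f n) * resolvent_kernel z (m - n)) \<le> C * \<kappa> * p * q"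
    if z: "Im z > 0" and f: "(\<Sum>n\<in>A. (cmod (f n))\<^sup>2) \<le> p\<^sup>2" and g: "(\<Sum>n\<in>A. (cmod (g n))\<^sup>2) \<le> q\<^sup>2" and pq: "p > 0" "q > 0"
    for z and f g :: "int ^ 'd \<Rightarrow> complex" and p q
  proof -
    \<comment> \<open>Points with W n = 0 contribute nothing to the form, and the interpolation
      takes ln (W n).\<close>
    define A' where "A' = {n \<in> A. W n > 0}"
    define W' where "W' n = W n / \<kappa>" for n
    let ?f = "\<lambda>n. f n / of_real p" and ?g = "\<lambda>n. g n / of_real q"
    have A': "finite A'" "A' \<subseteq> A" using A by (auto simp: A'_def)
    have "(\<Sum>n\<in>A'. W' n powr (a + 1)) = (\<Sum>n\<in>A'. W n powr (a + 1)) / \<kappa> powr (a + 1)"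
      using W(1) \<kappa> by (simp add: W'_def powr_divide sum_divide_distrib)
    also have "\<dots> \<le> (\<Sum>n\<in>A. W n powr (a + 1)) / \<kappa> powr (a + 1)"
      using A A' by (intro divide_right_mono sum_mono2) auto
    also have "\<dots> \<le> 1" using W(2) \<kappa> by (simp add: divide_le_eq_1)
    finally have W1: "(\<Sum>n\<in>A'. W' n powr (a + 1)) \<le> 1" .
    have norm1: "(\<Sum>n\<in>A'. (cmod (u n / of_real r))\<^sup>2) \<le> 1" if "(\<Sum>n\<in>A. (cmod (u n))\<^sup>2) \<le> r\<^sup>2" "r > 0" for u :: "int ^ 'd \<Rightarrow> complex" and r
    proof -
      have "(\<Sum>n\<in>A'. (cmod (u n / of_real r))\<^sup>2) = (\<Sum>n\<in>A'. (cmod (u n))\<^sup>2) / r\<^sup>2"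
        using that by (simp add: norm_divide power_divide sum_divide_distrib)
      also have "\<dots> \<le> (\<Sum>n\<in>A. (cmod (u n))\<^sup>2) / r\<^sup>2"
        using A A' by (intro divide_right_mono sum_mono2) auto
      also have "\<dots> \<le> 1" using that by (simp add: divide_le_eq_1)
      finally show ?thesis .
    qed
    have "cmod (\<Sum>m\<in>A'. \<Sum>n\<in>A'. (sqrt (W' m) * ?g m) * (sqrt (W' n) * ?f n) * resolvent_kernel z (m - n)) \<le> C"
      unfolding C_def
      by (rule bilinear_resolvent_bound[OF a Ca z A'(1)])
         (use \<kappa> W1 norm1[OF f pq(1)] norm1[OF g pq(2)] in \<open>auto simp: W'_def A'_def\<close>)
    moreover have "(\<Sum>m\<in>A'. \<Sum>n\<in>A'. (sqrt (W m) * g m) * (sqrt (W n) * f n) * resolvent_kernel z (m - n))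
       = of_real (\<kappa> * p * q) * (\<Sum>m\<in>A'. \<Sum>n\<in>A'. (sqrt (W' m) * ?g m) * (sqrt (W' n) * ?f n) * resolvent_kernel z (m - n))"
    proof -
      have t: "(sqrt (W m) * g m) * (sqrt (W n) * f n) * resolvent_kernel z (m - n)
         = of_real (\<kappa> * p * q) * ((sqrt (W' m) * ?g m) * (sqrt (W' n) * ?f n) * resolvent_kernel z (m - n))" for m n
      proof -
        have s: "complex_of_real (sqrt \<kappa>) * of_real (sqrt \<kappa>) = of_real \<kappa>"
          using \<kappa> by (simp flip: of_real_mult)
        have s0: "complex_of_real (sqrt \<kappa>) \<noteq> 0" using \<kappa> by simp
        show ?thesis using pq s0 unfolding W'_def real_sqrt_divide
          by (simp add: field_simps s[symmetric])
      qed
      show ?thesis unfolding sum_distrib_left t ..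
    qed
    moreover have "(\<Sum>m\<in>A. \<Sum>n\<in>A. (sqrt (W m) * g m) * (sqrt (W n) * f n) * resolvent_kernel z (m - n))
       = (\<Sum>m\<in>A'. \<Sum>n\<in>A'. (sqrt (W m) * g m) * (sqrt (W n) * f n) * resolvent_kernel z (m - n))"
    proof -
      have 0: "sqrt (W n) = 0" if "n \<in> A - A'" for n using that W(1)[of n] by (auto simp: A'_def)
      have "(\<Sum>n\<in>A. (sqrt (W m) * g m) * (sqrt (W n) * f n) * resolvent_kernel z (m - n))
          = (\<Sum>n\<in>A'. (sqrt (W m) * g m) * (sqrt (W n) * f n) * resolvent_kernel z (m - n))" for m
        using A A' 0 by (intro sum.mono_neutral_right) auto
      then show ?thesis using A A' 0 by (simp only:) (intro sum.mono_neutral_right, auto)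
    qed
    ultimately show ?thesis using \<kappa> pq mult_left_mono[of _ C "\<kappa> * p * q"] by (simp add: norm_mult abs_mult mult_ac)
  qed
  show ?thesis
  proof (cases "Im z > 0")
    case True
    then show ?thesis using upper[OF True f g pq] by (simp add: C_def)
  next
    case False
    then have z': "Im (cnj z) > 0" using z by simp
    let ?S = "\<Sum>m\<in>A. \<Sum>n\<in>A. (sqrt (W m) * cnj (f m)) * (sqrt (W n) * cnj (g n)) * resolvent_kernel (cnj z) (m - n)"
    have "(\<Sum>m\<in>A. \<Sum>n\<in>A. (sqrt (W m) * g m) * (sqrt (W n) * f n) * resolvent_kernel z (m - n))
        = cnj (\<Sum>m\<in>A. \<Sum>n\<in>A. (sqrt (W m) * cnj (g m)) * (sqrt (W n) * cnj (f n)) * resolvent_kernel (cnj z) (n - m))"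
      by (simp add: resolvent_kernel_cnj)
    also have "(\<Sum>m\<in>A. \<Sum>n\<in>A. (sqrt (W m) * cnj (g m)) * (sqrt (W n) * cnj (f n)) * resolvent_kernel (cnj z) (n - m))
        = ?S"
      by (subst sum.swap) (simp add: mult_ac)
    finally have e: "(\<Sum>m\<in>A. \<Sum>n\<in>A. (sqrt (W m) * g m) * (sqrt (W n) * f n) * resolvent_kernel z (m - n)) = cnj ?S" .
    have "cmod ?S \<le> C * \<kappa> * q * p"
      by (rule upper[OF z']) (use f g pq in simp_all)
    then show ?thesis unfolding e complex_mod_cnj C_def by (simp only: mult_ac)
  qed
qed

lemma lp_space_summable: "V \<in> lp_space s \<Longrightarrow> (\<lambda>n. norm (V n) powr s) summable_on UNIV"
  by (simp add: lp_space_def)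

lemma lp_norm_powr:
  assumes "s > 0" "V \<in> lp_space s"
  shows "lp_norm s V powr s = (\<Sum>\<^sub>\<infinity>n. norm (V n) powr s)"
  using assms by (simp add: lp_norm_def powr_powr infsum_nonneg)

lemma lp_norm_nonneg: "lp_norm s V \<ge> 0" by (simp add: lp_norm_def)

lemma norm_le_lp_norm:
  assumes s: "s > 0" and V: "V \<in> lp_space s"
  shows "norm (V n) \<le> lp_norm s V"
proof -
  have "norm (V n) powr s \<le> (\<Sum>\<^sub>\<infinity>n. norm (V n) powr s)"
    using finite_sum_le_infsum[OF lp_space_summable[OF V], of "{n}"] by simp
  then have "(norm (V n) powr s) powr (1 / s) \<le> (lp_norm s V powr s) powr (1 / s)"
    unfolding lp_norm_powr[OF s V] using s by (intro powr_mono2) auto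
  then show ?thesis using s by (simp add: powr_powr lp_norm_nonneg)
qed

lemma norm_abs_sqrt: "cmod (abs_sqrt V n) = sqrt (norm (V n))"
  by (simp add: abs_sqrt_def)

lemma norm_signed_sqrt: "cmod (signed_sqrt V n) = sqrt (norm (V n))"
  by (simp add: signed_sqrt_def norm_divide real_div_sqrt)

text \<open>The bilinear estimate with W = |V| and a = s - 1, so that the (a + 1)-th power sum of W
  is bounded by the s-th power of the norm of V. The hypothesis on s is the hypothesis on a in
  \<open>kernel_time_bound\<close>.\<close>

theorem weighted_resolvent_bound:
  assumes d: "CARD('d::finite) = 4 \<and> 1 \<le> s \<and> s < 2 \<or> CARD('d) \<ge> 5 \<and> 1 \<le> s \<and> s \<le> (real CARD('d) + 2) / 3"
  shows "\<exists>C\<ge>0. \<forall>V :: int ^ 'd \<Rightarrow> complex. V \<in> lp_space s \<longrightarrow> (\<forall>z x. Im z \<noteq> 0 \<longrightarrow>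
     norm (mulop (abs_sqrt V) (resolvent lattice_laplacian z (mulop (abs_sqrt V) x))) \<le> C * lp_norm s V * norm x)"
proof -
  define a where "a = s - 1"
  have a: "a \<ge> 0" "CARD('d) = 4 \<and> a < 1 \<or> CARD('d) \<ge> 5 \<and> a \<le> (real CARD('d) - 1) / 3"
    using d by (auto simp: a_def)
  have s: "s \<ge> 1" "s > 0" using d by auto
  obtain Ca where Ca0: "Ca \<ge> 0" and Ca: "\<And>(n :: int ^ 'd) T. integral {0..T} (\<lambda>t. (1 + t) powr a * cmod (kernel t n)) \<le> Ca"
    using kernel_time_bound[OF a] by blast
  define C where "C = exp (a\<^sup>2) * (a + 2) * Ca + 7 * exp 1"
  have C: "C \<ge> 0" using a Ca0 by (simp add: C_def)
  show ?thesis
  proof (intro exI[of _ C] conjI C allI impI)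
    fix V :: "int ^ 'd \<Rightarrow> complex" and z x
    assume V: "V \<in> lp_space s" and z: "Im z \<noteq> 0"
    define \<kappa> where "\<kappa> = lp_norm s V"
    have b: "cmod (abs_sqrt V n) \<le> sqrt \<kappa>" for n
      unfolding norm_abs_sqrt \<kappa>_def using norm_le_lp_norm[OF s(2) V, of n] by simp
    let ?A = "mulop (abs_sqrt V)"
    define T where "T x = ?A (resolvent lattice_laplacian z (?A x))" for x
    have clA: "clin ?A" by (rule clin_mulop[OF b])
    have clT: "clin T" unfolding T_def by (intro clin_compose[OF clA] clin_compose[OF L.clin_resolvent[OF z]] clA)
    show "norm (T x) \<le> C * lp_norm s V * norm x" unfolding \<kappa>_def[symmetric]
    proof (rule clin_norm_le_of_truncate[OF clT])
      show "0 \<le> C * \<kappa>" using C by (simp add: \<kappa>_def lp_norm_nonneg)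
      fix F :: "(int ^ 'd) set" and x y :: "(int ^ 'd) ell2"
      assume F: "finite F"
      let ?w = "\<lambda>n. sqrt (norm (V n))"
      \<comment> \<open>The homogeneous estimate normalises by \<kappa> and the norms of x and y, so
        their zeros are treated apart.\<close>
      show "inner (T (truncate F x)) (truncate F y) \<le> C * \<kappa> * norm x * norm y"
      proof (cases "\<kappa> = 0 \<or> x = 0 \<or> y = 0")
        case True
        have "T (truncate F x) = 0 \<or> truncate F y = 0"
        proof -
          have t0: "truncate F 0 = 0" by (rule ell2_eqI) simp
          have V0: "V n = 0" if "\<kappa> = 0" for n
            using norm_le_lp_norm[OF s(2) V, of n] that by (simp add: \<kappa>_def)
          have "T u = 0" if "\<kappa> = 0" for u
            unfolding T_def by (intro ell2_eqI) (simp add: coord_mulop[OF b] abs_sqrt_def V0[OF that])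
          then show ?thesis using True t0 clin_0[OF clT] by auto
        qed
        then have "inner (T (truncate F x)) (truncate F y) = 0" by auto
        then show ?thesis using C by (simp add: \<kappa>_def lp_norm_nonneg)
      next
        case False
        then have pos: "\<kappa> > 0" "norm x > 0" "norm y > 0" using lp_norm_nonneg[of s V] by (auto simp: \<kappa>_def)
        have tr: "?A (truncate F x) = (\<Sum>k\<in>F. (?w k * coord x k) *\<^sub>C ket k)"
          by (rule ell2_eqI) (simp add: coord_mulop[OF b] abs_sqrt_def F if_distrib[of "\<lambda>u. _ * u"] sum.delta' cong: if_cong)
        have Tc: "coord (T (truncate F x)) m = ?w m * (\<Sum>k\<in>F. (?w k * coord x k) * resolvent_kernel z (m - k))" for m
          unfolding T_def tr
          by (simp add: coord_mulop[OF b] abs_sqrt_def clin_sum[OF L.clin_resolvent[OF z]] clin_scaleC[OF L.clin_resolvent[OF z]]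
              coord_resolvent_ket[OF z])
        have "inner (T (truncate F x)) (truncate F y) = (\<Sum>m\<in>F. Re (coord (T (truncate F x)) m * cnj (coord y m)))"
          unfolding inner_ell2_def
          by (subst infsum_cong_neutral[where T = F and g = "\<lambda>m. Re (coord (T (truncate F x)) m * cnj (coord y m))"]) (use F in auto)
        also have "\<dots> = Re (\<Sum>m\<in>F. \<Sum>n\<in>F. (?w m * cnj (coord y m)) * (?w n * coord x n) * resolvent_kernel z (m - n))"
          unfolding Tc Re_sum sum_distrib_left sum_distrib_right by (simp add: mult_ac)
        also have "\<dots> \<le> cmod (\<Sum>m\<in>F. \<Sum>n\<in>F. (?w m * cnj (coord y m)) * (?w n * coord x n) * resolvent_kernel z (m - n))"
          by (rule complex_Re_le_cmod)
        also have "\<dots> \<le> C * \<kappa> * norm x * norm y"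
          unfolding C_def
        proof (rule resolvent_bilinear_homogeneous[OF a(1) Ca z F])
          show "(\<Sum>n\<in>F. norm (V n) powr (a + 1)) \<le> \<kappa> powr (a + 1)"
            using finite_sum_le_infsum[OF lp_space_summable[OF V] F] lp_norm_powr[OF s(2) V] by (simp add: a_def \<kappa>_def)
        qed (use pos sum_coord_square_le[OF F] in auto)
        finally show ?thesis .
      qed
    qed
  qed
qed

section \<open>Return to operators on sequences\<close>

lemma coord_ell2_of: "f \<in> lp_space 2 \<Longrightarrow> coord (ell2_of f) = f"
  by (rule ell2_of_inverse)

text \<open>Uniqueness of the resolvent equation is injectivity on \<open>lp_space 2\<close>, which
  is what evaluating \<open>the_inv_into\<close> requires.\<close>

lemma free_resolvent_coord:
  fixes x :: "(int ^ 'd::finite) ell2"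
  assumes z: "Im z \<noteq> 0"
  shows "free_resolvent z (coord x) = coord (resolvent lattice_laplacian z x)"
  unfolding free_resolvent_def
proof (rule the_inv_into_f_eq)
  have e: "(\<lambda>n. discrete_laplacian (coord u) n - z * coord u n) = coord (lattice_laplacian u - z *\<^sub>C u)" for u :: "(int ^ 'd) ell2"
    by (simp add: discrete_laplacian_coord fun_eq_iff)
  show "inj_on (\<lambda>u n. discrete_laplacian u n - z * u n) (lp_space 2 :: (int ^ 'd \<Rightarrow> complex) set)"
  proof (rule inj_onI)
    fix f g :: "int ^ 'd \<Rightarrow> complex"
    assume f: "f \<in> lp_space 2" and g: "g \<in> lp_space 2"
      and eq: "(\<lambda>n. discrete_laplacian f n - z * f n) = (\<lambda>n. discrete_laplacian g n - z * g n)"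
    have "coord (lattice_laplacian (ell2_of f) - z *\<^sub>C ell2_of f) = coord (lattice_laplacian (ell2_of g) - z *\<^sub>C ell2_of g)"
      using eq unfolding e[symmetric] coord_ell2_of[OF f] coord_ell2_of[OF g] .
    then have "lattice_laplacian (ell2_of f) - z *\<^sub>C ell2_of f = lattice_laplacian (ell2_of g) - z *\<^sub>C ell2_of g"
      by (simp add: coord_inject)
    then have "ell2_of f = ell2_of g" using L.resolvent_ex1[OF z] by metis
    then show "f = g" using coord_ell2_of[OF f] coord_ell2_of[OF g] by metis
  qed
  show "(\<lambda>n. discrete_laplacian (coord (resolvent lattice_laplacian z x)) n - z * coord (resolvent lattice_laplacian z x) n) = coord x"
    unfolding e L.resolvent_eq[OF z] ..
qed simp

lemma linear_op_of_clin:
  assumes T: "clin T" and B: "\<And>f. f \<in> lp_space 2 \<Longrightarrow> B f = coord (T (ell2_of f))"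
  shows "linear_op B"
  unfolding linear_op_def
proof (intro conjI ballI allI)
  fix f g :: "'a \<Rightarrow> complex" and c assume f: "f \<in> lp_space 2"
  show "B f \<in> lp_space 2" by (simp add: B f)
  have cf: "(\<lambda>n. c * f n) \<in> lp_space 2" by (rule lp_space_2_mult[OF f order_refl])
  have "ell2_of (\<lambda>n. c * f n) = c *\<^sub>C ell2_of f"
    using f cf by (intro ell2_eqI) (simp add: coord_ell2_of)
  then show "B (\<lambda>n. c * f n) = (\<lambda>n. c * B f n)"
    by (simp add: B f cf clin_scaleC[OF T] fun_eq_iff)
  assume g: "g \<in> lp_space 2"
  have fg: "(\<lambda>n. f n + g n) \<in> lp_space 2" by (rule lp_space_2_add[OF f g])
  have "ell2_of (\<lambda>n. f n + g n) = ell2_of f + ell2_of g"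
    using f g fg by (intro ell2_eqI) (simp add: coord_ell2_of)
  then show "B (\<lambda>n. f n + g n) = (\<lambda>n. B f n + B g n)"
    by (simp add: B f g fg clin_add[OF T] fun_eq_iff)
qed

lemma op_norm_le:
  assumes T: "clin T" and B: "\<And>x. B (coord x) = coord (T x)" and K: "K \<ge> 0" "\<And>x. norm (T x) \<le> K * norm x"
  shows "op_norm B \<le> ennreal K"
proof -
  have B': "B f = coord (T (ell2_of f))" if "f \<in> lp_space 2" for f
    using B[of "ell2_of f"] that by (simp add: coord_ell2_of)
  have n: "norm (ell2_of f) = lp_norm 2 f" if "f \<in> lp_space 2" for f
    using that by (simp add: norm_ell2 coord_ell2_of)
  have le: "lp_norm 2 (B f) \<le> K * lp_norm 2 f" if "f \<in> lp_space 2" for f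
    using K(2)[of "ell2_of f"] n[OF that] by (simp add: B'[OF that] norm_ell2[symmetric])
  have lin: "linear_op B" using T B' by (rule linear_op_of_clin)
  then have bo: "bounded_op B" unfolding bounded_op_def using le by blast
  have "(SUP f\<in>{f \<in> lp_space 2. lp_norm 2 f \<le> 1}. lp_norm 2 (B f)) \<le> K"
  proof (rule cSUP_least)
    have "coord 0 \<in> {f \<in> lp_space 2. lp_norm 2 f \<le> 1}" by (simp add: norm_ell2[symmetric])
    then show "{f \<in> lp_space 2. lp_norm 2 f \<le> 1} \<noteq> ({} :: ('a \<Rightarrow> complex) set)" by blast
    fix f :: "'a \<Rightarrow> complex" assume f: "f \<in> {f \<in> lp_space 2. lp_norm 2 f \<le> 1}"
    then have "lp_norm 2 (B f) \<le> K * lp_norm 2 f" by (intro le) simp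
    also have "\<dots> \<le> K * 1" using f K by (intro mult_left_mono) auto
    finally show "lp_norm 2 (B f) \<le> K" by simp
  qed
  then show ?thesis using bo by (simp add: op_norm_def ennreal_leI)
qed

lemma l2_inner_coord: "l2_inner (coord x) (coord y) = Complex (inner x y) (inner ((- \<i>) *\<^sub>C x) y)"
proof -
  have s: "(\<lambda>n. coord x n * cnj (coord y n)) summable_on UNIV"
    by (intro lp_space_2_prod_summable) auto
  have "Re (l2_inner (coord x) (coord y)) = inner x y"
    unfolding l2_inner_def inner_ell2_def by (rule infsum_Re[OF s, symmetric])
  moreover have "Im (l2_inner (coord x) (coord y)) = inner ((- \<i>) *\<^sub>C x) y"
    unfolding l2_inner_def inner_ell2_def infsum_Im[OF s, symmetric] by (intro infsum_cong) simp
  ultimately show ?thesis by (simp add: complex_eq_iff)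
qed

text \<open>Polarisation preserves the real inner product; complex linearity carries the factor -i
  through W and so preserves the imaginary part of the Hermitian product.\<close>

lemma unitary_op_of_isometry:
  assumes W: "clin W" "bij W" "\<And>x. norm (W x) = norm x"
  shows "unitary_op (\<lambda>f. coord (W (ell2_of f)))"
proof -
  have inner: "inner (W x) (W y) = inner x y" for x y
    by (simp add: dot_norm clin_add[OF W(1), symmetric] W(3))
  have lin: "linear_op (\<lambda>f. coord (W (ell2_of f)))" using W(1) by (rule linear_op_of_clin) simp
  have "bij_betw (\<lambda>f. coord (W (ell2_of f))) (lp_space 2) (lp_space 2)"
  proof (rule bij_betw_byWitness[where f' = "\<lambda>f. coord (inv W (ell2_of f))"])
    show "\<forall>f\<in>lp_space 2. coord (inv W (ell2_of (coord (W (ell2_of f))))) = f"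
      using W(2) by (simp add: coord_inverse bij_is_inj coord_ell2_of)
    show "\<forall>f\<in>lp_space 2. coord (W (ell2_of (coord (inv W (ell2_of f))))) = f"
      using W(2) by (simp add: coord_inverse bij_is_surj surj_f_inv_f coord_ell2_of)
  qed auto
  moreover have "l2_inner (coord (W (ell2_of f))) (coord (W (ell2_of g))) = l2_inner f g"
    if "f \<in> lp_space 2" "g \<in> lp_space 2" for f g
  proof -
    have "l2_inner (coord (W (ell2_of f))) (coord (W (ell2_of g))) = l2_inner (coord (ell2_of f)) (coord (ell2_of g))"
      unfolding l2_inner_coord clin_scaleC[OF W(1), symmetric] inner ..
    then show ?thesis using that by (simp add: coord_ell2_of)
  qed
  ultimately show ?thesis using lin by (simp add: unitary_op_def)
qed

theorem proposition2p1:
  fixes s :: real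
  assumes "CARD('d::finite) = 4 \<and> 1 \<le> s \<and> s < 2 \<or>
           CARD('d) \<ge> 5 \<and> 1 \<le> s \<and> s \<le> (real CARD('d) + 2) / 3"
  shows "(\<exists>C\<ge>0. \<forall>V :: int ^ 'd \<Rightarrow> complex. V \<in> lp_space s \<longrightarrow>
            (SUP z\<in>UNIV - \<real>.
               op_norm (mult_op (abs_sqrt V) \<circ> free_resolvent z \<circ> mult_op (signed_sqrt V)))
              \<le> ennreal (C * lp_norm s V)) \<and>
         (\<forall>V :: int ^ 'd \<Rightarrow> complex. V \<in> lp_space s \<longrightarrow> (\<forall>n. V n \<in> \<real>) \<longrightarrow>
            (\<exists>\<gamma>\<^sub>0>0. \<forall>\<gamma>::real. \<bar>\<gamma>\<bar> < \<gamma>\<^sub>0 \<longrightarrow>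
               unitarily_equivalent
                 (\<lambda>f n. discrete_laplacian f n + mult_op (\<lambda>k. complex_of_real \<gamma> * V k) f n)
                 discrete_laplacian))"
proof -
  obtain C where C: "C \<ge> 0"
    and bound: "\<And>(V :: int ^ 'd \<Rightarrow> complex) z x. V \<in> lp_space s \<Longrightarrow> Im z \<noteq> 0 \<Longrightarrow>
      norm (mulop (abs_sqrt V) (resolvent lattice_laplacian z (mulop (abs_sqrt V) x))) \<le> C * lp_norm s V * norm x"
    using weighted_resolvent_bound[OF assms] by blast
  have s: "s > 0" using assms by auto
  \<comment> \<open>The phase of V, kept of modulus one at the zeros. It gives V^(1/2) = |V|^(1/2)
    \<open>ph\<close>, which reduces the first claim to the symmetric sandwich; for real V it is a
    sign, so \<gamma> V = A S A with S symmetric.\<close>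
  define ph where "ph V n = (if V n = 0 then 1 else V n / of_real (norm (V n)))" for V :: "int ^ 'd \<Rightarrow> complex" and n
  have ph: "cmod (ph V n) \<le> 1" for V n by (simp add: ph_def norm_divide)
  have root: "cmod (abs_sqrt V n) \<le> sqrt (lp_norm s V)" if "V \<in> lp_space s" for V :: "int ^ 'd \<Rightarrow> complex" and n
    unfolding norm_abs_sqrt using norm_le_lp_norm[OF s that, of n] by simp
  have sroot: "cmod (signed_sqrt V n) \<le> sqrt (lp_norm s V)" if "V \<in> lp_space s" for V :: "int ^ 'd \<Rightarrow> complex" and n
    unfolding norm_signed_sqrt using norm_le_lp_norm[OF s that, of n] by simp
  have sq: "complex_of_real (sqrt r) * of_real (sqrt r) = of_real r" if "r \<ge> 0" for r
    using that by (simp flip: of_real_mult)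
  have polar: "signed_sqrt V n = abs_sqrt V n * ph V n" for V n
    using sq[of "norm (V n)"] by (auto simp: signed_sqrt_def abs_sqrt_def ph_def field_simps)
  have "op_norm (mult_op (abs_sqrt V) \<circ> free_resolvent z \<circ> mult_op (signed_sqrt V)) \<le> ennreal (C * lp_norm s V)"
    if V: "V \<in> lp_space s" and z: "z \<in> UNIV - \<real>" for V :: "int ^ 'd \<Rightarrow> complex" and z
  proof -
    have z: "Im z \<noteq> 0" using z by (simp add: complex_is_Real_iff)
    define T where "T x = mulop (abs_sqrt V) (resolvent lattice_laplacian z (mulop (signed_sqrt V) x))" for x
    have cl: "clin T" unfolding T_def
      by (intro clin_compose[OF clin_mulop[OF root[OF V]]] clin_compose[OF L.clin_resolvent[OF z]] clin_mulop[OF sroot[OF V]])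
    have "mult_op (signed_sqrt V) (coord x) = coord (mulop (signed_sqrt V) x)" for x
      by (simp add: mult_op_def fun_eq_iff coord_mulop[OF sroot[OF V]])
    moreover have "mult_op (abs_sqrt V) (coord x) = coord (mulop (abs_sqrt V) x)" for x
      by (simp add: mult_op_def fun_eq_iff coord_mulop[OF root[OF V]])
    ultimately have B: "(mult_op (abs_sqrt V) \<circ> free_resolvent z \<circ> mult_op (signed_sqrt V)) (coord x) = coord (T x)" for x
      by (simp add: T_def free_resolvent_coord[OF z])
    have "norm (T x) \<le> C * lp_norm s V * norm x" for x
    proof -
      have "mulop (signed_sqrt V) x = mulop (abs_sqrt V) (mulop (ph V) x)"
        by (rule ell2_eqI) (simp add: coord_mulop[OF sroot[OF V]] coord_mulop[OF root[OF V]] coord_mulop[OF ph] polar)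
      then have "norm (T x) \<le> C * lp_norm s V * norm (mulop (ph V) x)"
        unfolding T_def using bound[OF V z] by simp
      also have "\<dots> \<le> C * lp_norm s V * norm x"
        using norm_mulop_le[where c = "ph V" and B = 1, OF ph, of x] C by (intro mult_left_mono) (auto simp: lp_norm_nonneg)
      finally show ?thesis .
    qed
    then show ?thesis using C by (intro op_norm_le[OF cl B]) (auto simp: lp_norm_nonneg)
  qed
  then have part1: "\<exists>C\<ge>0. \<forall>V :: int ^ 'd \<Rightarrow> complex. V \<in> lp_space s \<longrightarrow>
            (SUP z\<in>UNIV - \<real>. op_norm (mult_op (abs_sqrt V) \<circ> free_resolvent z \<circ> mult_op (signed_sqrt V)))
              \<le> ennreal (C * lp_norm s V)"
    using C by (intro exI[of _ C] conjI allI impI SUP_least) auto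
  have part2: "\<exists>\<gamma>\<^sub>0>0. \<forall>\<gamma>::real. \<bar>\<gamma>\<bar> < \<gamma>\<^sub>0 \<longrightarrow>
               unitarily_equivalent
                 (\<lambda>f n. discrete_laplacian f n + mult_op (\<lambda>k. complex_of_real \<gamma> * V k) f n)
                 discrete_laplacian"
    if V: "V \<in> lp_space s" and real: "\<forall>n. V n \<in> \<real>" for V :: "int ^ 'd \<Rightarrow> complex"
  proof -
    define K where "K = C * lp_norm s V"
    have K: "K \<ge> 0" using C by (simp add: K_def lp_norm_nonneg)
    let ?A = "mulop (abs_sqrt V)"
    have symA: "symop ?A" by (rule symop_mulop[OF root[OF V]]) (simp add: abs_sqrt_def)
    \<comment> \<open>This threshold gives |\<gamma>| K \<le> 1/2, as
      \<open>smooth_perturbation\<close> asks; the 1 in the denominator covers K = 0.\<close>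
    show ?thesis
    proof (intro exI[of _ "1 / (2 * K + 1)"] conjI allI impI)
      show "0 < 1 / (2 * K + 1)" using K by simp
      fix \<gamma> :: real assume \<gamma>: "\<bar>\<gamma>\<bar> < 1 / (2 * K + 1)"
      define S where "S = mulop (\<lambda>n. of_real \<gamma> * ph V n)"
      have bS: "cmod (of_real \<gamma> * ph V n) \<le> \<bar>\<gamma>\<bar>" for n
        using mult_left_mono[OF ph[of V n], of "\<bar>\<gamma>\<bar>"] by (simp add: norm_mult)
      have symS: "symop S" unfolding S_def
        by (rule symop_mulop[OF bS]) (use real in \<open>auto simp: ph_def intro!: Reals_mult Reals_divide\<close>)
      have "\<bar>\<gamma>\<bar> * (2 * K + 1) \<le> 1" using \<gamma> K by (simp add: less_divide_eq)
      then have small: "\<bar>\<gamma>\<bar> * K \<le> 1 / 2" by (simp add: algebra_simps)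
      have "\<exists>W :: (int ^ 'd) ell2 \<Rightarrow> (int ^ 'd) ell2. clin W \<and> bij W \<and> (\<forall>x. norm (W x) = norm x)
          \<and> (\<forall>x. lattice_laplacian (W x) + ?A (S (?A (W x))) = W (lattice_laplacian x))"
      proof (rule smooth_perturbation[OF symop_lattice_laplacian symA symS _ _ K abs_ge_zero small])
        show "norm (?A (resolvent lattice_laplacian z (?A x))) \<le> K * norm x" if "Im z \<noteq> 0" for z x
          unfolding K_def by (rule bound[OF V that])
        show "norm (S x) \<le> \<bar>\<gamma>\<bar> * norm x" for x
          unfolding S_def by (rule norm_mulop_le[OF bS])
      qed
      then obtain W :: "(int ^ 'd) ell2 \<Rightarrow> (int ^ 'd) ell2" where W: "clin W" "bij W" "\<And>x. norm (W x) = norm x"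
        and int: "\<And>x. lattice_laplacian (W x) + ?A (S (?A (W x))) = W (lattice_laplacian x)"
        by blast
      have ASA: "coord (?A (S (?A y))) n = of_real \<gamma> * V n * coord y n" for y n
      proof -
        have "coord (?A (S (?A y))) n = (of_real (sqrt (norm (V n))) * of_real (sqrt (norm (V n)))) * (of_real \<gamma> * ph V n * coord y n)"
          by (simp add: S_def coord_mulop[OF root[OF V]] coord_mulop[OF bS] abs_sqrt_def mult_ac)
        also have "\<dots> = of_real \<gamma> * V n * coord y n"
          by (subst sq) (auto simp: ph_def)
        finally show ?thesis .
      qed
      have "(\<lambda>n. discrete_laplacian (coord (W (ell2_of f))) n + mult_op (\<lambda>k. complex_of_real \<gamma> * V k) (coord (W (ell2_of f))) n)
          = coord (W (ell2_of (discrete_laplacian f)))" if f: "f \<in> lp_space 2" for f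
      proof -
        have "discrete_laplacian f = coord (lattice_laplacian (ell2_of f))"
          using discrete_laplacian_coord[of "ell2_of f"] f by (simp add: coord_ell2_of)
        then have "W (ell2_of (discrete_laplacian f)) = lattice_laplacian (W (ell2_of f)) + ?A (S (?A (W (ell2_of f))))"
          by (simp add: coord_inverse int)
        then show ?thesis by (simp add: fun_eq_iff discrete_laplacian_coord mult_op_def ASA)
      qed
      then show "unitarily_equivalent (\<lambda>f n. discrete_laplacian f n + mult_op (\<lambda>k. complex_of_real \<gamma> * V k) f n) discrete_laplacian"
        unfolding unitarily_equivalent_def using unitary_op_of_isometry[OF W] by blast
    qed
  qed
  show ?thesis using part1 part2 by blast
qed

end
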